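(* Let $h$ be hyperbolic with respect to $\mathbf{e}\in\mathbb{R}^n$, let $r,m$ be positive integers and $\epsilon>0$. Let $\mathsf{X}_1,\dots,\mathsf{X}_m$ be independent random vectors in $\Lambda_+(h,\mathbf{e})$ with finite supports such that $\sum_{i=1}^m\mathbb{E}\mathsf{X}_i=\mathbf{e}$, $\operatorname{tr}(\mathbb{E}\mathsf{X}_i)\leq\epsilon$ and $\operatorname{rk}(\mathbb{E}\mathsf{X}_i)\leq r$ for all $1\leq i\leq m$. Then $$\mathbb{P}\left[\lambda_{\max}\Big(\sum_{i=1}^m\mathsf{X}_i\Big)\leq\delta(\epsilon,m,r)\right]>0.$$
   Context: $h\in\mathbb{R}[x_1,\dots,x_n]$ homogeneous of degree $d$ is hyperbolic with respect to $\mathbf{e}$ if $h(\mathbf{e})\neq0$ and $t\mapsto h(t\mathbf{e}-\mathbf{x})$ has only real zeros for all $\mathbf{x}$; write $h(t\mathbf{e}-\mathbf{x})=h(\mathbf{e})\prod_{j=1}^d(t-\lambda_j(\mathbf{x}))$, $\lambda_{\max}(\mathbf{x})=\max_j\lambda_j(\mathbf{x})$. $\Lambda_+(h,\mathbf{e})=\{\mathbf{x}:\min_j\lambda_j(\mathbf{x})\geq0\}$, $\operatorname{tr}(\mathbf{x})=\sum_j\lambda_j(\mathbf{x})$, $\operatorname{rk}(\mathbf{x})=\#\{j:\lambda_j(\mathbf{x})\neq0\}$. For a positive integer $r$, $U_r$ is the set of pairs $(\delta,\mu)$ of positive reals such that $$\delta-1\geq\frac{\delta}{\mu}\cdot\frac{\left(1+\frac{\delta}{r\mu}\right)^{r-1}-\left(\frac{\delta}{r\mu}\right)^{r-1}}{\left(1+\frac{\delta}{r\mu}\right)^{r}-\left(\frac{\delta}{r\mu}\right)^{r}},$$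 and either $\mu>1$, or ($1\leq\delta\leq2$ and $\mu>1-\delta/r$); and $\delta(\epsilon,m,r)=\inf\left\{\frac{\epsilon\mu+(1-\frac1m)\delta}{1-\frac1m+\frac{\mu}{m}}:(\delta,\mu)\in U_r\right\}$. *)

theory Defs
  imports
    "HOL-Probability.Probability"
    "HOL-Library.Poly_Mapping"
    "HOL-Computational_Algebra.Computational_Algebra"
begin

text \<open>A polynomial in \<open>\<real>[x\<^sub>i : i \<in> 'n]\<close>: exponent vectors are mapped to coefficients.\<close>

type_synonym 'n rpoly = "('n \<Rightarrow>\<^sub>0 nat) \<Rightarrow>\<^sub>0 real"

text \<open>Evaluation is possible in every field extension of the reals, since hyperbolicity refers
  to complex zeros.\<close>

definition evalp :: "'n::finite rpoly \<Rightarrow> 'b::real_field ^ 'n \<Rightarrow> 'b" where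
  "evalp h x = (\<Sum>k\<in>Poly_Mapping.keys h.
     of_real (Poly_Mapping.lookup h k) * (\<Prod>i\<in>UNIV. (x $ i) ^ Poly_Mapping.lookup k i))"

definition homogeneous :: "nat \<Rightarrow> 'n::finite rpoly \<Rightarrow> bool" where
  "homogeneous d h \<longleftrightarrow>
     (\<forall>k\<in>Poly_Mapping.keys h. (\<Sum>i\<in>UNIV. Poly_Mapping.lookup k i) = d)"

definition hyperbolic :: "nat \<Rightarrow> 'n::finite rpoly \<Rightarrow> real ^ 'n \<Rightarrow> bool" where
  "hyperbolic d h e \<longleftrightarrow> homogeneous d h \<and> evalp h e \<noteq> 0 \<and>
     (\<forall>x :: real ^ 'n. \<forall>t :: complex.
        evalp h (\<chi> i. t * of_real (e $ i) - of_real (x $ i)) = 0 \<longrightarrow> t \<in> \<real>)"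

text \<open>The multiset of the numbers \<open>\<lambda>\<^sub>1(x), \<dots>, \<lambda>\<^sub>d(x)\<close>. It is well defined for hyperbolic \<open>h\<close>:
  see \<open>ex1_eigenvalues\<close> and \<open>eigenvalues\<close> below.\<close>

definition eigenvalues :: "'n::finite rpoly \<Rightarrow> real ^ 'n \<Rightarrow> real ^ 'n \<Rightarrow> real multiset" where
  "eigenvalues h e x =
     (THE L. \<forall>t::real. evalp h (t *\<^sub>R e - x) = evalp h e * (\<Prod>l\<in>#L. t - l))"

text \<open>\<open>lambda_max\<close> and \<open>lambda_min\<close> are meaningful only in positive degree.\<close>

definition lambda_max :: "'n::finite rpoly \<Rightarrow> real ^ 'n \<Rightarrow> real ^ 'n \<Rightarrow> real" where
  "lambda_max h e x = Max (set_mset (eigenvalues h e x))"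

definition lambda_min :: "'n::finite rpoly \<Rightarrow> real ^ 'n \<Rightarrow> real ^ 'n \<Rightarrow> real" where
  "lambda_min h e x = Min (set_mset (eigenvalues h e x))"

definition Lambda_plus :: "'n::finite rpoly \<Rightarrow> real ^ 'n \<Rightarrow> (real ^ 'n) set" where
  "Lambda_plus h e = {x. lambda_min h e x \<ge> 0}"

definition tr :: "'n::finite rpoly \<Rightarrow> real ^ 'n \<Rightarrow> real ^ 'n \<Rightarrow> real" where
  "tr h e x = (\<Sum>l\<in>#eigenvalues h e x. l)"

definition rk :: "'n::finite rpoly \<Rightarrow> real ^ 'n \<Rightarrow> real ^ 'n \<Rightarrow> nat" where
  "rk h e x = size {#l \<in># eigenvalues h e x. l \<noteq> 0#}"

definition U :: "nat \<Rightarrow> (real \<times> real) set" where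
  "U r = {(\<delta>, \<mu>). \<delta> > 0 \<and> \<mu> > 0 \<and>
     \<delta> - 1 \<ge> \<delta> / \<mu> *
       (((1 + \<delta> / (real r * \<mu>)) ^ (r - 1) - (\<delta> / (real r * \<mu>)) ^ (r - 1)) /
        ((1 + \<delta> / (real r * \<mu>)) ^ r - (\<delta> / (real r * \<mu>)) ^ r)) \<and>
     (\<mu> > 1 \<or> (1 \<le> \<delta> \<and> \<delta> \<le> 2 \<and> \<mu> > 1 - \<delta> / real r))}"

definition delta :: "real \<Rightarrow> nat \<Rightarrow> nat \<Rightarrow> real" where
  "delta \<epsilon> m r = (INF (\<delta>, \<mu>)\<in>U r.
     (\<epsilon> * \<mu> + (1 - 1 / real m) * \<delta>) / (1 - 1 / real m + \<mu> / real m))"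


subsection \<open>The eigenvalues are well defined\<close>

lemma real_rooted_poly_splits:
  fixes p :: "real poly"
  assumes "p \<noteq> 0" "\<And>z::complex. poly (map_poly of_real p) z = 0 \<Longrightarrow> z \<in> \<real>"
  shows "\<exists>L. size L = degree p \<and> p = smult (lead_coeff p) (\<Prod>l\<in>#L. [:-l, 1:])"
  using assms
proof (induction "degree p" arbitrary: p)
  case 0
  then obtain c where "p = [:c:]" by (metis degree_eq_zeroE)
  then show ?case by (intro exI[of _ "{#}"]) auto
next
  case (Suc n)
  let ?P = "map_poly complex_of_real p"
  have "degree ?P = Suc n"
    using Suc.hyps(2) by (simp add: degree_map_poly)
  then obtain z where z: "poly ?P z = 0"
    using fundamental_theorem_of_algebra[of ?P] by (metis constant_degree nat.simps(3))
  then obtain a where a: "z = of_real a" using Suc.prems(2) by (auto elim: Reals_cases)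
  have "poly p a = 0"
    using z unfolding a by (simp add: poly_altdef degree_map_poly coeff_map_poly flip: of_real_mult of_real_power of_real_sum)
  then obtain q where q: "p = [:-a, 1:] * q"
    by (metis dvdE poly_eq_0_iff_dvd)
  have q0: "q \<noteq> 0" using q Suc.prems(1) by auto
  have dq: "n = degree q" using Suc.hyps(2) q q0 by (simp add: degree_mult_eq del: mult_pCons_left)
  have "z \<in> \<real>" if "poly (map_poly of_real q) z = 0" for z :: complex
  proof (rule Suc.prems(2))
    have "map_poly complex_of_real p = map_poly of_real [:-a, 1:] * map_poly of_real q"
      unfolding q by (rule poly_eqI) (simp add: coeff_map_poly coeff_mult del: mult_pCons_left)
    then show "poly (map_poly of_real p) z = 0" using that by simp
  qed
  then obtain L where L: "size L = degree q" "q = smult (lead_coeff q) (\<Prod>l\<in>#L. [:-l, 1:])"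
    using Suc.hyps(1)[OF dq q0] by blast
  have lc: "lead_coeff p = lead_coeff q" unfolding q lead_coeff_mult by simp
  show ?case
  proof (intro exI[of _ "add_mset a L"] conjI)
    show "size (add_mset a L) = degree p" using L dq Suc.hyps(2) by simp
    show "p = smult (lead_coeff p) (\<Prod>l\<in>#add_mset a L. [:-l, 1:])"
    proof -
      have "p = [:-a, 1:] * smult (lead_coeff q) (\<Prod>l\<in>#L. [:-l, 1:])"
        unfolding L(2)[symmetric] by (rule q)
      also have "\<dots> = smult (lead_coeff q) (\<Prod>l\<in>#add_mset a L. [:-l, 1:])"
        by (simp only: mult_smult_right image_mset_add_mset prod_mset.add_mset)
      finally show ?thesis unfolding lc .
    qed
  qed
qed

lemma coeff_mult_top:
  fixes p q :: "'a::comm_semiring_1 poly"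
  assumes "degree p \<le> a" "degree q \<le> b"
  shows "coeff (p * q) (a + b) = coeff p a * coeff q b"
proof -
  have "coeff (p * q) (a + b) = (\<Sum>i\<le>a + b. if i = a then coeff p a * coeff q b else 0)"
    unfolding coeff_mult
  proof (rule sum.cong)
    fix i assume "i \<in> {..a + b}"
    show "coeff p i * coeff q (a + b - i) = (if i = a then coeff p a * coeff q b else 0)"
    proof (cases "i = a")
      case False
      then consider "i > degree p" | "a + b - i > degree q" using assms \<open>i \<in> _\<close> by fastforce
      then show ?thesis using False by cases (auto simp: coeff_eq_0)
    qed auto
  qed auto
  then show ?thesis by simp
qed

lemma linear_power_top:
  fixes a b :: real
  shows "degree ([:a, b:] ^ k) \<le> k \<and> coeff ([:a, b:] ^ k) k = b ^ k"
proof (induction k)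
  case (Suc k)
  have "degree ([:a, b:] ^ Suc k) \<le> Suc k"
    using degree_power_le[of "[:a, b:]" "Suc k"] by (auto intro: order.trans)
  moreover have "coeff ([:a, b:] * [:a, b:] ^ k) (1 + k) = b * b ^ k"
    using Suc by (subst coeff_mult_top) (auto simp del: mult_pCons_left)
  ultimately show ?case by (simp del: mult_pCons_left)
qed auto

lemma prod_linear_top:
  fixes a b :: "'i \<Rightarrow> real"
  assumes "finite A"
  shows "degree (\<Prod>i\<in>A. [:a i, b i:] ^ k i) \<le> (\<Sum>i\<in>A. k i) \<and>
         coeff (\<Prod>i\<in>A. [:a i, b i:] ^ k i) (\<Sum>i\<in>A. k i) = (\<Prod>i\<in>A. b i ^ k i)"
  using assms
proof (induction A)
  case (insert j A)
  have d: "degree ([:a j, b j:] ^ k j * (\<Prod>i\<in>A. [:a i, b i:] ^ k i)) \<le> k j + (\<Sum>i\<in>A. k i)"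
    using insert.IH linear_power_top[of "a j" "b j" "k j"]
    by (meson add_mono degree_mult_le order.trans)
  have "coeff ([:a j, b j:] ^ k j * (\<Prod>i\<in>A. [:a i, b i:] ^ k i)) (k j + (\<Sum>i\<in>A. k i)) =
        b j ^ k j * (\<Prod>i\<in>A. b i ^ k i)"
    using insert.IH linear_power_top[of "a j" "b j" "k j"] by (subst coeff_mult_top) auto
  with d show ?case using insert.hyps by simp
qed auto

lemma ex1_eigenvalues:
  assumes "hyperbolic d h e"
  shows "\<exists>!L. \<forall>t::real. evalp h (t *\<^sub>R e - x) = evalp h e * (\<Prod>l\<in>#L. t - l)"
    and "\<exists>L. size L = d \<and> (\<forall>t::real. evalp h (t *\<^sub>R e - x) = evalp h e * (\<Prod>l\<in>#L. t - l))"
proof -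
  define m where "m k = (\<Prod>i\<in>UNIV. [:- (x $ i), e $ i:] ^ Poly_Mapping.lookup k i)"
    for k :: "'a \<Rightarrow>\<^sub>0 nat"
  define p where "p = (\<Sum>k\<in>Poly_Mapping.keys h. smult (Poly_Mapping.lookup h k) (m k))"
  have hom: "(\<Sum>i\<in>UNIV. Poly_Mapping.lookup k i) = d" if "k \<in> Poly_Mapping.keys h" for k
    using assms that by (auto simp: hyperbolic_def homogeneous_def)
  have m: "degree (m k) \<le> d" "coeff (m k) d = (\<Prod>i\<in>UNIV. (e $ i) ^ Poly_Mapping.lookup k i)"
    if "k \<in> Poly_Mapping.keys h" for k
    using prod_linear_top[of UNIV "\<lambda>i. - (x $ i)" "\<lambda>i. e $ i" "Poly_Mapping.lookup k"]
    unfolding m_def hom[OF that] by auto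
  have cp: "coeff p d = evalp h e"
    unfolding p_def evalp_def by (simp add: coeff_sum m)
  have he: "evalp h e \<noteq> 0" using assms by (simp add: hyperbolic_def)
  have "degree p \<le> d" unfolding p_def by (intro degree_sum_le) (auto intro!: degree_smult_le[THEN order.trans] m)
  with cp he have dp: "degree p = d" by (metis le_antisym le_degree)
  have ev: "poly p t = evalp h (t *\<^sub>R e - x)" for t
    by (simp add: p_def m_def evalp_def poly_sum poly_prod poly_power algebra_simps)
  have cev: "poly (map_poly of_real p) z = evalp h (\<chi> i. z * of_real (e $ i) - of_real (x $ i))"
    for z :: complex
  proof -
    have add: "map_poly complex_of_real (\<Sum>k\<in>A. f k) = (\<Sum>k\<in>A. map_poly of_real (f k))"
      for A and f :: "('a \<Rightarrow>\<^sub>0 nat) \<Rightarrow> real poly"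
      by (rule poly_eqI) (simp add: coeff_map_poly coeff_sum)
    have mult: "map_poly complex_of_real (p * q) = map_poly of_real p * map_poly of_real q" for p q
      by (rule poly_eqI) (simp add: coeff_map_poly coeff_mult)
    have power: "map_poly complex_of_real (p ^ n) = map_poly of_real p ^ n" for p n
      by (induction n) (simp_all add: mult)
    have prod: "map_poly complex_of_real (\<Prod>k\<in>A. f k) = (\<Prod>k\<in>A. map_poly of_real (f k))"
      for A and f :: "'a \<Rightarrow> real poly"
      by (induction A rule: infinite_finite_induct) (simp_all add: mult)
    have smult: "map_poly complex_of_real (smult c q) = smult (of_real c) (map_poly of_real q)" for c q
      by (rule poly_eqI) (simp add: coeff_map_poly)
    have lin: "map_poly complex_of_real [:a, b:] = [:of_real a, of_real b:]" for a b
      by (simp add: map_poly_pCons)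
    show ?thesis
      unfolding p_def m_def evalp_def add smult prod power lin
      by (simp add: poly_sum poly_prod poly_power algebra_simps)
  qed
  have p0: "p \<noteq> 0" using cp he by auto
  have rooted: "z \<in> \<real>" if "poly (map_poly of_real p) z = 0" for z :: complex
    using that assms unfolding cev by (auto simp: hyperbolic_def)
  obtain L where L: "size L = d" "p = smult (evalp h e) (\<Prod>l\<in>#L. [:-l, 1:])"
    using real_rooted_poly_splits[OF p0 rooted] unfolding dp cp by blast
  have pm: "poly (\<Prod>l\<in>#K. [:-l, 1:]) t = (\<Prod>l\<in>#K. t - l)" for K and t :: real
    by (induction K) (simp_all add: algebra_simps)
  have LL: "evalp h (t *\<^sub>R e - x) = evalp h e * (\<Prod>l\<in>#L. t - l)" for t
    unfolding ev[symmetric] by (subst L(2)) (simp add: pm)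
  show "\<exists>L. size L = d \<and> (\<forall>t::real. evalp h (t *\<^sub>R e - x) = evalp h e * (\<Prod>l\<in>#L. t - l))"
    using L(1) LL by blast
  show "\<exists>!L. \<forall>t::real. evalp h (t *\<^sub>R e - x) = evalp h e * (\<Prod>l\<in>#L. t - l)"
  proof (rule ex1I)
    show "\<forall>t::real. evalp h (t *\<^sub>R e - x) = evalp h e * (\<Prod>l\<in>#L. t - l)" using LL by blast
  next
    fix K assume K: "\<forall>t::real. evalp h (t *\<^sub>R e - x) = evalp h e * (\<Prod>l\<in>#K. t - l)"
    have "poly (\<Prod>l\<in>#K. [:-l, 1:]) = poly (\<Prod>l\<in>#L. [:-l, 1:])"
      using K LL he by (intro ext) (simp add: pm)
    then have "proots (\<Prod>l\<in>#K. [:-l, 1:]) = proots (\<Prod>l\<in>#L. [:-l, 1:])"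
      by (simp only: poly_eq_poly_eq_iff)
    moreover have "proots (\<Prod>l\<in>#J. [:-l, 1:]) = J" for J :: "real multiset"
    proof (induction J)
      case (add a J)
      have "(\<Prod>l\<in>#J. [:-l, 1:]) \<noteq> 0" by (auto simp: prod_mset_zero_iff)
      then show ?case using add by (simp add: proots_mult del: mult_pCons_left)
    qed simp
    ultimately show "K = L" by simp
  qed
qed

lemma eigenvalues:
  assumes "hyperbolic d h e"
  shows "evalp h (t *\<^sub>R e - x) = evalp h e * (\<Prod>l\<in>#eigenvalues h e x. t - l)"
    and "size (eigenvalues h e x) = d"
proof -
  have *: "\<forall>t::real. evalp h (t *\<^sub>R e - x) = evalp h e * (\<Prod>l\<in>#eigenvalues h e x. t - l)"
    unfolding eigenvalues_def by (rule theI') (rule ex1_eigenvalues(1)[OF assms])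
  then show "evalp h (t *\<^sub>R e - x) = evalp h e * (\<Prod>l\<in>#eigenvalues h e x. t - l)" by blast
  show "size (eigenvalues h e x) = d"
    using * ex1_eigenvalues[OF assms, of x] by blast
qed

end

theory Submission
  imports Defs "HOL-Complex_Analysis.Complex_Analysis"
begin

text \<open>
  Let \<open>D\<^sub>v\<close> be the derivative in direction \<open>v\<close> and \<open>u\<^sub>i = E X\<^sub>i\<close>. Say that \<open>x\<close> is above the zeros of \<open>F\<close> if
  \<open>F > 0\<close> on \<open>x + \<Lambda>\<^sub>+\<close>. If \<open>x\<close> is above the zeros of \<open>F\<close>, then it is above those of \<open>(1 - D\<^sub>v) F\<close> if and only
  if \<open>D\<^sub>v F / F < 1\<close> at \<open>x\<close>. This quotient is linear in \<open>v\<close>, so whenever \<open>x\<close> is above the zeros of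
  \<open>\<Prod>\<^sub>i (1 - D\<^bsub>u\<^sub>i\<^esub>) h\<close> the \<open>u\<^sub>i\<close> can be replaced one by one by values \<open>v\<^sub>i\<close> of \<open>X\<^sub>i\<close>; no interlacing is needed.
  If \<open>x\<close> is above the zeros of \<open>(1 - D\<^sub>v) F\<close>, then \<open>x - v\<close> is above those of \<open>F\<close>, so this gives
  \<open>\<lambda>\<^sub>m\<^sub>a\<^sub>x (\<Sum>\<^sub>i v\<^sub>i) \<le> T\<close> for \<open>x = T e\<close>.

  That \<open>T e\<close> is above the zeros of \<open>\<Prod>\<^sub>i (1 - D\<^bsub>u\<^sub>i\<^esub>) h\<close> is the barrier argument of Marcus, Spielman and Srivastava:
  passing from \<open>F\<close> to \<open>(1 - D\<^sub>v) F\<close> and from \<open>x\<close> to \<open>x + \<delta> v\<close> does not increase \<open>D\<^sub>w F / F\<close>. Along \<open>v\<close> this quotient is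
  a sum of terms \<open>c / (s - a)\<close> with \<open>c \<ge> 0\<close>, where \<open>a\<close> is a zero of \<open>F\<close> on the line, and for each term it suffices
  to bound a sum over the at most \<open>r - 1\<close> other zeros. Leaving out the last step for each \<open>i\<close> in turn gives \<open>m\<close> points
  in the convex cone of the hyperbolic polynomial \<open>\<Prod>\<^sub>i (1 - y\<^sub>i D\<^bsub>u\<^sub>i\<^esub>) h\<close> in \<open>(x, y)\<close>, and their average is a
  multiple of \<open>(T e, 1)\<close>.
\<close>

subsection \<open>Polynomial functions and directional derivatives\<close>

abbreviation cpoly :: "real poly \<Rightarrow> complex poly" where
  "cpoly \<equiv> map_poly of_real"

lemma cpoly_add [simp]: "cpoly (p + q) = cpoly p + cpoly q"
  by (rule poly_eqI) (simp add: coeff_map_poly)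

lemma cpoly_mult [simp]: "cpoly (p * q) = cpoly p * cpoly q"
  by (rule poly_eqI) (simp add: coeff_map_poly coeff_mult)

lemma cpoly_diff [simp]: "cpoly (p - q) = cpoly p - cpoly q"
  by (rule poly_eqI) (simp add: coeff_map_poly)

lemma cpoly_smult [simp]: "cpoly (smult c p) = smult (of_real c) (cpoly p)"
  by (rule poly_eqI) (simp add: coeff_map_poly)

lemma cpoly_pCons [simp]: "cpoly (pCons c p) = pCons (of_real c) (cpoly p)"
  by (simp add: map_poly_pCons)

lemma cpoly_pderiv: "cpoly (pderiv p) = pderiv (cpoly p)"
  by (rule poly_eqI) (simp add: coeff_map_poly coeff_pderiv)

lemma poly_cpoly_of_real [simp]: "poly (cpoly p) (of_real s) = of_real (poly p s)"
  by (induction p) (simp_all)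

text \<open>Polynomial functions with real coefficients, given by closure rules so that facts on
  derivatives, substitutions and conjugation follow by structural induction. Arguments are complex
  since stability concerns non-real points.\<close>

inductive polyfun :: "(complex ^ 'n::finite \<Rightarrow> complex) \<Rightarrow> bool" where
  polyfun_const: "polyfun (\<lambda>z. of_real c)"
| polyfun_coord: "polyfun (\<lambda>z. z $ i)"
| polyfun_add: "polyfun F \<Longrightarrow> polyfun G \<Longrightarrow> polyfun (\<lambda>z. F z + G z)"
| polyfun_mult: "polyfun F \<Longrightarrow> polyfun G \<Longrightarrow> polyfun (\<lambda>z. F z * G z)"

lemma polyfun_0: "polyfun (\<lambda>z. 0)"
  using polyfun_const[of 0] by simp

lemma polyfun_1: "polyfun (\<lambda>z. 1)"
  using polyfun_const[of 1] by simp

lemma polyfun_cmult: "polyfun F \<Longrightarrow> polyfun (\<lambda>z. of_real c * F z)"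
  by (intro polyfun_mult polyfun_const)

lemma polyfun_diff:
  assumes "polyfun F" "polyfun G"
  shows "polyfun (\<lambda>z. F z - G z)"
  using polyfun_add[OF assms(1) polyfun_cmult[OF assms(2), of "-1"]] by simp

lemma polyfun_sum: "(\<And>i. i \<in> I \<Longrightarrow> polyfun (F i)) \<Longrightarrow> polyfun (\<lambda>z. \<Sum>i\<in>I. F i z)"
  by (induction I rule: infinite_finite_induct) (auto intro: polyfun_0 polyfun_add)

lemma polyfun_prod: "(\<And>i. i \<in> I \<Longrightarrow> polyfun (F i)) \<Longrightarrow> polyfun (\<lambda>z. \<Prod>i\<in>I. F i z)"
  by (induction I rule: infinite_finite_induct) (auto intro: polyfun_1 polyfun_mult)

lemma polyfun_power: "polyfun F \<Longrightarrow> polyfun (\<lambda>z. F z ^ k)"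
  by (induction k) (auto intro: polyfun_1 polyfun_mult)

lemma polyfun_compose:
  fixes g :: "complex ^ 'k::finite \<Rightarrow> complex ^ 'n::finite"
  assumes "polyfun F" "\<And>i. polyfun (\<lambda>p. g p $ i)"
  shows "polyfun (\<lambda>p. F (g p))"
  using assms(1) by induction (auto intro: polyfun.intros assms(2))

lemma polyfun_evalp: "polyfun (evalp h)"
  unfolding evalp_def by (intro polyfun_sum polyfun_mult polyfun_const polyfun_prod polyfun_power polyfun_coord)

lemma continuous_on_polyfun:
  assumes "polyfun F" "continuous_on S g"
  shows "continuous_on S (\<lambda>x. F (g x))"
  using assms(1) by induction (auto intro!: continuous_intros assms(2))

lemma polyfun_line:
  assumes "polyfun F"
  shows "\<exists>p. \<forall>s. F (z + s *s w) = poly p s"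
  using assms
proof induction
  case (polyfun_const c)
  show ?case by (rule exI[of _ "[:of_real c:]"]) simp
next
  case (polyfun_coord i)
  show ?case by (rule exI[of _ "[:z $ i, w $ i:]"]) simp
next
  case (polyfun_add F G)
  then obtain p q where "\<forall>s. F (z + s *s w) = poly p s" "\<forall>s. G (z + s *s w) = poly q s" by blast
  then show ?case by (intro exI[of _ "p + q"]) simp
next
  case (polyfun_mult F G)
  then obtain p q where "\<forall>s. F (z + s *s w) = poly p s" "\<forall>s. G (z + s *s w) = poly q s" by blast
  then show ?case by (intro exI[of _ "p * q"]) simp
qed

section \<open>Real points and real lines in the complex space\<close>

definition cvec :: "real ^ 'n \<Rightarrow> complex ^ 'n" where
  "cvec x = (\<chi> i. of_real (x $ i))"

lemma cvec_nth [simp]: "cvec x $ i = of_real (x $ i)"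
  by (simp add: cvec_def)

lemma cvec_add: "cvec (x + y) = cvec x + cvec y"
  by (simp add: vec_eq_iff)

lemma cvec_scaleR: "cvec (c *\<^sub>R x) = of_real c *s cvec x"
  by (simp add: vec_eq_iff)

lemma continuous_on_cvec [continuous_intros]:
  "continuous_on S g \<Longrightarrow> continuous_on S (\<lambda>x. cvec (g x))"
  unfolding cvec_def by (intro continuous_intros)

lemma continuous_on_smult_vec [continuous_intros]:
  fixes f :: "'a::topological_space \<Rightarrow> complex"
  shows "continuous_on S f \<Longrightarrow> continuous_on S g \<Longrightarrow> continuous_on S (\<lambda>x. f x *s g x)"
  unfolding vector_scalar_mult_def by (intro continuous_intros)

lemma evalp_cvec: "evalp h (cvec x) = of_real (evalp h x)"
  by (simp add: evalp_def)

lemma polyfun_line_real: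
  assumes "polyfun F"
  shows "\<exists>p. \<forall>s. F (cvec x + s *s cvec v) = poly (cpoly p) s"
  using assms
proof induction
  case (polyfun_const c)
  show ?case by (rule exI[of _ "[:c:]"]) simp
next
  case (polyfun_coord i)
  show ?case by (rule exI[of _ "[:x $ i, v $ i:]"]) simp
next
  case (polyfun_add F G)
  then obtain p q where "\<forall>s. F (cvec x + s *s cvec v) = poly (cpoly p) s"
    "\<forall>s. G (cvec x + s *s cvec v) = poly (cpoly q) s" by blast
  then show ?case by (intro exI[of _ "p + q"]) simp
next
  case (polyfun_mult F G)
  then obtain p q where "\<forall>s. F (cvec x + s *s cvec v) = poly (cpoly p) s"
    "\<forall>s. G (cvec x + s *s cvec v) = poly (cpoly q) s" by blast
  then show ?case by (intro exI[of _ "p * q"]) simp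
qed

lemma polyfun_real:
  assumes "polyfun F"
  shows "F (cvec x) = of_real (Re (F (cvec x)))"
proof -
  obtain p where "\<forall>s. F (cvec x + s *s cvec 0) = poly (cpoly p) s"
    using polyfun_line_real[OF assms] by blast
  then have "F (cvec x) = of_real (poly p 0)"
    using poly_cpoly_of_real[of p 0] by (metis add.right_neutral of_real_0 vector_smult_lzero)
  then show ?thesis by simp
qed

lemma polyfun_cnj:
  assumes "polyfun F"
  shows "F (\<chi> i. cnj (z $ i)) = cnj (F z)"
  using assms by induction auto

text \<open>The direction is real but the base point complex: derivatives are needed at points whose
  imaginary part lies in the cone.\<close>

definition D :: "real ^ 'n \<Rightarrow> (complex ^ 'n::finite \<Rightarrow> complex) \<Rightarrow> complex ^ 'n \<Rightarrow> complex" where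
  "D v F z = deriv (\<lambda>s. F (z + s *s cvec v)) 0"

lemma D_line:
  assumes "\<And>s. F (z + s *s cvec v) = poly p s"
  shows "D v F (z + s *s cvec v) = poly (pderiv p) s"
proof -
  have "F (z + s *s cvec v + t *s cvec v) = poly p (s + t)" for t
    using assms[of "s + t"] by (simp add: vector_sadd_rdistrib add.assoc)
  moreover have "((\<lambda>t. poly p (s + t)) has_field_derivative poly (pderiv p) s) (at 0)"
    by (auto intro!: derivative_eq_intros)
  ultimately show ?thesis
    unfolding D_def by (simp add: DERIV_imp_deriv)
qed

lemma D_line_real:
  assumes "\<And>s. F (cvec x + s *s cvec v) = poly (cpoly p) s"
  shows "D v F (cvec x + s *s cvec v) = poly (cpoly (pderiv p)) s"
  using D_line[OF assms] by (simp add: cpoly_pderiv)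

lemma polyfun_has_derivative:
  assumes "polyfun F"
  shows "((\<lambda>s. F (z + s *s cvec v)) has_field_derivative D v F (z + s *s cvec v)) (at s)"
proof -
  obtain p where "\<And>s. F (z + s *s cvec v) = poly p s"
    using polyfun_line[OF assms] by blast
  then show ?thesis using D_line[of F z v p s] by simp
qed

lemma D_const [simp]: "D v (\<lambda>z. c) = (\<lambda>z. 0)"
  by (simp add: D_def fun_eq_iff)

lemma D_coord [simp]: "D v (\<lambda>z. z $ i) = (\<lambda>z. of_real (v $ i))"
proof
  fix z :: "complex ^ 'a"
  have "((\<lambda>s. (z + s *s cvec v) $ i) has_field_derivative of_real (v $ i)) (at 0)"
    by (auto intro!: derivative_eq_intros)
  then show "D v (\<lambda>z. z $ i) z = of_real (v $ i)"
    unfolding D_def by (rule DERIV_imp_deriv)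
qed

lemma D_add:
  assumes "polyfun F" "polyfun G"
  shows "D v (\<lambda>z. F z + G z) = (\<lambda>z. D v F z + D v G z)"
proof
  fix z
  show "D v (\<lambda>z. F z + G z) z = D v F z + D v G z"
    using DERIV_add[OF polyfun_has_derivative[OF assms(1), of z v 0] polyfun_has_derivative[OF assms(2), of z v 0]]
    by (simp add: D_def[of v "\<lambda>z. F z + G z"] DERIV_imp_deriv)
qed

lemma D_mult:
  assumes "polyfun F" "polyfun G"
  shows "D v (\<lambda>z. F z * G z) = (\<lambda>z. D v F z * G z + F z * D v G z)"
proof
  fix z
  show "D v (\<lambda>z. F z * G z) z = D v F z * G z + F z * D v G z"
    using DERIV_mult[OF polyfun_has_derivative[OF assms(1), of z v 0] polyfun_has_derivative[OF assms(2), of z v 0]]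
    by (simp add: D_def[of v "\<lambda>z. F z * G z"] DERIV_imp_deriv)
qed

lemma D_cmult:
  assumes "polyfun F"
  shows "D v (\<lambda>z. c * F z) = (\<lambda>z. c * D v F z)"
proof
  fix z
  show "D v (\<lambda>z. c * F z) z = c * D v F z"
    using DERIV_cmult[OF polyfun_has_derivative[OF assms(1), of z v 0], of c]
    by (simp add: D_def[of v "\<lambda>z. c * F z"] DERIV_imp_deriv)
qed

lemma D_diff:
  assumes "polyfun F" "polyfun G"
  shows "D v (\<lambda>z. F z - G z) = (\<lambda>z. D v F z - D v G z)"
  using D_add[OF assms(1) polyfun_cmult[OF assms(2), of "-1"], of v] D_cmult[OF assms(2), of v "-1"]
  by simp

lemma polyfun_D: "polyfun F \<Longrightarrow> polyfun (D v F)"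
  by (induction rule: polyfun.induct) (auto simp: D_add D_mult intro: polyfun.intros polyfun_0)

lemma D_commute:
  assumes "polyfun F"
  shows "D v (D w F) = D w (D v F)"
  using assms
  by induction (auto simp: D_add D_mult polyfun_D polyfun_mult algebra_simps fun_eq_iff)

lemma D_vec_add:
  assumes "polyfun F"
  shows "D (v + w) F z = D v F z + D w F z"
  using assms by induction (auto simp: D_add D_mult algebra_simps)

lemma D_vec_scaleR:
  assumes "polyfun F"
  shows "D (c *\<^sub>R v) F z = of_real c * D v F z"
  using assms by induction (auto simp: D_add D_mult algebra_simps)

lemma D_vec_sum:
  assumes "polyfun F"
  shows "D (\<Sum>k\<in>S. c k *\<^sub>R v k) F z = (\<Sum>k\<in>S. of_real (c k) * D (v k) F z)"
proof -
  have "D 0 F z = 0" using D_vec_scaleR[OF assms, of 0 0] by simp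
  then show ?thesis
    by (induction S rule: infinite_finite_induct) (simp_all add: D_vec_add D_vec_scaleR assms)
qed

subsection \<open>Zeros of univariate polynomials\<close>

lemma poly_prod_mset_linear:
  "poly (\<Prod>a\<in>#A. [:- a, 1:]) (t :: 'a::comm_ring_1) = (\<Prod>a\<in>#A. t - a)"
  by (induction A) (simp_all add: algebra_simps)

lemma poly_pderiv_prod_mset_linear:
  fixes s :: "'a::field"
  assumes "s \<notin># A"
  shows "poly (pderiv (\<Prod>a\<in>#A. [:- a, 1:])) s =
         poly (\<Prod>a\<in>#A. [:- a, 1:]) s * (\<Sum>a\<in>#A. 1 / (s - a))"
  using assms
proof (induction A)
  case (add a A)
  then have "s - a \<noteq> 0" "s \<notin># A" by auto
  moreover have "pderiv [:- a, 1:] = 1" by (simp add: pderiv_pCons)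
  ultimately show ?case using add.IH
    by (simp add: pderiv_mult field_simps del: mult_pCons_left)
qed simp

lemma complex_poly_splits:
  fixes p :: "complex poly"
  assumes "p \<noteq> 0"
  obtains A where "size A = degree p" "p = smult (lead_coeff p) (\<Prod>a\<in>#A. [:- a, 1:])"
  using alg_closed_imp_factorization[OF assms] by metis

text \<open>The logarithmic derivative at 0 is the sum of \<open>1 / (0 - a)\<close> over the zeros,
  and \<open>Im a < 0\<close> puts each term into the open lower half-plane. The first alternative
  occurs when there are no zeros.\<close>

lemma log_derivative_lower_half_plane:
  fixes p :: "complex poly"
  assumes "\<And>s. Im s \<ge> 0 \<Longrightarrow> poly p s \<noteq> 0"
  shows "poly (pderiv p) 0 = 0 \<or> Im (poly (pderiv p) 0 / poly p 0) < 0"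
proof -
  have p0: "p \<noteq> 0" using assms[of 0] by auto
  obtain A where A: "p = smult (lead_coeff p) (\<Prod>a\<in>#A. [:- a, 1:])"
    using complex_poly_splits[OF p0] .
  have root: "Im a < 0" if "a \<in># A" for a
  proof (rule ccontr)
    assume "\<not> Im a < 0"
    moreover have "poly p a = 0"
      using that by (subst A) (auto simp: poly_prod_mset_linear prod_mset_zero_iff)
    ultimately show False using assms[of a] by auto
  qed
  have "0 \<notin># A" using root by fastforce
  have "poly (pderiv p) 0 = lead_coeff p * poly (pderiv (\<Prod>a\<in>#A. [:- a, 1:])) 0"
    by (subst A) (simp add: pderiv_smult)
  also have "\<dots> = lead_coeff p * poly (\<Prod>a\<in>#A. [:- a, 1:]) 0 * (\<Sum>a\<in>#A. 1 / (0 - a))"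
    using poly_pderiv_prod_mset_linear[OF \<open>0 \<notin># A\<close>] by simp
  also have "lead_coeff p * poly (\<Prod>a\<in>#A. [:- a, 1:]) 0 = poly p 0"
    by (subst (2) A) simp
  finally have eq: "poly (pderiv p) 0 = poly p 0 * (\<Sum>a\<in>#A. 1 / (0 - a))" .
  have neg: "Im (\<Sum>a\<in>#B. 1 / (0 - a)) < 0 \<or> B = {#}" if "\<And>a. a \<in># B \<Longrightarrow> Im a < 0" for B :: "complex multiset"
    using that
  proof (induction B)
    case (add b B)
    have "Im (1 / (0 - b)) < 0"
      using add.prems[of b] by (simp add: Im_divide divide_neg_pos sum_power2_gt_zero_iff)
    moreover have "Im (\<Sum>a\<in>#B. 1 / (0 - a)) \<le> 0" using add by force
    ultimately show ?case by simp
  qed simp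
  show ?thesis
    using neg[of A] root eq assms[of 0] by auto
qed

lemma prod_mset_ge_power:
  fixes f :: "'a \<Rightarrow> real"
  assumes "\<And>a. a \<in># A \<Longrightarrow> f a \<ge> c" "c \<ge> 0"
  shows "(\<Prod>a\<in>#A. f a) \<ge> c ^ size A"
  using assms(1)
proof (induction A)
  case (add a A)
  then have "c ^ size A \<le> (\<Prod>a\<in>#A. f a)" "f a \<ge> c" by simp_all
  then show ?case using assms(2) by (simp add: mult_mono)
qed simp

lemma norm_prod_mset: "norm (\<Prod>a\<in>#A. f a :: complex) = (\<Prod>a\<in>#A. norm (f a))"
  by (induction A) (simp_all add: norm_mult)

text \<open>Continuity of the roots: they cannot enter the upper half-plane without crossing the real axis.\<close>

lemma root_homotopy:
  fixes P :: "real \<Rightarrow> complex \<Rightarrow> complex"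
  assumes cont: "continuous_on ({0..1} \<times> UNIV) (\<lambda>z. P (fst z) (snd z))"
    and bounded: "\<And>\<tau> t. \<tau> \<in> {0..1} \<Longrightarrow> P \<tau> t = 0 \<Longrightarrow> norm t \<le> R"
    and splits: "\<And>\<tau>. \<tau> \<in> {0..1} \<Longrightarrow> \<exists>A. size A = d \<and> (\<forall>t. P \<tau> t = c * (\<Prod>a\<in>#A. t - a))"
    and c: "c \<noteq> 0"
    and real: "\<And>\<tau> t. \<tau> \<in> {0..1} \<Longrightarrow> P \<tau> (of_real t) \<noteq> 0"
    and start: "\<And>t. Im t \<ge> 0 \<Longrightarrow> P 0 t \<noteq> 0"
    and t: "Im t \<ge> 0"
  shows "P 1 t \<noteq> 0"
proof
  assume root: "P 1 t = 0"
  \<comment> \<open>\<open>S\<close> collects the parameters with a zero in the closed upper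
    half-plane. The bound \<open>R\<close> makes it a projection of a compact set, hence closed. It
    is also open, so connectedness of \<open>{0..1}\<close> gives all or nothing.\<close>
  define Z where "Z = {z \<in> {0..1} \<times> UNIV. P (fst z) (snd z) = 0} \<inter> ({0..1} \<times> (cball 0 R \<inter> {t. Im t \<ge> 0}))"
  define S where "S = fst ` Z"
  have S_iff: "\<tau> \<in> S \<longleftrightarrow> \<tau> \<in> {0..1} \<and> (\<exists>t. Im t \<ge> 0 \<and> P \<tau> t = 0)" for \<tau>
  proof
    show "\<tau> \<in> S \<Longrightarrow> \<tau> \<in> {0..1} \<and> (\<exists>t. Im t \<ge> 0 \<and> P \<tau> t = 0)"
      unfolding S_def Z_def by auto
  next
    assume *: "\<tau> \<in> {0..1} \<and> (\<exists>t. Im t \<ge> 0 \<and> P \<tau> t = 0)"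
    then obtain t where "Im t \<ge> 0" "P \<tau> t = 0" by blast
    then have "(\<tau>, t) \<in> Z" using * bounded[of \<tau> t] by (simp add: Z_def)
    then show "\<tau> \<in> S" unfolding S_def by force
  qed
  have "closed {z \<in> {0..1} \<times> UNIV. P (fst z) (snd z) = 0}"
    by (intro continuous_closed_preimage_constant cont closed_Times closed_UNIV closed_atLeastAtMost)
  moreover have "compact ({0..1::real} \<times> (cball 0 R \<inter> {t. Im t \<ge> 0}))"
    by (intro compact_Times compact_Int_closed compact_Icc compact_cball closed_halfspace_Im_ge)
  ultimately have "compact Z"
    unfolding Z_def by (rule closed_Int_compact)
  then have "compact S"
    unfolding S_def by (intro compact_continuous_image continuous_on_fst continuous_on_id)
  then have clo: "closedin (top_of_set {0..1}) S"
    by (intro closed_subset compact_imp_closed) (auto simp: S_iff)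
  have opn: "openin (top_of_set {0..1}) S"
    unfolding openin_contains_ball
  proof (intro conjI ballI)
    show "S \<subseteq> {0..1}" by (auto simp: S_iff)
    fix \<tau> assume "\<tau> \<in> S"
    then obtain t where t: "\<tau> \<in> {0..1}" "Im t \<ge> 0" "P \<tau> t = 0" by (auto simp: S_iff)
    define \<eta> where "\<eta> = Im t"
    have "\<eta> \<noteq> 0"
    proof
      assume "\<eta> = 0"
      then have "t = of_real (Re t)" by (simp add: \<eta>_def complex_eq_iff)
      then show False using real[OF t(1), of "Re t"] t(3) by simp
    qed
    then have \<eta>: "\<eta> > 0" using t(2) by (simp add: \<eta>_def)
    have "continuous_on {0..1} (\<lambda>\<sigma>. P \<sigma> t)"
    proof -
      have "continuous_on {0..1} (\<lambda>\<sigma>. (\<sigma>, t))" by (intro continuous_intros)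
      from continuous_on_compose2[OF cont this] show ?thesis by auto
    qed
    \<comment> \<open>If all \<open>d\<close> zeros of \<open>P \<sigma>\<close> had distance at
      least \<open>\<eta>\<close> from \<open>t\<close>, then \<open>P \<sigma> t\<close> would have
      norm at least \<open>norm c * \<eta> ^ d\<close>. Below this threshold some zero lies within
      \<open>\<eta> = Im t\<close> of \<open>t\<close>, so still in the closed upper
      half-plane.\<close>
    then obtain \<epsilon> where \<epsilon>: "\<epsilon> > 0"
      "\<And>\<sigma>. \<sigma> \<in> {0..1} \<Longrightarrow> dist \<sigma> \<tau> < \<epsilon> \<Longrightarrow> dist (P \<sigma> t) (P \<tau> t) < norm c * \<eta> ^ d"
      using t(1) \<eta> c unfolding continuous_on_iff by (metis mult_pos_pos zero_less_norm_iff zero_less_power)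
    have "ball \<tau> \<epsilon> \<inter> {0..1} \<subseteq> S"
    proof
      fix \<sigma> assume \<sigma>: "\<sigma> \<in> ball \<tau> \<epsilon> \<inter> {0..1}"
      then have small: "norm (P \<sigma> t) < norm c * \<eta> ^ d"
        using \<epsilon>(2)[of \<sigma>] t(3) by (simp add: dist_commute)
      obtain A where A: "size A = d" "\<And>t. P \<sigma> t = c * (\<Prod>a\<in>#A. t - a)"
        using splits[of \<sigma>] \<sigma> by auto
      obtain a where a: "a \<in># A" "norm (t - a) < \<eta>"
      proof (rule ccontr)
        assume "\<not> thesis"
        then have "(\<Prod>a\<in>#A. norm (t - a)) \<ge> \<eta> ^ size A"
          using that \<eta> by (intro prod_mset_ge_power) force+
        then show False using small A c by (simp add: norm_mult norm_prod_mset)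
      qed
      have "Im a \<ge> 0"
        using a(2) abs_Im_le_cmod[of "t - a"] by (simp add: \<eta>_def)
      moreover have "P \<sigma> a = 0" using a(1) by (auto simp: A(2) prod_mset_zero_iff)
      ultimately show "\<sigma> \<in> S" using \<sigma> by (auto simp: S_iff)
    qed
    then show "\<exists>\<epsilon>>0. ball \<tau> \<epsilon> \<inter> {0..1} \<subseteq> S" using \<epsilon>(1) by blast
  qed
  have "1 \<in> S" using root t by (auto simp: S_iff)
  moreover have "0 \<notin> S" using start by (auto simp: S_iff)
  moreover have "S = {} \<or> S = {0..1}"
    using connected_Icc[of "0::real" 1] clo opn unfolding connected_clopen by blast
  ultimately show False by auto
qed

subsection \<open>Rational functions that map the upper half-plane to the lower one\<close>

text \<open>\<open>- q / p\<close> is then a Pick (Nevanlinna) function. It is kept as a pair of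
  polynomials, so common real zeros are possible.\<close>

definition pick :: "real poly \<Rightarrow> real poly \<Rightarrow> bool" where
  "pick p q \<longleftrightarrow> (\<forall>s. Im s > 0 \<longrightarrow> poly (cpoly p) s \<noteq> 0 \<and> Im (poly (cpoly q) s / poly (cpoly p) s) \<le> 0)"

lemma pick_splits:
  assumes "pick p q"
  obtains L where "size L = degree p" "p = smult (lead_coeff p) (\<Prod>l\<in>#L. [:- l, 1:])"
proof -
  have upper: "poly (cpoly p) z \<noteq> 0" if "Im z > 0" for z
    using assms that by (auto simp: pick_def)
  have cnj: "poly (cpoly p) (cnj z) = cnj (poly (cpoly p) z)" for z
    by (induction p) simp_all
  have "p \<noteq> 0" using upper[of \<i>] by auto
  moreover have "z \<in> \<real>" if "poly (cpoly p) z = 0" for z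
  proof (rule ccontr)
    assume "z \<notin> \<real>"
    then have "Im z > 0 \<or> Im (cnj z) > 0" by (auto simp: complex_is_Real_iff)
    then show False using upper[of z] upper[of "cnj z"] that by (auto simp: cnj)
  qed
  ultimately show ?thesis using that real_rooted_poly_splits by blast
qed

text \<open>\<open>R = q / p\<close> is real at \<open>s\<close> and has \<open>Im R \<le> 0\<close>
  above it. The difference quotient in the direction \<open>\<i>\<close> has real part
  \<open>Im R / \<eta>\<close>, and its limit is the real derivative.\<close>

lemma pick_derivative_nonpos:
  assumes "pick p q" "poly p s \<noteq> 0"
  shows "poly (pderiv q) s * poly p s - poly q s * poly (pderiv p) s \<le> 0"
proof -
  define R where "R z = poly (cpoly q) z / poly (cpoly p) z" for z
  define r where "r = (poly (pderiv q) s * poly p s - poly q s * poly (pderiv p) s) / (poly p s * poly p s)"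
  have "(R has_field_derivative of_real r) (at (of_real s))"
    unfolding R_def r_def using assms(2)
    by (auto intro!: derivative_eq_intros simp flip: cpoly_pderiv)
  then have lim: "((\<lambda>h. (R (of_real s + h) - R (of_real s)) / h) \<longlongrightarrow> of_real r) (at 0)"
    by (simp add: DERIV_def)
  have "filterlim (\<lambda>\<eta>. \<i> * of_real \<eta>) (at 0) (at_right (0::real))"
    unfolding filterlim_at
    by (auto intro!: tendsto_eq_intros simp: eventually_at_right_less eventually_at_filter)
  then have "((\<lambda>\<eta>. Re ((R (of_real s + \<i> * of_real \<eta>) - R (of_real s)) / (\<i> * of_real \<eta>))) \<longlongrightarrow> r) (at_right 0)"
    using tendsto_Re[OF filterlim_compose[OF lim]] by simp
  moreover have "eventually (\<lambda>\<eta>. Re ((R (of_real s + \<i> * of_real \<eta>) - R (of_real s)) / (\<i> * of_real \<eta>)) \<le> 0) (at_right 0)"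
    unfolding eventually_at_right_field
  proof (intro exI[of _ 1] conjI allI impI)
    fix \<eta> :: real assume \<eta>: "0 < \<eta>"
    have "Im (R (of_real s + \<i> * of_real \<eta>)) \<le> 0"
      using assms(1) \<eta> by (simp add: pick_def R_def)
    moreover have "Im (R (of_real s)) = 0" by (simp add: R_def)
    ultimately show "Re ((R (of_real s + \<i> * of_real \<eta>) - R (of_real s)) / (\<i> * of_real \<eta>)) \<le> 0"
      using \<eta> by (simp add: Re_divide divide_nonpos_pos mult_nonpos_nonneg)
  qed simp
  ultimately have "r \<le> 0" by (intro tendsto_upperbound) auto
  moreover have "poly p s * poly p s > 0" using assms(2) not_square_less_zero[of "poly p s"] by (metis linorder_neqE_linordered_idom mult_eq_0_iff)
  ultimately show ?thesis by (simp add: r_def divide_le_0_iff)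
qed

lemma pick_antimono:
  assumes "pick p q" "\<And>s. s \<ge> 0 \<Longrightarrow> poly p s > 0" "s \<ge> 0"
  shows "poly q s / poly p s \<le> poly q 0 / poly p 0"
proof (rule DERIV_nonpos_imp_nonincreasing[OF assms(3)])
  fix x :: real assume "0 \<le> x" "x \<le> s"
  then have "poly p x > 0" using assms(2) by simp
  then show "\<exists>y. ((\<lambda>s. poly q s / poly p s) has_real_derivative y) (at x) \<and> y \<le> 0"
    using pick_derivative_nonpos[OF assms(1), of x]
    by (intro exI[of _ "(poly (pderiv q) x * poly p x - poly q x * poly (pderiv p) x) / (poly p x * poly p x)"])
       (auto intro!: derivative_eq_intros divide_nonpos_pos)
qed

lemma degree_le_if_poly_le:
  fixes p q :: "real poly"
  assumes "\<And>s. s \<ge> 0 \<Longrightarrow> poly p s \<ge> 0" "\<And>s. s \<ge> 0 \<Longrightarrow> poly p s \<le> poly q s"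
  shows "degree p \<le> degree q"
proof (rule ccontr)
  assume deg: "\<not> degree p \<le> degree q"
  have pos: "\<not> lead_coeff f > 0" if "\<And>s. s \<ge> 0 \<Longrightarrow> poly f s \<le> 0" for f :: "real poly"
  proof
    assume "lead_coeff f > 0"
    then obtain n where "\<And>x. x \<ge> n \<Longrightarrow> poly f x \<ge> lead_coeff f"
      using poly_pinfty_gt_lc by blast
    from this[of "max n 0"] that[of "max n 0"] \<open>lead_coeff f > 0\<close> show False by simp
  qed
  have "degree (- q) < degree p" using deg by simp
  from lead_coeff_add_le[OF this] have "lead_coeff (p - q) = lead_coeff p" by simp
  moreover have "\<not> lead_coeff (p - q) > 0" using assms(2) by (intro pos) simp
  moreover have "\<not> lead_coeff (- p) > 0" using assms(1) by (intro pos) simp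
  ultimately have "lead_coeff p = 0" by simp
  then show False using deg by simp
qed

text \<open>By monotonicity \<open>q\<close> is at most a constant multiple of \<open>p\<close> on
  the half-line. This rules out a linear term in the partial fraction expansion.\<close>

lemma pick_degree_le:
  assumes "pick p q" "\<And>s. s \<ge> 0 \<Longrightarrow> poly p s > 0" "\<And>s. s \<ge> 0 \<Longrightarrow> poly q s \<ge> 0"
  shows "degree q \<le> degree p"
proof -
  define C where "C = poly q 0 / poly p 0"
  have "poly q s \<le> poly (smult C p) s" if "s \<ge> 0" for s
    using pick_antimono[OF assms(1,2) that] assms(2)[OF that] by (simp add: C_def field_simps)
  then have "degree q \<le> degree (smult C p)" by (intro degree_le_if_poly_le assms(3))
  then show ?thesis using degree_smult_le[of C p] by linarith
qed

text \<open>Near a zero of \<open>p\<close> of order \<open>k\<close>, at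
  \<open>s = a + \<rho> * cis \<theta>\<close>, the quotient behaves like
  \<open>\<kappa> / (\<rho> * cis \<theta>) ^ k\<close>, with imaginary part of the sign of
  \<open>- \<kappa> * sin (k * \<theta>)\<close>. Keeping it nonpositive for all \<theta> between 0
  and \<open>pi\<close> forces a simple pole and a nonnegative residue.\<close>

lemma pick_residue:
  assumes pq: "pick p q" and a: "poly p a = 0" "poly q a \<noteq> 0"
  obtains p0 where "p = [:- a, 1:] * p0" "poly p0 a \<noteq> 0" "poly q a / poly p0 a \<ge> 0"
proof -
  have p: "p \<noteq> 0" using pq by (auto simp: pick_def dest: spec[of _ \<i>])
  define k where "k = order a p"
  obtain p0 where p0: "p = [:- a, 1:] ^ k * p0" "\<not> [:- a, 1:] dvd p0"
    using order_decomp[OF p] unfolding k_def by blast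
  have p0a: "poly p0 a \<noteq> 0" using p0(2) by (simp add: poly_eq_0_iff_dvd)
  define \<kappa> where "\<kappa> = poly q a / poly p0 a"
  have \<kappa>: "\<kappa> \<noteq> 0" using a(2) p0a by (simp add: \<kappa>_def)
  have k0: "k \<noteq> 0" using p0(1) a(1) p0a by (cases k) auto
  have sin: "\<kappa> * sin (real k * \<theta>) \<ge> 0" if \<theta>: "0 < \<theta>" "\<theta> < pi" for \<theta>
  proof -
    define \<omega> where "\<omega> = cis \<theta>"
    have Im: "Im \<omega> > 0" using \<theta> by (simp add: \<omega>_def sin_gt_zero)
    \<comment> \<open>Scaling by \<open>\<rho> ^ k\<close> keeps the sign of the imaginary part and
      cancels the pole, so a limit exists as \<rho> tends to 0.\<close>
    define f where "f \<rho> = poly (cpoly q) (of_real a + of_real \<rho> * \<omega>) /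
      poly (cpoly p0) (of_real a + of_real \<rho> * \<omega>) / \<omega> ^ k" for \<rho> :: real
    have "isCont f 0"
      unfolding f_def using p0a by (intro continuous_intros) (auto simp: \<omega>_def)
    then have "(f \<longlongrightarrow> f 0) (at_right 0)"
      unfolding isCont_def by (rule tendsto_within_subset) simp
    then have "((\<lambda>\<rho>. Im (f \<rho>)) \<longlongrightarrow> Im (f 0)) (at_right 0)" by (rule tendsto_Im)
    moreover have "eventually (\<lambda>\<rho>. Im (f \<rho>) \<le> 0) (at_right 0)"
      unfolding eventually_at_right_field
    proof (intro exI[of _ 1] conjI allI impI)
      fix \<rho> :: real assume \<rho>: "0 < \<rho>"
      define s where "s = of_real a + of_real \<rho> * \<omega>"
      have "Im s > 0" using Im \<rho> by (simp add: s_def)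
      then have "Im (poly (cpoly q) s / poly (cpoly p) s) \<le> 0" using pq by (simp add: pick_def)
      moreover have cpow: "cpoly ([:- a, 1:] ^ j) = [:- of_real a, 1:] ^ j" for j
        by (induction j) (simp_all del: mult_pCons_left)
      have "poly (cpoly p) s = of_real \<rho> ^ k * \<omega> ^ k * poly (cpoly p0) s"
        unfolding p0(1) by (simp add: cpow s_def poly_power power_mult_distrib)
      then have "f \<rho> = of_real (\<rho> ^ k) * (poly (cpoly q) s / poly (cpoly p) s)"
        using \<rho> unfolding f_def s_def[symmetric] by (simp add: field_simps)
      ultimately show "Im (f \<rho>) \<le> 0"
        using \<rho> by (simp del: of_real_power times_divide_eq_right add: mult_nonneg_nonpos)
    qed simp
    ultimately have "Im (f 0) \<le> 0" by (intro tendsto_upperbound) auto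
    moreover have "f 0 = of_real \<kappa> * inverse (\<omega> ^ k)"
      by (simp add: f_def \<kappa>_def divide_simps)
    moreover have "inverse (\<omega> ^ k) = cis (- (real k * \<theta>))"
      unfolding \<omega>_def Complex.DeMoivre by (rule cis_inverse)
    ultimately show ?thesis by simp
  qed
  have "k = 1"
  proof (rule ccontr)
    assume "k \<noteq> 1"
    then have k2: "real k \<ge> 2" using k0 by linarith
    \<comment> \<open>For \<open>k \<ge> 2\<close> both angles are admissible and the sines are 1
      and -1, so \<kappa> would vanish.\<close>
    have "pi / (2 * real k) < pi" "3 * pi / (2 * real k) < pi"
      using k2 by (simp_all add: field_simps)
    then have "\<kappa> * sin (real k * (pi / (2 * real k))) \<ge> 0" "\<kappa> * sin (real k * (3 * pi / (2 * real k))) \<ge> 0"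
      using sin[of "pi / (2 * real k)"] sin[of "3 * pi / (2 * real k)"] k2 by simp_all
    moreover have "real k * (pi / (2 * real k)) = pi / 2" "real k * (3 * pi / (2 * real k)) = 3 / 2 * pi"
      using k2 by simp_all
    ultimately have "\<kappa> * sin (pi / 2) \<ge> 0" "\<kappa> * sin (3 / 2 * pi) \<ge> 0" by metis+
    then show False using \<kappa> unfolding sin_3over2_pi sin_pi_half by simp
  qed
  moreover have "\<kappa> \<ge> 0" using sin[of "pi / 2"] \<open>k = 1\<close> by simp
  ultimately show ?thesis using that[of p0] p0(1) p0a by (simp add: \<kappa>_def)
qed

text \<open>Induction on the degree cancels common zeros of \<open>p\<close> and \<open>q\<close>.
  When there are none, every zero of \<open>p\<close> is a simple pole of the quotient with
  nonnegative residue, and interpolation at the zeros determines \<open>q\<close>.\<close>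

lemma pick_partial_fractions:
  assumes "pick p q" "degree q \<le> degree p"
  shows "\<exists>A c0 c. finite A \<and> (\<forall>a\<in>A. poly p a = 0 \<and> c a \<ge> 0) \<and>
    (\<forall>s. poly p s \<noteq> 0 \<longrightarrow> poly q s / poly p s = c0 + (\<Sum>a\<in>A. c a / (s - a)))"
  using assms
proof (induction "degree p" arbitrary: p q rule: less_induct)
  case less
  have p: "p \<noteq> 0" using less.prems by (auto simp: pick_def dest: spec[of _ \<i>])
  show ?case
  proof (cases "\<exists>a. poly p a = 0 \<and> poly q a = 0")
    case True
    then obtain a p1 q1 where pq1: "p = [:- a, 1:] * p1" "q = [:- a, 1:] * q1"
      by (metis dvdE poly_eq_0_iff_dvd)
    have p1: "p1 \<noteq> 0" using p pq1 by auto
    have dp: "degree p = Suc (degree p1)"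
      using p1 unfolding pq1 by (simp add: degree_mult_eq del: mult_pCons_left)
    have dq: "degree q1 \<le> degree p1"
    proof (cases "q1 = 0")
      case False
      then have "degree q = Suc (degree q1)"
        unfolding pq1 by (simp add: degree_mult_eq del: mult_pCons_left)
      then show ?thesis using less.prems(2) dp by simp
    qed simp
    have "pick p1 q1"
      unfolding pick_def
    proof (intro allI impI)
      fix s :: complex assume s: "Im s > 0"
      then have *: "poly (cpoly p) s \<noteq> 0" "Im (poly (cpoly q) s / poly (cpoly p) s) \<le> 0"
        using less.prems(1) by (auto simp: pick_def)
      have "s - of_real a \<noteq> 0" using s by (auto simp: complex_eq_iff)
      moreover have "poly (cpoly p) s = (s - of_real a) * poly (cpoly p1) s"
        "poly (cpoly q) s = (s - of_real a) * poly (cpoly q1) s"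
        unfolding pq1 by (simp_all add: algebra_simps)
      ultimately show "poly (cpoly p1) s \<noteq> 0 \<and> Im (poly (cpoly q1) s / poly (cpoly p1) s) \<le> 0"
        using * by auto
    qed
    from less.hyps[OF _ this dq] dp obtain A c0 c where A: "finite A"
      "\<forall>a\<in>A. poly p1 a = 0 \<and> c a \<ge> 0"
      "\<And>s. poly p1 s \<noteq> 0 \<Longrightarrow> poly q1 s / poly p1 s = c0 + (\<Sum>a\<in>A. c a / (s - a))" by auto
    have "poly q s / poly p s = c0 + (\<Sum>a\<in>A. c a / (s - a))" if "poly p s \<noteq> 0" for s
      using that A(3)[of s] unfolding pq1 by (simp add: mult_divide_mult_cancel_left_if del: mult_pCons_left)
    then show ?thesis using A(1,2) unfolding pq1
      by (intro exI[of _ A] exI[of _ c0] exI[of _ c]) (auto simp del: mult_pCons_left)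
  next
    case False
    define A where "A = {a. poly p a = 0}"
    have A: "finite A" using p by (simp add: A_def poly_roots_finite)
    have "\<exists>p0. \<forall>a\<in>A. p = [:- a, 1:] * p0 a \<and> poly (p0 a) a \<noteq> 0 \<and> poly q a / poly (p0 a) a \<ge> 0"
      using False pick_residue[OF less.prems(1)] unfolding A_def by (intro bchoice) blast
    then obtain p0 where p0: "\<And>a. a \<in> A \<Longrightarrow> p = [:- a, 1:] * p0 a"
      "\<And>a. a \<in> A \<Longrightarrow> poly (p0 a) a \<noteq> 0" "\<And>a. a \<in> A \<Longrightarrow> poly q a / poly (p0 a) a \<ge> 0" by blast
    obtain L where L: "size L = degree p" "p = smult (lead_coeff p) (\<Prod>l\<in>#L. [:- l, 1:])"
      using pick_splits[OF less.prems(1)] .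
    have setL: "set_mset L = A"
      using p unfolding A_def by (subst L(2)) (auto simp: poly_prod_mset_linear prod_mset_zero_iff)
    \<comment> \<open>A second factor \<open>s - a\<close> would make \<open>p0 a\<close> vanish at
      \<open>a\<close>. So \<open>p\<close> has \<open>degree p\<close> distinct zeros.\<close>
    have "count L a = 1" if a: "a \<in> A" for a
    proof (rule ccontr)
      assume "count L a \<noteq> 1"
      then obtain L1 where L1: "L = add_mset a L1" using a setL by (metis insert_DiffM)
      then have "a \<in># L1"
        using \<open>count L a \<noteq> 1\<close> by (metis count_add_mset count_eq_zero_iff One_nat_def)
      moreover have "[:- a, 1:] * p0 a = [:- a, 1:] * smult (lead_coeff p) (\<Prod>l\<in>#L1. [:- l, 1:])"
        using L(2) p0(1)[OF a] unfolding L1 by (simp only: image_mset_add_mset prod_mset.add_mset mult_smult_right)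
      then have "p0 a = smult (lead_coeff p) (\<Prod>l\<in>#L1. [:- l, 1:])"
        by (subst (asm) mult_cancel_left) auto
      ultimately have "poly (p0 a) a = 0" by (auto simp: poly_prod_mset_linear prod_mset_zero_iff)
      then show False using p0(2)[OF a] by simp
    qed
    then have card: "card A = degree p"
      using L(1) unfolding size_multiset_overloaded_eq setL by simp
    define c where "c a = poly q a / poly (p0 a) a" for a
    \<comment> \<open>The value of \<open>q / p\<close> at infinity, which is 0 if
      \<open>degree q < degree p\<close>. It cancels the top coefficient in \<open>N\<close>, which
      then has too many zeros for its degree.\<close>
    define c0 where "c0 = coeff q (degree p) / lead_coeff p"
    define N where "N = q - smult c0 p - (\<Sum>a\<in>A. smult (c a) (p0 a))"
    have d0: "degree (p0 a) < degree p" if "a \<in> A" for a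
    proof -
      have "p0 a \<noteq> 0" using p0(2)[OF that] by auto
      then show ?thesis
        by (subst p0(1)[OF that]) (simp add: degree_mult_eq del: mult_pCons_left)
    qed
    have root: "poly N a = 0" if a: "a \<in> A" for a
    proof -
      have "poly (p0 b) a = 0" if "b \<in> A" "b \<noteq> a" for b
      proof -
        have "(a - b) * poly (p0 b) a = poly p a"
          by (subst p0(1)[OF that(1)]) (simp add: algebra_simps)
        then show ?thesis using that(2) a by (simp add: A_def)
      qed
      then have "(\<Sum>b\<in>A. c b * poly (p0 b) a) = (\<Sum>b\<in>A. if b = a then c a * poly (p0 a) a else 0)"
        by (intro sum.cong) auto
      also have "\<dots> = poly q a" using a A p0(2)[OF a] by (simp add: c_def)
      finally show ?thesis using a by (simp add: N_def poly_sum A_def)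
    qed
    have "N = 0"
    proof (rule ccontr)
      assume N: "N \<noteq> 0"
      have "degree N \<le> degree p"
        unfolding N_def using less.prems(2) d0 A
        by (intro degree_diff_le degree_sum_le order.trans[OF degree_smult_le]) (auto intro: less_imp_le)
      moreover have "coeff N (degree p) = 0"
        using d0 p by (simp add: N_def coeff_sum coeff_eq_0 c0_def)
      then have "degree N \<noteq> degree p" using N leading_coeff_0_iff[of N] by metis
      moreover have "card A \<le> card {a. poly N a = 0}"
        using root N by (intro card_mono poly_roots_finite) auto
      then have "card A \<le> degree N" using card_poly_roots_bound[OF N] by linarith
      ultimately show False using card by simp
    qed
    have "poly q s / poly p s = c0 + (\<Sum>a\<in>A. c a / (s - a))" if s: "poly p s \<noteq> 0" for s
    proof -
      have "poly (p0 a) s / poly p s = 1 / (s - a)" if "a \<in> A" for a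
      proof -
        have eq: "poly p s = (s - a) * poly (p0 a) s"
          by (subst p0(1)[OF that]) (simp add: algebra_simps)
        then have "poly (p0 a) s \<noteq> 0" using s by auto
        then show ?thesis using eq by simp
      qed
      then have "(\<Sum>a\<in>A. c a * poly (p0 a) s / poly p s) = (\<Sum>a\<in>A. c a / (s - a))"
        by (intro sum.cong) (simp_all only: times_divide_eq_right[symmetric], simp)
      moreover have "poly q s = c0 * poly p s + (\<Sum>a\<in>A. c a * poly (p0 a) s)"
        using arg_cong[OF \<open>N = 0\<close>, of "\<lambda>f. poly f s"] by (simp add: N_def poly_sum)
      ultimately show ?thesis using s by (simp add: add_divide_distrib sum_divide_distrib)
    qed
    then show ?thesis using A p0(3) by (intro exI[of _ A] exI[of _ c0] exI[of _ c]) (auto simp: A_def c_def)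
  qed
qed

subsection \<open>The barrier inequality on a line\<close>

text \<open>Jensen's inequality: with \<open>a = 1 / b\<close> the terms are
  \<open>a / (1 + \<delta> * a)\<close>, concave in \<open>a\<close>. If \<open>B\<close> has fewer
  than \<open>k\<close> elements, the missing ones count as \<open>a = 0\<close>.\<close>

lemma sum_shifted_reciprocals_le:
  fixes \<delta> \<sigma> :: real
  assumes "\<And>b. b \<in># B \<Longrightarrow> b > 0" "size B \<le> k" "k \<ge> 1" "(\<Sum>b\<in>#B. 1 / b) \<le> \<sigma>" "\<sigma> > 0" "\<delta> > 0"
  shows "(\<Sum>b\<in>#B. 1 / (\<delta> + b)) \<le> \<sigma> / (1 + \<delta> * \<sigma> / real k)"
proof -
  define t where "t = \<sigma> / real k"
  have t: "t > 0" using assms by (simp add: t_def)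
  define w where "w = (1 + \<delta> * t) ^ 2"
  have "1 + \<delta> * t > 0" using t assms(6) by (simp add: add_pos_pos)
  then have w: "w > 0" by (simp add: w_def)
  \<comment> \<open>tangent at \<open>t\<close> of the concave function \<open>a \<mapsto> a / (1 + \<delta> a)\<close>, where \<open>a = 1 / b\<close>\<close>
  have tangent: "1 / (\<delta> + b) \<le> (\<delta> * t\<^sup>2 + 1 / b) / w" if b: "b > 0" for b
  proof -
    have "b * w \<le> (\<delta> * t\<^sup>2 * b + 1) * (\<delta> + b)"
      using zero_le_power2[of "b * t - 1"] assms(6)
        mult_left_mono[OF zero_le_power2[of "b * t - 1"], of \<delta>]
      by (simp add: w_def power2_eq_square algebra_simps)
    moreover have "\<delta> * t\<^sup>2 + 1 / b = (\<delta> * t\<^sup>2 * b + 1) / b" using b by (simp add: field_simps)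
    ultimately show ?thesis using b w assms(6) by (simp add: divide_simps mult_ac)
  qed
  have "(\<Sum>b\<in>#B. 1 / (\<delta> + b)) \<le> (\<Sum>b\<in>#B. (\<delta> * t\<^sup>2 + 1 / b) / w)"
    using assms(1) by (intro sum_mset_mono tangent)
  also have "\<dots> = (real (size B) * (\<delta> * t\<^sup>2) + (\<Sum>b\<in>#B. 1 / b)) / w"
    by (induction B) (simp_all add: add_divide_distrib algebra_simps)
  also have "\<dots> \<le> (real k * (\<delta> * t\<^sup>2) + \<sigma>) / w"
    using assms w t by (intro divide_right_mono add_mono mult_right_mono) auto
  also have "real k * (\<delta> * t\<^sup>2) + \<sigma> = \<sigma> * (1 + \<delta> * t)"
    using assms(3) by (simp add: t_def power2_eq_square field_simps)
  also have "\<dots> / w = \<sigma> / (1 + \<delta> * t)"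
    using t assms by (simp add: w_def power2_eq_square add_pos_pos)
  finally show ?thesis by (simp add: t_def)
qed

text \<open>Zeros are real because of \<open>pick\<close>, and negative because \<open>p\<close> is
  positive on the closed half-line. There the logarithmic derivative becomes a sum of positive
  decreasing terms.\<close>

lemma pick_log_derivative:
  assumes pq: "pick p q" and pos: "\<And>s. s \<ge> 0 \<Longrightarrow> poly p s > 0"
  obtains L where "size L = degree p" "\<And>l. l \<in># L \<longleftrightarrow> poly p l = 0" "\<And>l. l \<in># L \<Longrightarrow> l < 0"
    "\<And>s. s \<ge> 0 \<Longrightarrow> poly (pderiv p) s / poly p s = (\<Sum>l\<in>#L. 1 / (s - l))"
    "\<And>s. poly p s = lead_coeff p * (\<Prod>l\<in>#L. s - l)"
proof -
  obtain L where L: "size L = degree p" "p = smult (lead_coeff p) (\<Prod>l\<in>#L. [:- l, 1:])"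
    using pick_splits[OF pq] .
  have p: "lead_coeff p \<noteq> 0" using pos[of 0] by auto
  have ev: "poly p s = lead_coeff p * (\<Prod>l\<in>#L. s - l)" for s
    by (subst L(2)) (simp add: poly_prod_mset_linear)
  have root: "l \<in># L \<longleftrightarrow> poly p l = 0" for l
    using p by (auto simp: ev prod_mset_zero_iff)
  have neg: "l < 0" if "l \<in># L" for l
    using that pos[of l] root by force
  have "poly (pderiv p) s / poly p s = (\<Sum>l\<in>#L. 1 / (s - l))" if "s \<ge> 0" for s
  proof -
    have "s \<notin># L" using neg that by force
    have "poly (pderiv p) s = lead_coeff p * poly (pderiv (\<Prod>l\<in>#L. [:- l, 1:])) s"
      by (subst L(2)) (simp add: pderiv_smult)
    also have "\<dots> = poly p s * (\<Sum>l\<in>#L. 1 / (s - l))"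
      unfolding poly_pderiv_prod_mset_linear[OF \<open>s \<notin># L\<close>] ev by (simp add: poly_prod_mset_linear)
    finally show ?thesis using pos[OF that] by simp
  qed
  then show ?thesis using that L(1) root neg ev by blast
qed

lemma pick_log_derivative_le:
  assumes "pick p q" "\<And>s. s \<ge> 0 \<Longrightarrow> poly p s > 0"
    and "degree p \<le> r" "r \<ge> 1" "poly (pderiv p) 0 / poly p 0 \<le> \<sigma>" "\<sigma> > 0" "\<delta> > 0"
  shows "poly (pderiv p) \<delta> / poly p \<delta> \<le> \<sigma> / (1 + \<delta> * \<sigma> / real r)"
proof -
  obtain L where L: "size L = degree p" "\<And>l. l \<in># L \<Longrightarrow> l < 0"
    "\<And>s. s \<ge> 0 \<Longrightarrow> poly (pderiv p) s / poly p s = (\<Sum>l\<in>#L. 1 / (s - l))"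
    using pick_log_derivative[OF assms(1,2)] by metis
  have "(\<Sum>b\<in>#image_mset uminus L. 1 / (\<delta> + b)) \<le> \<sigma> / (1 + \<delta> * \<sigma> / real r)"
    using assms L(1,2) L(3)[of 0] by (intro sum_shifted_reciprocals_le) (auto simp: multiset.map_comp o_def)
  then show ?thesis using assms L(3)[of \<delta>] by (simp add: multiset.map_comp o_def)
qed

text \<open>Let \<open>F = q / p\<close> and \<open>\<psi> = p' / p\<close>. The left side is
  \<open>F - F' / (1 - \<psi>)\<close> at \<delta>, and the comparison with \<open>F 0\<close> holds
  for each partial fraction separately: for the zero \<open>a\<close> it amounts to
  \<open>\<psi> - 1 / (\<delta> - a) \<le> 1 - 1 / \<delta>\<close>, a bound on the sum over the
  other zeros. There are at most \<open>r - 1\<close> of these, hence the form of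
  \<open>bound\<close>; for \<open>r \<le> 1\<close> there are none.\<close>

lemma pick_barrier:
  assumes pq: "pick p q" and pos: "\<And>s. s \<ge> 0 \<Longrightarrow> poly p s > 0" "\<And>s. s \<ge> 0 \<Longrightarrow> poly q s \<ge> 0"
    and deg: "degree p \<le> r" and \<sigma>: "poly (pderiv p) 0 / poly p 0 \<le> \<sigma>" "\<sigma> > 0"
    and \<delta>: "\<delta> \<ge> 1" and less: "poly (pderiv p) \<delta> < poly p \<delta>"
    and bound: "r \<le> 1 \<or> \<sigma> / (1 + \<delta> * \<sigma> / real (r - 1)) \<le> 1 - 1 / \<delta>"
  shows "(poly q \<delta> - poly (pderiv q) \<delta>) / (poly p \<delta> - poly (pderiv p) \<delta>) \<le> poly q 0 / poly p 0"
proof -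
  obtain L where L: "size L = degree p" "\<And>l. l \<in># L \<longleftrightarrow> poly p l = 0" "\<And>l. l \<in># L \<Longrightarrow> l < 0"
    "\<And>s. s \<ge> 0 \<Longrightarrow> poly (pderiv p) s / poly p s = (\<Sum>l\<in>#L. 1 / (s - l))"
    using pick_log_derivative[OF pq pos(1)] by metis
  obtain A c0 c where A: "finite A" "\<And>a. a \<in> A \<Longrightarrow> a \<in># L" "\<And>a. a \<in> A \<Longrightarrow> c a \<ge> 0"
    "\<And>s. poly p s \<noteq> 0 \<Longrightarrow> poly q s / poly p s = c0 + (\<Sum>a\<in>A. c a / (s - a))"
    using pick_partial_fractions[OF pq pick_degree_le[OF pq pos]] unfolding L(2) by blast
  define \<psi> where "\<psi> = poly (pderiv p) \<delta> / poly p \<delta>"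
  define F where "F s = c0 + (\<Sum>a\<in>A. c a / (s - a))" for s
  define F' where "F' = (\<Sum>a\<in>A. - c a / (\<delta> - a)\<^sup>2)"
  have p\<delta>: "poly p \<delta> > 0" using pos \<delta> by simp
  have \<psi>: "1 - \<psi> > 0" using less p\<delta> by (simp add: \<psi>_def)
  have q: "poly q s = F s * poly p s" if "s \<ge> 0" for s
    using A(4)[of s] pos(1)[OF that] by (simp add: F_def field_simps)
  have others: "\<psi> - 1 / (\<delta> - a) \<le> 1 - 1 / \<delta>" if a: "a \<in> A" for a
  proof -
    obtain L1 where L1: "L = add_mset a L1" using A(2)[OF a] by (metis insert_DiffM)
    have "\<psi> - 1 / (\<delta> - a) = (\<Sum>l\<in>#L1. 1 / (\<delta> - l))"
      using L(4)[of \<delta>] \<delta> by (simp add: \<psi>_def L1)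
    also have "\<dots> \<le> 1 - 1 / \<delta>"
    proof (cases "r \<le> 1")
      case True
      then have "size L1 = 0" using L(1) deg unfolding L1 size_add_mset by linarith
      then have "L1 = {#}" by simp
      then show ?thesis using \<delta> by simp
    next
      case False
      \<comment> \<open>Dropping the positive term of \<open>a\<close> keeps the bound \<sigma> at
        0, while the number of zeros falls to at most \<open>r - 1\<close>.\<close>
      have "(\<Sum>l\<in>#L1. 1 / (0 - l)) \<le> (\<Sum>l\<in>#L. 1 / (0 - l))"
        using L(3)[of a] by (simp add: L1 divide_nonneg_neg)
      then have "(\<Sum>b\<in>#image_mset uminus L1. 1 / b) \<le> \<sigma>"
        using L(4)[of 0] \<sigma> by (simp add: multiset.map_comp o_def)
      then have "(\<Sum>b\<in>#image_mset uminus L1. 1 / (\<delta> + b)) \<le> \<sigma> / (1 + \<delta> * \<sigma> / real (r - 1))"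
        using False L(1,3) deg \<sigma>(2) \<delta> by (intro sum_shifted_reciprocals_le) (auto simp: L1)
      then show ?thesis using bound False by (simp add: multiset.map_comp o_def)
    qed
    finally show ?thesis .
  qed
  have DF: "(F has_real_derivative F') (at \<delta>)"
  proof -
    have "((\<lambda>s. c a / (s - a)) has_real_derivative - c a / (\<delta> - a)\<^sup>2) (at \<delta>)" if "a \<in> A" for a
      using L(3)[OF A(2)[OF that]] \<delta> by (auto intro!: derivative_eq_intros simp: power2_eq_square)
    from DERIV_add[OF DERIV_const DERIV_sum[of A, OF this]]
    show ?thesis unfolding F_def F'_def by simp
  qed
  have "((\<lambda>s. F s * poly p s) has_real_derivative F' * poly p \<delta> + F \<delta> * poly (pderiv p) \<delta>) (at \<delta>)"
    using DERIV_mult[OF DF poly_DERIV[of p \<delta>]] by (simp add: mult.commute add.commute)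
  then have "(poly q has_real_derivative F' * poly p \<delta> + F \<delta> * poly (pderiv p) \<delta>) (at \<delta>)"
    by (rule has_field_derivative_transform_within_open[of _ _ _ "{0<..}"]) (use \<delta> q in auto)
  then have q': "poly (pderiv q) \<delta> = F' * poly p \<delta> + F \<delta> * poly (pderiv p) \<delta>"
    by (metis DERIV_unique poly_DERIV)
  have "(poly q \<delta> - poly (pderiv q) \<delta>) / (poly p \<delta> - poly (pderiv p) \<delta>) = F \<delta> - F' / (1 - \<psi>)"
    using p\<delta> \<psi> less q[of \<delta>] \<delta> unfolding q' \<psi>_def by (simp add: field_simps)
  also have "\<dots> = c0 + (\<Sum>a\<in>A. c a / (\<delta> - a) + c a / (\<delta> - a)\<^sup>2 / (1 - \<psi>))"
    by (simp add: F_def F'_def sum.distrib sum_negf sum_divide_distrib)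
  also have "\<dots> \<le> c0 + (\<Sum>a\<in>A. c a / (0 - a))"
  proof (intro add_left_mono sum_mono)
    fix a assume a: "a \<in> A"
    define b where "b = - a"
    have b: "b > 0" using L(3)[OF A(2)[OF a]] by (simp add: b_def)
    have "1 / (\<delta> + b) + 1 / (\<delta> + b)\<^sup>2 / (1 - \<psi>) \<le> 1 / b"
    proof -
      have "1 / \<delta> - 1 / (\<delta> + b) \<le> 1 - \<psi>" using others[OF a] by (simp add: b_def)
      then have "b / (\<delta> * (\<delta> + b)) \<le> 1 - \<psi>" using \<delta> b by (simp add: field_simps)
      then have "1 / (\<delta> + b)\<^sup>2 / (1 - \<psi>) \<le> 1 / (\<delta> + b)\<^sup>2 / (b / (\<delta> * (\<delta> + b)))"
        using \<delta> b \<psi> by (intro divide_left_mono) auto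
      also have "\<dots> = \<delta> / (b * (\<delta> + b))"
      proof -
        have "1 / x\<^sup>2 / (b / (\<delta> * x)) = \<delta> / (b * x)" if "x \<noteq> 0" for x
          using that b \<delta> by (simp add: power2_eq_square)
        then show ?thesis using \<delta> b by simp
      qed
      also have "\<dots> = 1 / b - 1 / (\<delta> + b)" using \<delta> b by (simp add: field_simps)
      finally show ?thesis by simp
    qed
    from mult_left_mono[OF this A(3)[OF a]]
    show "c a / (\<delta> - a) + c a / (\<delta> - a)\<^sup>2 / (1 - \<psi>) \<le> c a / (0 - a)"
      by (simp add: b_def algebra_simps)
  qed
  also have "\<dots> = poly q 0 / poly p 0" using A(4)[of 0] pos(1)[of 0] by simp
  finally show ?thesis .
qed

subsection \<open>Hyperbolicity cones\<close>

definition homogfun :: "nat \<Rightarrow> (complex ^ 'n::finite \<Rightarrow> complex) \<Rightarrow> bool" where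
  "homogfun d F \<longleftrightarrow> polyfun F \<and> (\<forall>c z. F (c *s z) = c ^ d * F z)"

text \<open>Real-rootedness on lines in direction \<open>e\<close>, expressed as absence of zeros in
  the upper half-plane. Conjugation supplies the lower one, see
  \<open>hypfun_nonreal\<close>.\<close>

definition hypfun :: "nat \<Rightarrow> (complex ^ 'n::finite \<Rightarrow> complex) \<Rightarrow> real ^ 'n \<Rightarrow> bool" where
  "hypfun d F e \<longleftrightarrow> homogfun d F \<and> F (cvec e) \<noteq> 0 \<and>
     (\<forall>x t. Im t > 0 \<longrightarrow> F (cvec x + t *s cvec e) \<noteq> 0)"

text \<open>For hyperbolic \<open>F\<close> this is the open hyperbolicity cone: all zeros on the
  line through \<open>w\<close> in direction \<open>e\<close> are negative. In this form no
  eigenvalues have to be chosen.\<close>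

definition hcone :: "(complex ^ 'n::finite \<Rightarrow> complex) \<Rightarrow> real ^ 'n \<Rightarrow> (real ^ 'n) set" where
  "hcone F e = {w. \<forall>s\<ge>0. F (cvec (w + s *\<^sub>R e)) \<noteq> 0}"

lemma homogfun_smult: "homogfun d F \<Longrightarrow> F (c *s z) = c ^ d * F z"
  by (simp add: homogfun_def)

lemma hypfunD:
  assumes "hypfun d F e"
  shows "polyfun F" "homogfun d F" "F (cvec e) \<noteq> 0"
    "Im t > 0 \<Longrightarrow> F (cvec x + t *s cvec e) \<noteq> 0"
  using assms by (auto simp: hypfun_def homogfun_def)

lemma hypfun_nonreal:
  assumes "hypfun d F e" "Im t \<noteq> 0"
  shows "F (cvec x + t *s cvec e) \<noteq> 0"
proof (cases "Im t > 0")
  case False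
  then have "Im (cnj t) > 0" using assms(2) by simp
  then have "F (cvec x + cnj t *s cvec e) \<noteq> 0" by (rule hypfunD[OF assms(1)])
  moreover have "cvec x + t *s cvec e = (\<chi> i. cnj ((cvec x + cnj t *s cvec e) $ i))"
    by (simp add: vec_eq_iff)
  ultimately show ?thesis
    using polyfun_cnj[OF hypfunD(1)[OF assms(1)]] by (metis complex_cnj_zero_iff)
qed (use hypfunD[OF assms(1)] in auto)

text \<open>Homogeneity gives \<open>F (A + t *s B) = t ^ d * F (B + inverse t *s A)\<close>, so
  after division by \<open>t ^ d\<close> the polynomial tends to \<open>F B\<close> at infinity. Its
  degree is therefore \<open>d\<close> and its leading coefficient \<open>F B\<close>, whatever
  \<open>A\<close> is; the deformation argument needs this uniformity.\<close>

lemma homogfun_line_splits: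
  assumes F: "homogfun d F" and B: "F B \<noteq> 0"
  shows "\<exists>M. size M = d \<and> (\<forall>t. F (A + t *s B) = F B * (\<Prod>a\<in>#M. t - a))"
proof -
  have poly: "polyfun F" using F by (simp add: homogfun_def)
  obtain p where p: "\<And>t. F (A + t *s B) = poly p t"
    using polyfun_line[OF poly] by blast
  obtain q where q: "\<And>t. F (B + t *s A) = poly q t"
    using polyfun_line[OF poly] by blast
  have pq: "poly p t / t ^ d = poly q (inverse t)" if "t \<noteq> 0" for t
  proof -
    have "A + t *s B = t *s (B + inverse t *s A)"
      using that by (simp add: vec_eq_iff field_simps)
    then have "poly p t = t ^ d * poly q (inverse t)"
      using homogfun_smult[OF F] by (metis p q)
    then show ?thesis using that by simp
  qed
  have inv: "((\<lambda>t::complex. inverse t ^ k) \<longlongrightarrow> 0) at_infinity" if "k > 0" for k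
    using tendsto_power[OF tendsto_inverse_0, of k] that by (simp add: power_0_left)
  have "((\<lambda>t. poly q (inverse t)) \<longlongrightarrow> poly q 0) at_infinity"
    by (intro tendsto_intros tendsto_inverse_0)
  moreover have "poly q 0 = F B" using q[of 0] by simp
  moreover have "eventually (\<lambda>t. poly q (inverse t) = poly p t / t ^ d) at_infinity"
    unfolding eventually_at_infinity
  proof (intro exI[of _ 1] allI impI)
    fix t :: complex assume "1 \<le> norm t"
    then show "poly q (inverse t) = poly p t / t ^ d" by (intro pq[symmetric]) auto
  qed
  ultimately have lim: "((\<lambda>t. poly p t / t ^ d) \<longlongrightarrow> F B) at_infinity"
    using Lim_transform_eventually by fastforce
  have lc: "((\<lambda>t. poly p t / t ^ degree p) \<longlongrightarrow> lead_coeff p) at_infinity"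
    by (rule poly_divide_tendsto_aux)
  have nt: "(at_infinity :: complex filter) \<noteq> bot" by (rule trivial_limit_at_infinity)
  have *: "((\<lambda>t. poly p t / t ^ (m + k)) \<longlongrightarrow> 0) at_infinity"
    if "((\<lambda>t. poly p t / t ^ m) \<longlongrightarrow> l) at_infinity" "k > 0" for m k l
  proof -
    have "poly p t / t ^ (m + k) = poly p t / t ^ m * inverse t ^ k" for t
      by (simp add: power_add field_simps)
    then show ?thesis using tendsto_mult[OF that(1) inv[OF that(2)]] by simp
  qed
  have deg: "degree p = d"
  proof (rule linorder_cases[of "degree p" d])
    assume "degree p < d"
    then have "((\<lambda>t. poly p t / t ^ d) \<longlongrightarrow> 0) at_infinity"
      using *[OF lc, of "d - degree p"] by simp
    then show ?thesis using tendsto_unique[OF nt lim] B by blast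
  next
    assume less: "d < degree p"
    then have "((\<lambda>t. poly p t / t ^ degree p) \<longlongrightarrow> 0) at_infinity"
      using *[OF lim, of "degree p - d"] by simp
    then have "lead_coeff p = 0" using tendsto_unique[OF nt lc] by blast
    then show ?thesis using less by simp
  qed
  then have "lead_coeff p = F B" using tendsto_unique[OF nt lc] lim by simp
  moreover have "p \<noteq> 0" using calculation B by auto
  then obtain M where "size M = degree p" "p = smult (lead_coeff p) (\<Prod>a\<in>#M. [:- a, 1:])"
    using complex_poly_splits by blast
  then have "size M = d" "poly p t = F B * (\<Prod>a\<in>#M. t - a)" for t
    using calculation deg by (metis, metis poly_smult poly_prod_mset_linear)
  then show ?thesis unfolding p by blast
qed

lemma norm_smult_vec: "norm (c *s (x :: complex ^ 'n)) = norm c * norm x"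
  by (simp add: norm_vec_def vector_scalar_mult_def norm_mult L2_set_right_distrib)

text \<open>Garding's argument: the polynomial in \<open>t\<close> has no real zero at any stage of the deformation
  from \<open>x = 0, w = e\<close>, where its zeros are explicit.\<close>

lemma garding_step:
  assumes F: "hypfun d F e"
    and C: "\<And>x w. w \<in> C \<Longrightarrow> F (cvec x + \<i> *s cvec w) \<noteq> 0"
    and w: "\<And>\<tau>. 0 \<le> \<tau> \<Longrightarrow> \<tau> \<le> 1 \<Longrightarrow> (1 - \<tau>) *\<^sub>R e + \<tau> *\<^sub>R w \<in> C"
    and v: "v \<in> hcone F e" and t: "Im t \<ge> 0"
  shows "F (cvec x + \<i> *s cvec w + t *s cvec v) \<noteq> 0"
proof -
  note poly = hypfunD(1)[OF F] and hom = hypfunD(2)[OF F]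
  define A where "A \<tau> = cvec (\<tau> *\<^sub>R x) + \<i> *s cvec ((1 - \<tau>) *\<^sub>R e + \<tau> *\<^sub>R w)" for \<tau>
  define P where "P \<tau> t = F (A \<tau> + t *s cvec v)" for \<tau> t
  have v0: "F (cvec v) \<noteq> 0" using v by (auto simp: hcone_def dest: spec[of _ 0])
  have contA: "continuous_on S A" for S unfolding A_def by (intro continuous_intros)
  have "compact (A ` {0..1})" by (intro compact_continuous_image contA compact_Icc)
  then obtain M where M: "\<And>\<tau>. \<tau> \<in> {0..1} \<Longrightarrow> norm (A \<tau>) \<le> M"
    using compact_imp_bounded[of "A ` {0..1}"] unfolding bounded_iff by blast
  have M0: "M \<ge> 0" using M[of 0] norm_ge_zero[of "A 0"] by (simp del: norm_ge_zero)
  have "continuous_on UNIV F" using continuous_on_polyfun[OF poly continuous_on_id] by simp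
  then have "open (F -` (- {0}))" by (intro open_vimage) auto
  then obtain \<epsilon> where \<epsilon>: "\<epsilon> > 0" "\<And>z. dist z (cvec v) < \<epsilon> \<Longrightarrow> F z \<noteq> 0"
    using v0 unfolding open_dist by (metis ComplI singletonD vimageE vimageI singletonI ComplD)
  have "P 1 t \<noteq> 0"
  proof (rule root_homotopy[where P = P and R = "M / \<epsilon>" and c = "F (cvec v)" and d = d])
    show "continuous_on ({0..1} \<times> UNIV) (\<lambda>z. P (fst z) (snd z))"
      unfolding P_def by (intro continuous_on_polyfun[OF poly] continuous_intros continuous_on_compose2[OF contA[of UNIV]]) auto
  next
    \<comment> \<open>\<open>P \<tau> t\<close> is \<open>t ^ d\<close> times the value of
      \<open>F\<close> at \<open>v + A \<tau> / t\<close>. For large \<open>t\<close> this point is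
      so near to \<open>v\<close> that \<open>F\<close> does not vanish there.\<close>
    fix \<tau> t assume \<tau>: "\<tau> \<in> {0..1}" and P: "P \<tau> t = 0"
    show "norm t \<le> M / \<epsilon>"
    proof (rule ccontr)
      assume "\<not> norm t \<le> M / \<epsilon>"
      then have t: "norm t > M / \<epsilon>" "norm t > 0"
        using M0 \<epsilon>(1) by (auto intro: le_less_trans[OF divide_nonneg_pos])
      have "A \<tau> + t *s cvec v = t *s (cvec v + inverse t *s A \<tau>)"
        using t(2) by (simp add: vec_eq_iff field_simps)
      then have "P \<tau> t = t ^ d * F (cvec v + inverse t *s A \<tau>)"
        unfolding P_def using homogfun_smult[OF hom] by metis
      then have "F (cvec v + inverse t *s A \<tau>) = 0"
        using P t(2) by simp
      moreover have "norm (inverse t *s A \<tau>) < \<epsilon>"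
      proof -
        have "norm (inverse t *s A \<tau>) = norm (A \<tau>) / norm t"
          by (simp add: norm_smult_vec norm_inverse divide_inverse mult.commute del: inverse_eq_divide)
        also have "\<dots> \<le> M / norm t" using M[OF \<tau>] by (rule divide_right_mono) simp
        also have "\<dots> < \<epsilon>" using t \<epsilon>(1) by (simp add: field_simps)
        finally show ?thesis .
      qed
      ultimately show False using \<epsilon>(2)[of "cvec v + inverse t *s A \<tau>"] by (simp add: dist_norm)
    qed
  next
    fix \<tau> :: real
    show "\<exists>M. size M = d \<and> (\<forall>t. P \<tau> t = F (cvec v) * (\<Prod>a\<in>#M. t - a))"
      unfolding P_def by (rule homogfun_line_splits[OF hom v0])
  next
    \<comment> \<open>For real \<open>t\<close> the imaginary part is a point of the segment from
      \<open>e\<close> to \<open>w\<close>, which lies in \<open>C\<close>.\<close>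
    fix \<tau> t :: real assume \<tau>: "\<tau> \<in> {0..1}"
    have "A \<tau> + of_real t *s cvec v = cvec (\<tau> *\<^sub>R x + t *\<^sub>R v) + \<i> *s cvec ((1 - \<tau>) *\<^sub>R e + \<tau> *\<^sub>R w)"
      by (simp add: A_def cvec_add cvec_scaleR)
    then show "P \<tau> (of_real t) \<noteq> 0" using C w \<tau> by (simp add: P_def)
  next
    \<comment> \<open>For nonzero \<open>t\<close> the initial value is \<open>t ^ d\<close> times
      \<open>F\<close> at \<open>v + (\<i> / t) e\<close>. If \<open>\<i> / t\<close> is not real,
      hyperbolicity applies; if it is real, then \<open>Im t \<ge> 0\<close> makes it nonnegative,
      and \<open>v\<close> lies in the cone.\<close>
    fix t assume t: "Im t \<ge> 0"
    have A0: "A 0 + t *s cvec v = \<i> *s cvec e + t *s cvec v" by (simp add: A_def vec_eq_iff)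
    show "P 0 t \<noteq> 0"
    proof (cases "t = 0")
      case True
      have "P 0 t = F (\<i> *s cvec e)" unfolding P_def A0 by (simp add: True)
      then show ?thesis using homogfun_smult[OF hom, of \<i> "cvec e"] hypfunD(3)[OF F] by simp
    next
      case False
      have "F (cvec v + (\<i> / t) *s cvec e) \<noteq> 0"
      proof (cases "Im (\<i> / t) = 0")
        case True
        have "Re (\<i> / t) = Im t / (cmod t)\<^sup>2" by (simp add: Re_divide cmod_power2)
        then have "\<i> / t = of_real (Re (\<i> / t))" "Re (\<i> / t) \<ge> 0"
          using True t by (simp_all add: complex_eq_iff)
        then have "cvec v + (\<i> / t) *s cvec e = cvec (v + Re (\<i> / t) *\<^sub>R e)"
          by (metis cvec_add cvec_scaleR)
        then show ?thesis using v \<open>Re (\<i> / t) \<ge> 0\<close> by (simp add: hcone_def)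
      qed (use hypfun_nonreal[OF F] in auto)
      moreover have "\<i> *s cvec e + t *s cvec v = t *s (cvec v + (\<i> / t) *s cvec e)"
        using False by (simp add: vec_eq_iff field_simps)
      then have "P 0 t = t ^ d * F (cvec v + (\<i> / t) *s cvec e)"
        unfolding P_def A0 using homogfun_smult[OF hom] by metis
      ultimately show ?thesis using False by simp
    qed
  qed (use v0 t in auto)
  then show ?thesis by (simp add: P_def A_def)
qed

section \<open>Openness, stability and convexity of the hyperbolicity cone\<close>

context
  fixes F :: "complex ^ 'n::finite \<Rightarrow> complex" and e and d
  assumes F: "hypfun d F e"
begin

lemma hcone_self: "e \<in> hcone F e"
proof -
  have "F (cvec (e + s *\<^sub>R e)) \<noteq> 0" if s: "s \<ge> 0" for s
  proof -
    have "cvec (e + s *\<^sub>R e) = of_real (1 + s) *s cvec e"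
      by (simp add: vec_eq_iff algebra_simps)
    then have "F (cvec (e + s *\<^sub>R e)) = of_real (1 + s) ^ d * F (cvec e)"
      using homogfun_smult[OF hypfunD(2)[OF F]] by metis
    moreover have "complex_of_real (1 + s) \<noteq> 0"
      using s by (simp only: of_real_eq_0_iff)
    ultimately show ?thesis using hypfunD(3)[OF F] by (simp del: of_real_add)
  qed
  then show ?thesis by (simp add: hcone_def)
qed

text \<open>Application of \<open>garding_step\<close> with \<open>C\<close> the open ray through
  \<open>e\<close>, where the assumption on \<open>C\<close> is hyperbolicity itself.\<close>

lemma hcone_pair:
  assumes "v \<in> hcone F e" "\<alpha> > 0" "Im t \<ge> 0"
  shows "F (cvec x + \<i> *s cvec (\<alpha> *\<^sub>R e) + t *s cvec v) \<noteq> 0"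
proof (rule garding_step[OF F, where C = "(\<lambda>\<alpha>. \<alpha> *\<^sub>R e) ` {0<..}"])
  fix x w assume "w \<in> (\<lambda>\<alpha>. \<alpha> *\<^sub>R e) ` {0<..}"
  then obtain \<alpha> where \<alpha>: "\<alpha> > 0" "w = \<alpha> *\<^sub>R e" by auto
  have "\<i> *s cvec w = (\<i> * of_real \<alpha>) *s cvec e" by (simp add: \<alpha>(2) vec_eq_iff)
  then show "F (cvec x + \<i> *s cvec w) \<noteq> 0"
    using hypfunD(4)[OF F, of "\<i> * of_real \<alpha>" x] \<alpha>(1) by simp
next
  fix \<tau> :: real assume \<tau>: "0 \<le> \<tau>" "\<tau> \<le> 1"
  have "1 - \<tau> + \<tau> * \<alpha> > 0"
    using \<tau> assms(2) by (cases "\<tau> = 0") (auto intro: add_nonneg_pos)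
  moreover have "(1 - \<tau>) *\<^sub>R e + \<tau> *\<^sub>R \<alpha> *\<^sub>R e = (1 - \<tau> + \<tau> * \<alpha>) *\<^sub>R e"
    by (simp add: algebra_simps)
  ultimately show "(1 - \<tau>) *\<^sub>R e + \<tau> *\<^sub>R \<alpha> *\<^sub>R e \<in> (\<lambda>\<alpha>. \<alpha> *\<^sub>R e) ` {0<..}" by auto
qed (use assms in auto)

lemma hcone_diff:
  assumes "v \<in> hcone F e"
  obtains \<eta> where "\<eta> > 0" "v - \<eta> *\<^sub>R e \<in> hcone F e"
proof -
  have "continuous_on UNIV (\<lambda>s. F (cvec (v + s *\<^sub>R e)))"
    by (intro continuous_on_polyfun[OF hypfunD(1)[OF F]] continuous_intros)
  then have "open ((\<lambda>s. F (cvec (v + s *\<^sub>R e))) -` (- {0}))" by (intro open_vimage) auto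
  moreover have "0 \<in> (\<lambda>s. F (cvec (v + s *\<^sub>R e))) -` (- {0})"
    using assms by (auto simp: hcone_def dest: spec[of _ 0])
  ultimately have "\<exists>\<epsilon>>0. \<forall>s. dist s 0 < \<epsilon> \<longrightarrow> s \<in> (\<lambda>s. F (cvec (v + s *\<^sub>R e))) -` (- {0})"
    unfolding open_dist by blast
  then obtain \<epsilon> where \<epsilon>: "\<epsilon> > 0" "\<And>s. \<bar>s\<bar> < \<epsilon> \<Longrightarrow> F (cvec (v + s *\<^sub>R e)) \<noteq> 0"
    by auto
  have "v - (\<epsilon> / 2) *\<^sub>R e + s *\<^sub>R e = v + (s - \<epsilon> / 2) *\<^sub>R e" for s by (simp add: algebra_simps)
  moreover have "F (cvec (v + (s - \<epsilon> / 2) *\<^sub>R e)) \<noteq> 0" if "s \<ge> 0" for s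
  proof (cases "s \<ge> \<epsilon> / 2")
    case True
    then show ?thesis using assms by (simp add: hcone_def)
  next
    case False
    then show ?thesis using that \<epsilon>(1) by (intro \<epsilon>(2)) auto
  qed
  ultimately have "F (cvec (v - (\<epsilon> / 2) *\<^sub>R e + s *\<^sub>R e)) \<noteq> 0" if "s \<ge> 0" for s
    using that by metis
  then have "v - (\<epsilon> / 2) *\<^sub>R e \<in> hcone F e" by (simp add: hcone_def)
  then show ?thesis using that \<epsilon>(1) by (meson half_gt_zero)
qed

text \<open>Splitting \<open>w\<close> as \<open>\<eta> e + (w - \<eta> e)\<close> reduces this to
  \<open>hcone_pair\<close> with \<open>t = \<i>\<close>.\<close>

lemma hcone_stable:
  assumes "w \<in> hcone F e"
  shows "F (cvec x + \<i> *s cvec w) \<noteq> 0"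
proof -
  obtain \<eta> where \<eta>: "\<eta> > 0" "w - \<eta> *\<^sub>R e \<in> hcone F e" using hcone_diff[OF assms] .
  have "cvec x + \<i> *s cvec (\<eta> *\<^sub>R e) + \<i> *s cvec (w - \<eta> *\<^sub>R e) = cvec x + \<i> *s cvec w"
    by (simp add: vec_eq_iff algebra_simps)
  then show ?thesis using hcone_pair[OF \<eta>(2,1), of \<i> x] by (metis complex_i_mult_minus imaginary_unit.simps(2) zero_le_one)
qed

text \<open>Second application of \<open>garding_step\<close>: now \<open>C\<close> is generated by
  \<open>e\<close> and \<open>v - \<eta> e\<close>, and \<open>hcone_pair\<close> gives stability
  there. At the purely imaginary point \<open>\<i> (v + w + s e)\<close> homogeneity leads back to a
  real point.\<close>

lemma hcone_add:
  assumes v: "v \<in> hcone F e" and w: "w \<in> hcone F e"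
  shows "v + w \<in> hcone F e"
proof -
  obtain \<eta> where \<eta>: "\<eta> > 0" "v - \<eta> *\<^sub>R e \<in> hcone F e" using hcone_diff[OF v] .
  define C where "C = {\<alpha> *\<^sub>R e + \<beta> *\<^sub>R (v - \<eta> *\<^sub>R e) | \<alpha> \<beta>. \<alpha> > 0 \<and> \<beta> \<ge> 0}"
  have stable: "F (cvec x + \<i> *s cvec u) \<noteq> 0" if "u \<in> C" for x u
  proof -
    obtain \<alpha> \<beta> where ab: "\<alpha> > 0" "\<beta> \<ge> 0" "u = \<alpha> *\<^sub>R e + \<beta> *\<^sub>R (v - \<eta> *\<^sub>R e)"
      using \<open>u \<in> C\<close> by (auto simp: C_def)
    have "cvec x + \<i> *s cvec u = cvec x + \<i> *s cvec (\<alpha> *\<^sub>R e) + (\<i> * of_real \<beta>) *s cvec (v - \<eta> *\<^sub>R e)"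
      by (simp add: ab(3) vec_eq_iff algebra_simps)
    moreover have "Im (\<i> * of_real \<beta>) \<ge> 0" using ab(2) by simp
    ultimately show ?thesis using hcone_pair[OF \<eta>(2) ab(1), of "\<i> * of_real \<beta>" x] by metis
  qed
  have "F (cvec (v + w + s *\<^sub>R e)) \<noteq> 0" if s: "s \<ge> 0" for s
  proof -
    define u where "u = (\<eta> + s) *\<^sub>R e + 1 *\<^sub>R (v - \<eta> *\<^sub>R e)"
    have "F (cvec 0 + \<i> *s cvec u + \<i> *s cvec w) \<noteq> 0"
    proof (rule garding_step[OF F stable _ w])
      fix \<tau> :: real assume \<tau>: "0 \<le> \<tau>" "\<tau> \<le> 1"
      have "(1 - \<tau>) *\<^sub>R e + \<tau> *\<^sub>R u = (1 - \<tau> + \<tau> * (\<eta> + s)) *\<^sub>R e + \<tau> *\<^sub>R (v - \<eta> *\<^sub>R e)"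
        by (simp add: u_def algebra_simps)
      moreover have "1 - \<tau> + \<tau> * (\<eta> + s) > 0"
        using \<tau> \<eta>(1) s by (cases "\<tau> = 0") (auto intro: add_nonneg_pos)
      ultimately show "(1 - \<tau>) *\<^sub>R e + \<tau> *\<^sub>R u \<in> C" using \<tau> unfolding C_def by blast
    qed auto
    moreover have "cvec 0 + \<i> *s cvec u + \<i> *s cvec w = \<i> *s cvec (v + w + s *\<^sub>R e)"
      by (simp add: u_def vec_eq_iff algebra_simps)
    ultimately show ?thesis using homogfun_smult[OF hypfunD(2)[OF F], of \<i>] by auto
  qed
  then show ?thesis by (simp add: hcone_def)
qed

lemma hcone_scaleR:
  assumes "w \<in> hcone F e" "c > 0"
  shows "c *\<^sub>R w \<in> hcone F e"
proof -
  have "F (cvec (c *\<^sub>R w + s *\<^sub>R e)) \<noteq> 0" if "s \<ge> 0" for s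
  proof -
    have "cvec (c *\<^sub>R w + s *\<^sub>R e) = of_real c *s cvec (w + (s / c) *\<^sub>R e)"
      using assms(2) by (simp add: vec_eq_iff field_simps)
    moreover have "F (cvec (w + (s / c) *\<^sub>R e)) \<noteq> 0"
      using assms that by (simp add: hcone_def)
    ultimately show ?thesis
      using homogfun_smult[OF hypfunD(2)[OF F], of "of_real c"] assms(2) by (metis mult_eq_0_iff of_real_eq_0_iff order_less_irrefl power_eq_0_iff)
  qed
  then show ?thesis by (simp add: hcone_def)
qed

lemma hcone_add_direction:
  assumes "w \<in> hcone F e" "s \<ge> 0"
  shows "w + s *\<^sub>R e \<in> hcone F e"
  using assms by (simp add: hcone_def add.assoc flip: scaleR_add_left)

text \<open>The segment from \<open>w\<close> to \<open>e\<close> stays in the cone, where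
  \<open>F\<close> has no zero, so the intermediate value theorem excludes a change of sign.\<close>

lemma hcone_pos:
  assumes "Re (F (cvec e)) > 0" "w \<in> hcone F e"
  shows "Re (F (cvec w)) > 0"
proof (rule ccontr)
  assume neg: "\<not> Re (F (cvec w)) > 0"
  define g where "g \<tau> = Re (F (cvec (w + \<tau> *\<^sub>R (e - w))))" for \<tau>
  have "continuous_on {0..1} g"
    unfolding g_def by (intro continuous_on_polyfun[OF hypfunD(1)[OF F]] continuous_intros)
  moreover have "g 0 \<le> 0" "0 \<le> g 1" using neg assms(1) by (auto simp: g_def)
  ultimately obtain \<tau> where \<tau>: "0 \<le> \<tau>" "\<tau> \<le> 1" "g \<tau> = 0" using IVT'[of g 0 0 1] by auto
  have "w + \<tau> *\<^sub>R (e - w) \<in> hcone F e"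
  proof (cases "\<tau> = 1")
    case False
    then have "(1 - \<tau>) *\<^sub>R w + \<tau> *\<^sub>R e \<in> hcone F e"
      using \<tau> assms(2) by (intro hcone_add_direction hcone_scaleR) auto
    then show ?thesis by (simp add: algebra_simps)
  qed (simp add: hcone_self)
  then have "F (cvec (w + \<tau> *\<^sub>R (e - w))) \<noteq> 0" by (auto simp: hcone_def dest: spec[of _ 0])
  then show False using \<tau>(3) polyfun_real[OF hypfunD(1)[OF F]] unfolding g_def by (metis of_real_0)
qed

end

subsection \<open>Stable functions and the barrier argument\<close>

definition line :: "(complex ^ 'n::finite \<Rightarrow> complex) \<Rightarrow> real ^ 'n \<Rightarrow> real ^ 'n \<Rightarrow> real poly" where
  "line F x v = (SOME p. \<forall>s. F (cvec x + s *s cvec v) = poly (cpoly p) s)"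

lemma poly_cpoly_line:
  "polyfun F \<Longrightarrow> poly (cpoly (line F x v)) s = F (cvec x + s *s cvec v)"
  unfolding line_def by (rule someI2_ex[OF polyfun_line_real]) auto

lemma poly_line:
  assumes "polyfun F"
  shows "poly (line F x v) s = Re (F (cvec (x + s *\<^sub>R v)))"
proof -
  have "of_real (poly (line F x v) s) = F (cvec (x + s *\<^sub>R v))"
    using poly_cpoly_line[OF assms, of x v "of_real s"] by (simp add: cvec_add cvec_scaleR)
  then show ?thesis by (metis Re_complex_of_real)
qed

lemma line_eqI:
  assumes "polyfun F" "\<And>s. poly p s = Re (F (cvec (x + s *\<^sub>R v)))"
  shows "line F x v = p"
proof -
  have "poly (line F x v) = poly p" using assms by (simp add: fun_eq_iff poly_line)
  then show ?thesis by (simp only: poly_eq_poly_eq_iff)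
qed

lemma line_D:
  assumes "polyfun F"
  shows "line (D v F) x v = pderiv (line F x v)"
proof (rule line_eqI[OF polyfun_D[OF assms]])
  fix s :: real
  have "D v F (cvec x + of_real s *s cvec v) = poly (cpoly (pderiv (line F x v))) (of_real s)"
    by (rule D_line_real) (simp add: poly_cpoly_line assms)
  then show "poly (pderiv (line F x v)) s = Re (D v F (cvec (x + s *\<^sub>R v)))"
    by (simp add: cvec_add cvec_scaleR)
qed

lemma polyfun_D_power: "polyfun F \<Longrightarrow> polyfun ((D v ^^ k) F)"
  by (induction k) (auto intro: polyfun_D)

lemma line_D_power: "polyfun F \<Longrightarrow> line ((D v ^^ k) F) x v = (pderiv ^^ k) (line F x v)"
  by (induction k) (simp_all add: line_D polyfun_D_power)

text \<open>Rank as nilpotency of \<open>D v\<close>. Unlike a count of eigenvalues, this condition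
  is inherited by \<open>F - D w F\<close>, see \<open>D_power_diff_D\<close>.\<close>

lemma degree_line_le:
  assumes "polyfun F" "(D v ^^ Suc r) F = (\<lambda>z. 0)"
  shows "degree (line F x v) \<le> r"
proof (rule ccontr)
  assume "\<not> degree (line F x v) \<le> r"
  then obtain k where k: "degree (line F x v) = k + Suc r" by (metis add.commute less_iff_Suc_add linorder_not_le add_Suc_right add_Suc)
  have "(pderiv ^^ Suc r) (line F x v) = 0"
    using line_D_power[OF assms(1), where v = v and k = "Suc r" and x = x] assms(2)
    by (metis line_eqI[OF polyfun_0] poly_0 zero_complex.simps(1))
  then have "coeff (line F x v) (k + Suc r) = 0"
    using coeff_higher_pderiv[of "Suc r" "line F x v" k] by (simp add: pochhammer_eq_0_iff del: funpow.simps)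
  then show False using k by (metis Zero_not_Suc add_eq_0_iff_both_eq_0 degree_0 leading_coeff_0_iff)
qed

text \<open>The barrier function: the quotient \<open>D v F / F\<close> at a real point, where both
  values are real for polynomial functions.\<close>

definition ldv :: "real ^ 'n \<Rightarrow> (complex ^ 'n::finite \<Rightarrow> complex) \<Rightarrow> real ^ 'n \<Rightarrow> real" where
  "ldv v F x = Re (D v F (cvec x)) / Re (F (cvec x))"

lemma ldv_line: "polyfun F \<Longrightarrow> ldv w F (x + s *\<^sub>R v) = poly (line (D w F) x v) s / poly (line F x v) s"
  by (simp add: ldv_def poly_line polyfun_D)

text \<open>The function \<open>exp (-s) * poly p s\<close> decreases and is eventually positive.\<close>

lemma poly_pos_if_diff_pderiv_pos:
  fixes p :: "real poly"
  assumes pos: "\<And>s. s \<ge> 0 \<Longrightarrow> poly p s - poly (pderiv p) s > 0"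
  shows "poly p 0 > 0"
proof -
  have lc: "lead_coeff p > 0"
  proof -
    have p: "p \<noteq> 0" using pos[of 0] by auto
    have lc: "lead_coeff (p - pderiv p) = lead_coeff p"
    proof (cases "degree p = 0")
      case True
      then have "pderiv p = 0" by (simp add: pderiv_eq_0_iff)
      then show ?thesis by simp
    next
      case False
      then have "degree (- pderiv p) < degree p" by (simp add: degree_pderiv)
      from lead_coeff_add_le[OF this] show ?thesis by simp
    qed
    have "\<not> lead_coeff (- (p - pderiv p)) > 0"
    proof
      assume a: "lead_coeff (- (p - pderiv p)) > 0"
      then obtain n where "\<And>x. x \<ge> n \<Longrightarrow> poly (- (p - pderiv p)) x \<ge> lead_coeff (- (p - pderiv p))"
        using poly_pinfty_gt_lc by blast
      from this[of "max n 0"] a pos[of "max n 0"] show False by simp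
    qed
    then have "lead_coeff p \<ge> 0" unfolding lead_coeff_minus lc by simp
    then show ?thesis using p by (simp add: order_less_le)
  qed
  then obtain n where n: "\<And>x. x \<ge> n \<Longrightarrow> poly p x \<ge> lead_coeff p"
    using poly_pinfty_gt_lc by blast
  define T where "T = max n 0"
  have "exp (- T) * poly p T \<le> exp (- 0) * poly p 0"
  proof (rule DERIV_nonpos_imp_nonincreasing[of 0 T])
    fix x :: real assume "0 \<le> x" "x \<le> T"
    then have "exp (- x) * (poly p x - poly (pderiv p) x) \<ge> 0" using pos[of x] by simp
    then show "\<exists>y. ((\<lambda>s. exp (- s) * poly p s) has_real_derivative y) (at x) \<and> y \<le> 0"
      by (intro exI[of _ "- (exp (- x) * (poly p x - poly (pderiv p) x))"])
         (auto intro!: derivative_eq_intros simp: algebra_simps)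
  qed (simp add: T_def)
  moreover have "poly p T > 0" using n[of T] lc by (simp add: T_def)
  then have "exp (- T) * poly p T > 0" by simp
  ultimately show ?thesis by simp
qed

lemma sum_mset_reciprocal_nonneg:
  fixes L :: "real multiset"
  assumes "\<And>l. l \<in># L \<Longrightarrow> l < 0"
  shows "(\<Sum>l\<in>#L. 1 / (0 - l)) \<ge> 0"
  using assms
proof (induction L)
  case (add a L)
  have "1 / (0 - a) \<ge> 0" using add.prems[of a] by simp
  moreover have "(\<Sum>l\<in>#L. 1 / (0 - l)) \<ge> 0" using add by simp
  ultimately show ?case unfolding image_mset_add_mset sum_mset.add_mset by (rule add_nonneg_nonneg)
qed simp

text \<open>\<open>pos\<close> normalises the sign; for a hyperbolic polynomial it can be achieved
  by multiplication with -1.\<close>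

locale hyperbolic_cone =
  fixes h :: "complex ^ 'n::finite \<Rightarrow> complex" and d :: nat and e :: "real ^ 'n"
  assumes hyp: "hypfun d h e" and pos: "Re (h (cvec e)) > 0"
begin

abbreviation K where "K \<equiv> hcone h e"

text \<open>The closed cone, obtained from \<open>K\<close> by approximation along \<open>e\<close>
  alone instead of a topological closure.\<close>

definition Kc where "Kc = {v. \<forall>\<eta>>0. v + \<eta> *\<^sub>R e \<in> K}"

lemma K_add_Kc:
  assumes "w \<in> K" "v \<in> Kc"
  shows "w + v \<in> K"
proof -
  obtain \<eta> where \<eta>: "\<eta> > 0" "w - \<eta> *\<^sub>R e \<in> K" using hcone_diff[OF hyp assms(1)] .
  moreover have "v + \<eta> *\<^sub>R e \<in> K" using assms(2) \<eta>(1) by (simp add: Kc_def)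
  ultimately show ?thesis using hcone_add[OF hyp, of "w - \<eta> *\<^sub>R e" "v + \<eta> *\<^sub>R e"] by simp
qed

lemma K_subset_Kc: "K \<subseteq> Kc"
  by (auto simp: Kc_def intro: hcone_add_direction[OF hyp])

lemma Kc_add:
  assumes "v \<in> Kc" "w \<in> Kc"
  shows "v + w \<in> Kc"
proof -
  have "v + w + \<eta> *\<^sub>R e \<in> K" if "\<eta> > 0" for \<eta>
    using K_add_Kc[of "v + \<eta> *\<^sub>R e" w] assms that by (simp add: Kc_def ac_simps)
  then show ?thesis by (simp add: Kc_def)
qed

lemma Kc_0: "0 \<in> Kc"
  by (auto simp: Kc_def intro: hcone_scaleR[OF hyp hcone_self[OF hyp]])

lemma Kc_scaleR:
  assumes "v \<in> Kc" "c \<ge> 0"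
  shows "c *\<^sub>R v \<in> Kc"
proof (cases "c = 0")
  case False
  have "c *\<^sub>R v + \<eta> *\<^sub>R e = c *\<^sub>R (v + (\<eta> / c) *\<^sub>R e)" for \<eta>
    using False by (simp add: algebra_simps)
  then show ?thesis using assms False hcone_scaleR[OF hyp] by (auto simp: Kc_def)
qed (simp add: Kc_0)

lemma e_in_Kc: "e \<in> Kc"
  using K_subset_Kc hcone_self[OF hyp] by auto

definition stable :: "(complex ^ 'n \<Rightarrow> complex) \<Rightarrow> bool" where
  "stable F \<longleftrightarrow> polyfun F \<and> (\<forall>x w. w \<in> K \<longrightarrow> F (cvec x + \<i> *s cvec w) \<noteq> 0)"

lemma stable_polyfun: "stable F \<Longrightarrow> polyfun F"
  by (simp add: stable_def)

lemma stable_h: "stable h"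
  using hcone_stable[OF hyp] hypfunD(1)[OF hyp] by (simp add: stable_def)

text \<open>Along \<open>v\<close> the imaginary part \<open>k + Im s *\<^sub>R v\<close> stays in
  \<open>K\<close>, so the restricted polynomial has no zero with
  \<open>Im s \<ge> 0\<close>.\<close>

lemma stable_log_derivative:
  fixes x
  assumes F: "stable F" and k: "k \<in> K" and v: "v \<in> Kc"
  defines "z \<equiv> cvec x + \<i> *s cvec k"
  shows "D v F z = 0 \<or> Im (D v F z / F z) < 0"
proof -
  obtain p where p: "\<And>s. F (z + s *s cvec v) = poly p s"
    using polyfun_line[OF stable_polyfun[OF F]] by blast
  have "poly p s \<noteq> 0" if s: "Im s \<ge> 0" for s
  proof -
    have "z + s *s cvec v = cvec (x + Re s *\<^sub>R v) + \<i> *s cvec (k + Im s *\<^sub>R v)"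
      by (simp add: z_def vec_eq_iff complex_eq_iff)
    moreover have "k + Im s *\<^sub>R v \<in> K" by (intro K_add_Kc k Kc_scaleR v s)
    ultimately show ?thesis using F by (metis p stable_def)
  qed
  from log_derivative_lower_half_plane[OF this] show ?thesis
    using p[of 0] D_line[OF p, of 0] by auto
qed

text \<open>At a zero, \<open>D v F / F\<close> would have the real value \<open>1 / y\<close>, but
  it is 0 or in the open lower half-plane.\<close>

lemma stable_diff_D:
  assumes "stable F" "v \<in> Kc"
  shows "stable (\<lambda>z. F z - of_real y * D v F z)"
  unfolding stable_def
proof (intro conjI allI impI)
  show "polyfun (\<lambda>z. F z - of_real y * D v F z)"
    using stable_polyfun[OF assms(1)] by (intro polyfun_diff polyfun_cmult polyfun_D)
  fix x k assume k: "k \<in> K"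
  let ?z = "cvec x + \<i> *s cvec k"
  have F: "F ?z \<noteq> 0" using assms(1) k by (simp add: stable_def)
  show "F ?z - of_real y * D v F ?z \<noteq> 0"
  proof
    assume eq: "F ?z - of_real y * D v F ?z = 0"
    then have "D v F ?z \<noteq> 0" "y \<noteq> 0" using F by auto
    moreover from this have "D v F ?z / F ?z = of_real (1 / y)"
      using eq F by (simp add: field_simps)
    ultimately show False using stable_log_derivative[OF assms(1) k assms(2), of x] by simp
  qed
qed

lemma stable_diff_D': "stable F \<Longrightarrow> v \<in> Kc \<Longrightarrow> stable (\<lambda>z. F z - D v F z)"
  using stable_diff_D[of F v 1] by simp

section \<open>Points above the zeros of a stable function\<close>

definition above :: "(complex ^ 'n \<Rightarrow> complex) \<Rightarrow> (real ^ 'n) set" where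
  "above F = {x. \<forall>w\<in>Kc. Re (F (cvec (x + w))) > 0}"

lemma above_add: "x \<in> above F \<Longrightarrow> w \<in> Kc \<Longrightarrow> x + w \<in> above F"
  by (auto simp: above_def add.assoc Kc_add)

lemma above_pos: "x \<in> above F \<Longrightarrow> Re (F (cvec x)) > 0"
  using Kc_0 by (force simp: above_def)

lemma K_above_h: "x \<in> K \<Longrightarrow> x \<in> above h"
  by (auto simp: above_def intro: hcone_pos[OF hyp pos] K_add_Kc)

text \<open>For \<open>v\<close> on the boundary of the cone stability does not apply directly.
  Shifting by \<open>\<i> \<eta> e\<close> moves the imaginary part into \<open>K\<close>, and
  Hurwitz's theorem passes to the limit \<open>\<eta> = 0\<close>. It needs a nonconstant limit; a
  constant one equals its value at \<open>s = 0\<close> by continuity, which is nonzero.\<close>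

lemma above_line_nonzero:
  assumes F: "stable F" and x: "x \<in> above F" and v: "v \<in> Kc" and s0: "Im s0 > 0"
  shows "F (cvec x + s0 *s cvec v) \<noteq> 0"
proof -
  note poly = stable_polyfun[OF F]
  define \<Phi> where "\<Phi> \<eta> s = F (cvec x + (\<i> * of_real \<eta>) *s cvec e + s *s cvec v)" for \<eta> :: real and s
  define g where "g = \<Phi> 0"
  have g: "g s = F (cvec x + s *s cvec v)" for s by (simp add: g_def \<Phi>_def)
  have g0: "g 0 \<noteq> 0" using above_pos[OF x] by (auto simp: g)
  have cont: "continuous_on S (\<lambda>z. \<Phi> (fst z) (snd z))" for S
    unfolding \<Phi>_def by (intro continuous_on_polyfun[OF poly] continuous_intros)
  have holo: "\<Phi> \<eta> holomorphic_on S" for \<eta> S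
  proof -
    obtain p where "\<And>s. F (cvec x + (\<i> * of_real \<eta>) *s cvec e + s *s cvec v) = poly p s"
      using polyfun_line[OF poly] by blast
    then have "\<Phi> \<eta> = poly p" by (simp add: \<Phi>_def fun_eq_iff)
    then show ?thesis by (simp add: holomorphic_intros)
  qed
  have cg: "continuous_on UNIV g" unfolding g_def by (rule holomorphic_on_imp_continuous_on[OF holo])
  show ?thesis
  proof (cases "g constant_on {s. Im s > 0}")
    case True
    then obtain c where c: "\<And>s. Im s > 0 \<Longrightarrow> g s = c" by (auto simp: constant_on_def)
    have "(\<lambda>n. \<i> * of_real (1 / real (Suc n))) \<longlonglongrightarrow> \<i> * of_real 0"
      by (intro tendsto_intros LIMSEQ_Suc[OF lim_1_over_n])
    then have "(\<lambda>n. g (\<i> * of_real (1 / real (Suc n)))) \<longlonglongrightarrow> g (\<i> * of_real 0)"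
      using cg by (intro continuous_on_tendsto_compose[of UNIV g]) auto
    moreover have "g (\<i> * of_real (1 / real (Suc n))) = c" for n by (rule c) simp
    ultimately have "g 0 = c" using LIMSEQ_const_iff[of c "g 0"] by simp
    then show ?thesis using g0 c[OF s0] g by metis
  next
    case False
    have "g s0 \<noteq> 0"
    proof (rule Hurwitz_no_zeros[of "{s. Im s > 0}" "\<lambda>n. \<Phi> (1 / real (Suc n))" g])
      show "connected {s. Im s > 0}" by (intro convex_connected convex_halfspace_Im_gt)
      show "\<Phi> (1 / real (Suc n)) holomorphic_on {s. Im s > 0}" for n by (rule holo)
      show "g holomorphic_on {s. Im s > 0}" unfolding g_def by (rule holo)
    next
      fix C assume C: "compact C" "C \<subseteq> {s. Im s > 0}"
      have "uniformly_continuous_on ({0..1} \<times> C) (\<lambda>z. \<Phi> (fst z) (snd z))"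
        by (intro compact_uniformly_continuous cont compact_Times C compact_Icc)
      then show "uniform_limit C (\<lambda>n. \<Phi> (1 / real (Suc n))) g sequentially"
        unfolding uniform_limit_iff
      proof (intro allI impI)
        fix \<epsilon> :: real assume "uniformly_continuous_on ({0..1} \<times> C) (\<lambda>z. \<Phi> (fst z) (snd z))" "0 < \<epsilon>"
        then obtain \<delta> where \<delta>: "\<delta> > 0" "\<And>a b. a \<in> {0..1} \<times> C \<Longrightarrow> b \<in> {0..1} \<times> C \<Longrightarrow>
          dist b a < \<delta> \<Longrightarrow> dist (\<Phi> (fst b) (snd b)) (\<Phi> (fst a) (snd a)) < \<epsilon>"
          unfolding uniformly_continuous_on_def by metis
        have "(\<lambda>n. 1 / real (Suc n)) \<longlonglongrightarrow> 0" by (rule LIMSEQ_Suc[OF lim_1_over_n])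
        then have "eventually (\<lambda>n. 1 / real (Suc n) < \<delta>) sequentially"
          using \<delta>(1) by (rule order_tendstoD)
        then show "eventually (\<lambda>n. \<forall>s\<in>C. dist (\<Phi> (1 / real (Suc n)) s) (g s) < \<epsilon>) sequentially"
        proof eventually_elim
          case (elim n)
          show ?case
          proof
            fix s assume "s \<in> C"
            then show "dist (\<Phi> (1 / real (Suc n)) s) (g s) < \<epsilon>"
              using \<delta>(2)[of "(0, s)" "(1 / real (Suc n), s)"] elim
              by (simp add: g_def dist_Pair_Pair dist_real_def)
          qed
        qed
      qed
    next
      fix n s assume s: "s \<in> {s. Im s > 0}"
      define \<eta> where "\<eta> = 1 / real (Suc n)"
      have "cvec x + (\<i> * of_real \<eta>) *s cvec e + s *s cvec v =
        cvec (x + Re s *\<^sub>R v) + \<i> *s cvec (\<eta> *\<^sub>R e + Im s *\<^sub>R v)"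
        by (simp add: vec_eq_iff complex_eq_iff)
      moreover have "\<eta> *\<^sub>R e + Im s *\<^sub>R v \<in> K"
        using s by (intro K_add_Kc hcone_scaleR[OF hyp] hcone_self[OF hyp] Kc_scaleR v) (auto simp: \<eta>_def)
      ultimately show "\<Phi> (1 / real (Suc n)) s \<noteq> 0"
        using F unfolding \<Phi>_def \<eta>_def[symmetric] by (simp add: stable_def)
    qed (use False s0 in \<open>auto simp: open_halfspace_Im_gt\<close>)
    then show ?thesis by (simp add: g)
  qed
qed

text \<open>The same shift by \<open>\<i> \<eta> e\<close>; in the limit the strict inequality for
  the quotient becomes a weak one. This makes the univariate inequalities available on rays into the
  cone.\<close>

lemma above_pick:
  assumes F: "stable F" and x: "x \<in> above F" and v: "v \<in> Kc" and w: "w \<in> Kc"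
  shows "pick (line F x v) (line (D w F) x v)"
  unfolding pick_def
proof (intro allI impI conjI)
  note poly = stable_polyfun[OF F]
  fix s :: complex assume s: "Im s > 0"
  note nz = above_line_nonzero[OF F x v s]
  show "poly (cpoly (line F x v)) s \<noteq> 0" using nz by (simp add: poly_cpoly_line poly)
  define z where "z \<eta> = cvec x + s *s cvec v + (\<i> * of_real \<eta>) *s cvec e" for \<eta> :: real
  have z0: "z 0 = cvec x + s *s cvec v" by (simp add: z_def)
  have "continuous_on UNIV (\<lambda>\<eta>. F (z \<eta>))" "continuous_on UNIV (\<lambda>\<eta>. D w F (z \<eta>))"
    unfolding z_def by (intro continuous_on_polyfun[OF poly] continuous_on_polyfun[OF polyfun_D[OF poly]] continuous_intros)+
  then have "((\<lambda>\<eta>. F (z \<eta>)) \<longlongrightarrow> F (z 0)) (at_right 0)" "((\<lambda>\<eta>. D w F (z \<eta>)) \<longlongrightarrow> D w F (z 0)) (at_right 0)"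
    unfolding continuous_on_def by (meson UNIV_I subset_UNIV tendsto_within_subset)+
  then have "((\<lambda>\<eta>. Im (D w F (z \<eta>) / F (z \<eta>))) \<longlongrightarrow> Im (D w F (z 0) / F (z 0))) (at_right 0)"
    using nz by (intro tendsto_intros) (auto simp: z0)
  moreover have "eventually (\<lambda>\<eta>. Im (D w F (z \<eta>) / F (z \<eta>)) \<le> 0) (at_right 0)"
    unfolding eventually_at_right_field
  proof (intro exI[of _ 1] conjI allI impI)
    fix \<eta> :: real assume \<eta>: "0 < \<eta>"
    have "z \<eta> = cvec (x + Re s *\<^sub>R v) + \<i> *s cvec (\<eta> *\<^sub>R e + Im s *\<^sub>R v)"
      by (simp add: z_def vec_eq_iff complex_eq_iff)
    moreover have "\<eta> *\<^sub>R e + Im s *\<^sub>R v \<in> K"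
      using s \<eta> by (intro K_add_Kc hcone_scaleR[OF hyp] hcone_self[OF hyp] Kc_scaleR v) auto
    ultimately show "Im (D w F (z \<eta>) / F (z \<eta>)) \<le> 0"
      using stable_log_derivative[OF F _ w] by (metis div_0 less_imp_le order_refl zero_complex.simps(2))
  qed simp
  ultimately have "Im (D w F (z 0) / F (z 0)) \<le> 0" by (intro tendsto_upperbound) auto
  then show "Im (poly (cpoly (line (D w F) x v)) s / poly (cpoly (line F x v)) s) \<le> 0"
    by (simp add: poly_cpoly_line poly polyfun_D z0)
qed

lemma above_line_pos:
  assumes "stable F" "x \<in> above F" "v \<in> Kc" "s \<ge> 0"
  shows "poly (line F x v) s > 0"
  using above_pos[OF above_add[OF assms(2) Kc_scaleR[OF assms(3,4)]]]
  by (simp add: poly_line stable_polyfun[OF assms(1)])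

lemma ldv_nonneg:
  assumes F: "stable F" and x: "x \<in> above F" and v: "v \<in> Kc"
  shows "ldv v F x \<ge> 0"
proof -
  note poly = stable_polyfun[OF F]
  obtain L where L: "\<And>l. l \<in># L \<Longrightarrow> l < 0"
    "\<And>s. s \<ge> 0 \<Longrightarrow> poly (pderiv (line F x v)) s / poly (line F x v) s = (\<Sum>l\<in>#L. 1 / (s - l))"
    using pick_log_derivative[OF above_pick[OF F x v v] above_line_pos[OF F x v]] by metis
  have "ldv v F x = (\<Sum>l\<in>#L. 1 / (0 - l))"
    using ldv_line[OF poly, of v x 0 v] L(2)[of 0] by (simp add: line_D poly)
  also have "\<dots> \<ge> 0" using L(1) by (rule sum_mset_reciprocal_nonneg)
  finally show ?thesis .
qed

lemma ldv_antimono: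
  assumes F: "stable F" and x: "x \<in> above F" and v: "v \<in> Kc" and w: "w \<in> Kc"
  shows "ldv w F (x + v) \<le> ldv w F x"
  using pick_antimono[OF above_pick[OF F x v w] above_line_pos[OF F x v], of 1]
    ldv_line[OF stable_polyfun[OF F], of w x 1 v] ldv_line[OF stable_polyfun[OF F], of w x 0 v]
  by simp

text \<open>On real points \<open>F - D v F\<close> is \<open>F\<close> times
  \<open>1 - ldv v F\<close>, and this factor does not decrease along \<open>Kc\<close>, so it is
  enough to test it at \<open>x\<close>.\<close>

lemma above_diff_D:
  assumes F: "stable F" and x: "x \<in> above F" and v: "v \<in> Kc" and less: "ldv v F x < 1"
  shows "x \<in> above (\<lambda>z. F z - D v F z)"
  unfolding above_def
proof (intro CollectI ballI)
  fix w assume w: "w \<in> Kc"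
  have "ldv v F (x + w) < 1" using ldv_antimono[OF F x w v] less by simp
  then show "Re (F (cvec (x + w)) - D v F (cvec (x + w))) > 0"
    using above_pos[OF above_add[OF x w]] by (simp add: ldv_def divide_less_eq)
qed

lemma above_diff_D_subset:
  assumes F: "polyfun F" and v: "v \<in> Kc"
  shows "above (\<lambda>z. F z - D v F z) \<subseteq> above F"
proof
  fix x assume x: "x \<in> above (\<lambda>z. F z - D v F z)"
  show "x \<in> above F"
    unfolding above_def
  proof (intro CollectI ballI)
    fix w assume w: "w \<in> Kc"
    have "poly (line F (x + w) v) s - poly (pderiv (line F (x + w) v)) s > 0" if "s \<ge> 0" for s
      using above_pos[OF above_add[OF above_add[OF x w] Kc_scaleR[OF v that]]]
      by (simp add: poly_line F polyfun_D flip: line_D[OF F])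
    then have "poly (line F (x + w) v) 0 > 0" by (rule poly_pos_if_diff_pderiv_pos)
    then show "Re (F (cvec (x + w))) > 0" by (simp add: poly_line F)
  qed
qed

lemma above_diff_D_less:
  assumes F: "stable F" and v: "v \<in> Kc" and x: "x \<in> above (\<lambda>z. F z - D v F z)"
  shows "ldv v F x < 1"
proof -
  have "Re (F (cvec x)) > 0"
    using x above_diff_D_subset[OF stable_polyfun[OF F] v] by (auto intro: above_pos)
  then show ?thesis using above_pos[OF x] by (simp add: ldv_def)
qed

text \<open>On a line in direction \<open>v\<close> all zeros \<open>l\<close> are negative and the
  sum of \<open>1 / (0 - l)\<close> is below 1. Hence each \<open>l < -1\<close>, and
  \<open>F\<close> is still positive one step back.\<close>

lemma above_diff_D_minus:
  assumes F: "stable F" and v: "v \<in> Kc" and x: "x \<in> above (\<lambda>z. F z - D v F z)"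
  shows "x - v \<in> above F"
  unfolding above_def
proof (intro CollectI ballI)
  note poly = stable_polyfun[OF F]
  fix w assume w: "w \<in> Kc"
  define y where "y = x + w"
  have y: "y \<in> above (\<lambda>z. F z - D v F z)" unfolding y_def by (rule above_add[OF x w])
  then have yF: "y \<in> above F" using above_diff_D_subset[OF poly v] by auto
  define p where "p = line F y v"
  obtain L where L: "\<And>l. l \<in># L \<Longrightarrow> l < 0"
    "\<And>s. s \<ge> 0 \<Longrightarrow> poly (pderiv p) s / poly p s = (\<Sum>l\<in>#L. 1 / (s - l))"
    "\<And>s. poly p s = lead_coeff p * (\<Prod>l\<in>#L. s - l)"
    using pick_log_derivative[OF above_pick[OF F yF v v] above_line_pos[OF F yF v]] unfolding p_def by metis
  have sum: "(\<Sum>l\<in>#L. 1 / (0 - l)) < 1"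
    using above_diff_D_less[OF F v y] ldv_line[OF poly, of v y 0 v] L(2)[of 0]
    by (simp add: line_D poly p_def)
  have l: "l < -1" if l: "l \<in># L" for l
  proof -
    obtain M where M: "L = add_mset l M" using l by (metis insert_DiffM)
    have "(\<Sum>l\<in>#M. 1 / (0 - l)) \<ge> 0" using L(1) by (intro sum_mset_reciprocal_nonneg) (simp add: M)
    then have "1 / (0 - l) < 1" using sum unfolding M by simp
    then show ?thesis using L(1)[OF l] by (simp add: field_simps)
  qed
  have prod: "(\<Prod>l\<in>#B. s - l) > 0" if "\<And>l. l \<in># B \<Longrightarrow> l < s" for B :: "real multiset" and s
    using that by (induction B) auto
  have "poly p 0 > 0" using above_line_pos[OF F yF v, of 0] by (simp add: p_def)
  then have "lead_coeff p > 0"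
    using L(3)[of 0] prod[of L 0] L(1) by (metis zero_less_mult_pos2)
  then have "poly p (-1) > 0" using L(3)[of "-1"] prod[of L "-1"] l by simp
  then show "Re (F (cvec (x - v + w))) > 0"
    by (simp add: p_def poly_line poly y_def algebra_simps)
qed

text \<open>\<open>pick_barrier\<close> for the restrictions \<open>p\<close> of \<open>F\<close>
  and \<open>q\<close> of \<open>D w F\<close> to the line through \<open>x\<close> along
  \<open>v\<close>. As \<open>D v\<close> and \<open>D w\<close> commute, \<open>q - q'\<close> is
  the restriction of \<open>D w (F - D v F)\<close>.\<close>

lemma barrier_step:
  assumes F: "stable F" and x: "x \<in> above F" and v: "v \<in> Kc"
    and rank: "(D v ^^ Suc r) F = (\<lambda>z. 0)" and r: "r \<ge> 1"
    and \<sigma>: "ldv v F x \<le> \<sigma>" "\<sigma> > 0" and \<delta>: "\<delta> \<ge> 1"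
    and small: "\<sigma> / (1 + \<delta> * \<sigma> / real r) < 1"
    and bound: "r \<le> 1 \<or> \<sigma> / (1 + \<delta> * \<sigma> / real (r - 1)) \<le> 1 - 1 / \<delta>"
  shows "x + \<delta> *\<^sub>R v \<in> above (\<lambda>z. F z - D v F z)"
    and "w \<in> Kc \<Longrightarrow> ldv w (\<lambda>z. F z - D v F z) (x + \<delta> *\<^sub>R v) \<le> ldv w F x"
proof -
  note poly = stable_polyfun[OF F]
  define p where "p = line F x v"
  have p': "pderiv p = line (D v F) x v" by (simp add: p_def line_D poly)
  have pos: "poly p s > 0" if "s \<ge> 0" for s using above_line_pos[OF F x v that] by (simp add: p_def)
  have deg: "degree p \<le> r" unfolding p_def by (rule degree_line_le[OF poly rank])
  have \<sigma>': "poly (pderiv p) 0 / poly p 0 \<le> \<sigma>"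
    unfolding p' unfolding p_def using \<sigma>(1) ldv_line[OF poly, of v x 0 v] by simp
  have "poly (pderiv p) \<delta> / poly p \<delta> \<le> \<sigma> / (1 + \<delta> * \<sigma> / real r)"
    using above_pick[OF F x v v] pos deg r \<sigma>' \<sigma>(2) \<delta> unfolding p_def by (intro pick_log_derivative_le) auto
  \<comment> \<open>The barrier along \<open>v\<close> has fallen below 1 at
    \<open>x + \<delta> v\<close>, so the operator can be applied there.\<close>
  then have lt: "poly (pderiv p) \<delta> / poly p \<delta> < 1" using small by linarith
  have xv: "x + \<delta> *\<^sub>R v \<in> above F" using \<delta> by (intro above_add x Kc_scaleR v) simp
  have "ldv v F (x + \<delta> *\<^sub>R v) < 1" using lt ldv_line[OF poly, of v x \<delta> v] unfolding p' unfolding p_def by simp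
  then show "x + \<delta> *\<^sub>R v \<in> above (\<lambda>z. F z - D v F z)" by (rule above_diff_D[OF F xv v])
  assume w: "w \<in> Kc"
  define q where "q = line (D w F) x v"
  have q': "pderiv q = line (D v (D w F)) x v" by (simp add: q_def line_D poly polyfun_D)
  have "(poly q \<delta> - poly (pderiv q) \<delta>) / (poly p \<delta> - poly (pderiv p) \<delta>) \<le> poly q 0 / poly p 0"
  proof (rule pick_barrier[OF _ pos _ deg \<sigma>' \<sigma>(2) \<delta> _ bound])
    show "pick p q" unfolding p_def q_def by (rule above_pick[OF F x v w])
    show "poly (pderiv p) \<delta> < poly p \<delta>" using lt pos[of \<delta>] \<delta> by (simp add: divide_less_eq)
    fix s :: real assume s: "s \<ge> 0"
    have "ldv w F (x + s *\<^sub>R v) \<ge> 0" by (intro ldv_nonneg F above_add x Kc_scaleR v s w)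
    then show "poly q s \<ge> 0"
      using ldv_line[OF poly, of w x s v] pos[OF s] by (simp add: p_def q_def zero_le_divide_iff)
  qed
  also have "(poly q \<delta> - poly (pderiv q) \<delta>) / (poly p \<delta> - poly (pderiv p) \<delta>) =
    ldv w (\<lambda>z. F z - D v F z) (x + \<delta> *\<^sub>R v)"
    unfolding q' p' unfolding p_def q_def
    by (simp add: ldv_def D_diff polyfun_D poly D_commute[of F w v] poly_line)
  also have "poly q 0 / poly p 0 = ldv w F x"
    using ldv_line[OF poly, of w x 0 v] by (simp add: p_def q_def)
  finally show "ldv w (\<lambda>z. F z - D v F z) (x + \<delta> *\<^sub>R v) \<le> ldv w F x" .
qed

end

subsection \<open>Products of the operators 1 - y D\<close>

text \<open>The product of the operators \<open>1 - y i * D (u i)\<close>, expanded so that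
  derivatives act on \<open>F\<close> only. The coefficients stay outside and are complex, so they
  can serve as further variables in \<open>above_rops_add\<close>.\<close>

fun ops :: "(nat \<Rightarrow> complex) \<Rightarrow> (nat \<Rightarrow> real ^ 'n) \<Rightarrow> nat list \<Rightarrow>
    (complex ^ 'n::finite \<Rightarrow> complex) \<Rightarrow> complex ^ 'n \<Rightarrow> complex" where
  "ops y u [] F = F"
| "ops y u (i # l) F = (\<lambda>z. ops y u l F z - y i * ops y u l (D (u i) F) z)"

abbreviation rops :: "(nat \<Rightarrow> real) \<Rightarrow> (nat \<Rightarrow> real ^ 'n) \<Rightarrow> nat list \<Rightarrow>
    (complex ^ 'n::finite \<Rightarrow> complex) \<Rightarrow> complex ^ 'n \<Rightarrow> complex" where
  "rops c \<equiv> ops (\<lambda>i. of_real (c i))"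

lemma polyfun_ops_compose:
  fixes g :: "complex ^ 'k::finite \<Rightarrow> complex ^ 'n::finite"
  assumes "polyfun F" "\<And>i. polyfun (y i)" "\<And>i. polyfun (\<lambda>p. g p $ i)"
  shows "polyfun (\<lambda>p. ops (\<lambda>i. y i p) u l F (g p))"
  using assms(1)
proof (induction l arbitrary: F)
  case Nil
  then show ?case using polyfun_compose[OF _ assms(3)] by simp
next
  case (Cons i l)
  then show ?case by (auto intro!: assms(2) polyfun_diff polyfun_mult polyfun_D)
qed

lemma polyfun_rops: "polyfun F \<Longrightarrow> polyfun (rops c u l F)"
  by (rule polyfun_ops_compose[of F "\<lambda>i z. of_real (c i)" "\<lambda>z. z", OF _ polyfun_const polyfun_coord])

lemma ops_cong:
  "(\<And>i. i \<in> set l \<Longrightarrow> y i = y' i \<and> u i = u' i) \<Longrightarrow> ops y u l F = ops y' u' l F"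
  by (induction l arbitrary: F) auto

lemma ops_0 [simp]: "ops (\<lambda>i. 0) u l F = F"
  by (induction l arbitrary: F) auto

lemma ops_diff:
  assumes "polyfun F" "polyfun G"
  shows "ops y u l (\<lambda>z. F z - of_real b * G z) = (\<lambda>z. ops y u l F z - of_real b * ops y u l G z)"
  using assms
  by (induction l arbitrary: F G)
     (simp_all add: D_diff D_cmult polyfun_cmult polyfun_D, simp add: algebra_simps)

lemma D_rops:
  assumes "polyfun F"
  shows "D v (rops c u l F) = rops c u l (D v F)"
  using assms
  by (induction l arbitrary: F)
     (auto simp: D_diff D_cmult polyfun_cmult polyfun_D polyfun_rops D_commute[of _ v])

lemma rops_Cons:
  assumes "polyfun F"
  shows "rops c u (i # l) F = rops c u l (\<lambda>z. F z - of_real (c i) * D (u i) F z)"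
  using assms by (simp add: ops_diff polyfun_D)

lemma rops_Cons':
  assumes "polyfun F"
  shows "rops c u (i # l) F = (\<lambda>z. rops c u l F z - of_real (c i) * D (u i) (rops c u l F) z)"
  using assms by (simp add: D_rops)

text \<open>The factors commute, so any one of them can be applied last.\<close>

lemma rops_remove1:
  assumes "polyfun F" "i \<in> set l"
  shows "rops c u l F = (\<lambda>z. rops c u (remove1 i l) F z - of_real (c i) * D (u i) (rops c u (remove1 i l) F) z)"
  using assms
proof (induction l arbitrary: F)
  case (Cons j l)
  show ?case
  proof (cases "i = j")
    case True
    then show ?thesis using rops_Cons'[OF Cons.prems(1)] by simp
  next
    case False
    let ?G = "\<lambda>z. F z - of_real (c j) * D (u j) F z"
    have "polyfun ?G" using Cons.prems by (intro polyfun_diff polyfun_cmult polyfun_D)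
    then show ?thesis
      using Cons.IH[of ?G] Cons.prems False by (simp add: rops_Cons del: ops.simps)
  qed
qed simp

text \<open>Each derivative lowers the degree by one. The factor \<open>c ^ k\<close> counts the
  derivatives already taken and avoids subtraction in the exponent.\<close>

lemma D_homogeneous:
  assumes F: "polyfun F" and hom: "\<And>z. c ^ k * F (c *s z) = c ^ d * F z"
  shows "c ^ Suc k * D v F (c *s z) = c ^ d * D v F z"
proof -
  have "((\<lambda>s. F (c *s z + s *s cvec v)) has_field_derivative D v F (c *s z)) (at (c * 0))"
    using polyfun_has_derivative[OF F, of "c *s z" v 0] by simp
  moreover have "((\<lambda>s. c * s) has_field_derivative c) (at 0)"
    by (auto intro!: derivative_eq_intros)
  ultimately have "((\<lambda>s. F (c *s z + (c * s) *s cvec v)) has_field_derivative D v F (c *s z) * c) (at 0)"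
    by (rule DERIV_chain2)
  then have "((\<lambda>s. c ^ k * F (c *s z + (c * s) *s cvec v)) has_field_derivative c ^ k * (D v F (c *s z) * c)) (at 0)"
    by (rule DERIV_cmult)
  moreover have "c ^ k * F (c *s z + (c * s) *s cvec v) = c ^ d * F (z + s *s cvec v)" for s
    using hom[of "z + s *s cvec v"] by (simp add: vector_add_ldistrib vector_smult_assoc)
  ultimately have "((\<lambda>s. c ^ d * F (z + s *s cvec v)) has_field_derivative c ^ k * (D v F (c *s z) * c)) (at 0)"
    by simp
  moreover have "((\<lambda>s. c ^ d * F (z + s *s cvec v)) has_field_derivative c ^ d * D v F z) (at 0)"
    using DERIV_cmult[OF polyfun_has_derivative[OF F, of z v 0]] by simp
  ultimately show ?thesis using DERIV_unique by fastforce
qed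

text \<open>Joint homogeneity in the point and the coefficients: a factor \<open>c\<close> on
  \<open>y i\<close> makes up for the degree lost to \<open>D (u i)\<close>.\<close>

lemma ops_homogeneous:
  assumes F: "polyfun F" and hom: "\<And>z. c ^ k * F (c *s z) = c ^ d * F z"
  shows "c ^ k * ops (\<lambda>i. c * y i) u l F (c *s z) = c ^ d * ops y u l F z"
  using assms
proof (induction l arbitrary: F k)
  case (Cons i l)
  have "c ^ Suc k * ops (\<lambda>i. c * y i) u l (D (u i) F) (c *s z) = c ^ d * ops y u l (D (u i) F) z"
    using Cons.prems by (intro Cons.IH polyfun_D D_homogeneous)
  moreover have "c ^ k * ops (\<lambda>i. c * y i) u l F (c *s z) = c ^ d * ops y u l F z"
    using Cons by simp
  ultimately show ?case by (simp add: algebra_simps)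
qed simp

lemma D_power_diff_D:
  assumes "polyfun F" "(D v ^^ k) F = (\<lambda>z. 0)"
  shows "(D v ^^ k) (\<lambda>z. F z - D w F z) = (\<lambda>z. 0)"
proof -
  have "(D v ^^ k) (\<lambda>z. F z - D w F z) = (\<lambda>z. (D v ^^ k) F z - D w ((D v ^^ k) F) z)"
    using assms(1)
    by (induction k) (simp_all add: D_diff polyfun_D polyfun_D_power D_commute[of _ v w])
  then show ?thesis by (simp add: assms(2))
qed

context hyperbolic_cone
begin

lemma stable_rops:
  assumes "stable F" "\<And>i. i \<in> set l \<Longrightarrow> u i \<in> Kc"
  shows "stable (rops c u l F)"
  using assms
proof (induction l arbitrary: F)
  case (Cons i l)
  then show ?case
    by (simp only: rops_Cons[OF stable_polyfun[OF Cons.prems(1)]]) (simp add: stable_diff_D)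
qed simp

text \<open>Repeated \<open>barrier_step\<close>. The bound is carried for all of \<open>J\<close>,
  not only for the list, because \<open>mixed_bound\<close> needs it for the index left out of the
  list.\<close>

lemma barrier_list:
  assumes "stable F" "x \<in> above F" "set l \<subseteq> J"
    and J: "\<And>j. j \<in> J \<Longrightarrow> u j \<in> Kc"
      "\<And>j. j \<in> J \<Longrightarrow> (D (u j) ^^ Suc r) F = (\<lambda>z. 0)" "\<And>j. j \<in> J \<Longrightarrow> ldv (u j) F x \<le> \<sigma>"
    and r: "r \<ge> 1" "\<sigma> > 0" "\<delta> \<ge> 1" "\<sigma> / (1 + \<delta> * \<sigma> / real r) < 1"
      "r \<le> 1 \<or> \<sigma> / (1 + \<delta> * \<sigma> / real (r - 1)) \<le> 1 - 1 / \<delta>"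
  shows "x + \<delta> *\<^sub>R (\<Sum>i\<leftarrow>l. u i) \<in> above (rops (\<lambda>_. 1) u l F) \<and>
    (\<forall>j\<in>J. ldv (u j) (rops (\<lambda>_. 1) u l F) (x + \<delta> *\<^sub>R (\<Sum>i\<leftarrow>l. u i)) \<le> \<sigma>)"
  using assms(1-3) J
proof (induction l arbitrary: F x)
  case (Cons i l)
  let ?G = "\<lambda>z. F z - D (u i) F z"
  have i: "i \<in> J" using Cons.prems by simp
  note step = barrier_step[OF Cons.prems(1,2) Cons.prems(4)[OF i] Cons.prems(5)[OF i] r(1) Cons.prems(6)[OF i] r(2-5)]
  have eq: "rops (\<lambda>_. 1) u (i # l) F = rops (\<lambda>_. 1) u l ?G"
    using rops_Cons[OF stable_polyfun[OF Cons.prems(1)], of "\<lambda>_. 1" u i l] by simp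
  have "x + \<delta> *\<^sub>R u i + \<delta> *\<^sub>R (\<Sum>i\<leftarrow>l. u i) \<in> above (rops (\<lambda>_. 1) u l ?G) \<and>
    (\<forall>j\<in>J. ldv (u j) (rops (\<lambda>_. 1) u l ?G) (x + \<delta> *\<^sub>R u i + \<delta> *\<^sub>R (\<Sum>i\<leftarrow>l. u i)) \<le> \<sigma>)"
  proof (rule Cons.IH)
    show "stable ?G" using Cons.prems(1) Cons.prems(4)[OF i] by (rule stable_diff_D')
    show "x + \<delta> *\<^sub>R u i \<in> above ?G" by (rule step(1))
    show "set l \<subseteq> J" using Cons.prems(3) by simp
    fix j assume j: "j \<in> J"
    show "u j \<in> Kc" by (rule Cons.prems(4)[OF j])
    show "(D (u j) ^^ Suc r) ?G = (\<lambda>z. 0)"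
      by (rule D_power_diff_D[OF stable_polyfun[OF Cons.prems(1)] Cons.prems(5)[OF j]])
    show "ldv (u j) ?G (x + \<delta> *\<^sub>R u i) \<le> \<sigma>"
      using step(2)[OF Cons.prems(4)[OF j]] Cons.prems(6)[OF j] by linarith
  qed
  then show ?case unfolding eq by (simp add: scaleR_add_right add.assoc)
qed simp

text \<open>The restriction of \<open>(x, y) \<mapsto> rops y u l h x\<close> to the span of
  \<open>(e, 0)\<close> and the two points is a hyperbolic polynomial in three variables, whose cone is convex.\<close>

lemma above_rops_add:
  assumes u: "\<And>i. i \<in> set l \<Longrightarrow> u i \<in> Kc"
    and x1: "x1 \<in> above (rops y1 u l h)" and x2: "x2 \<in> above (rops y2 u l h)"
  shows "x1 + x2 \<in> above (rops (\<lambda>i. y1 i + y2 i) u l h)"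
  unfolding above_def
proof (intro CollectI ballI)
  fix w assume w: "w \<in> Kc"
  have x2w: "x2 + w \<in> above (rops y2 u l h)" by (rule above_add[OF x2 w])
  define g :: "complex ^ 3 \<Rightarrow> complex ^ 'n" where
    "g p = p $ 1 *s cvec e + p $ 2 *s cvec x1 + p $ 3 *s cvec (x2 + w)" for p
  define y :: "nat \<Rightarrow> complex ^ 3 \<Rightarrow> complex" where
    "y i p = p $ 2 * of_real (y1 i) + p $ 3 * of_real (y2 i)" for i p
  define G where "G p = ops (\<lambda>i. y i p) u l h (g p)" for p
  define e1 :: "real ^ 3" where "e1 = vector [1, 0, 0]"
  have G: "G (cvec p + t *s cvec e1) =
      rops (\<lambda>i. p $ 2 * y1 i + p $ 3 * y2 i) u l h
        (cvec (p $ 1 *\<^sub>R e + p $ 2 *\<^sub>R x1 + p $ 3 *\<^sub>R (x2 + w)) + t *s cvec e)" for p :: "real ^ 3" and t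
  proof -
    have "g (cvec p + t *s cvec e1) = cvec (p $ 1 *\<^sub>R e + p $ 2 *\<^sub>R x1 + p $ 3 *\<^sub>R (x2 + w)) + t *s cvec e"
      by (simp add: g_def e1_def vec_eq_iff algebra_simps)
    moreover have "y i (cvec p + t *s cvec e1) = of_real (p $ 2 * y1 i + p $ 3 * y2 i)" for i
      by (simp add: y_def e1_def)
    ultimately show ?thesis by (simp add: G_def)
  qed
  have G0: "G (cvec p) = rops (\<lambda>i. p $ 2 * y1 i + p $ 3 * y2 i) u l h
      (cvec (p $ 1 *\<^sub>R e + p $ 2 *\<^sub>R x1 + p $ 3 *\<^sub>R (x2 + w)))" for p :: "real ^ 3"
    using G[of p 0] by simp
  have hyp3: "hypfun d G e1"
    unfolding hypfun_def homogfun_def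
  proof (intro conjI allI impI)
    have "polyfun (\<lambda>p :: complex ^ 3. p $ 2 * of_real (y1 i) + p $ 3 * of_real (y2 i))" for i
      by (intro polyfun_add polyfun_mult polyfun_const polyfun_coord)
    moreover have "polyfun (\<lambda>p. g p $ i)" for i
      unfolding g_def vector_add_component vector_smult_component cvec_nth
      by (intro polyfun_add polyfun_mult polyfun_const polyfun_coord)
    ultimately show "polyfun G"
      unfolding G_def y_def by (intro polyfun_ops_compose hypfunD(1)[OF hyp])
    fix c and p :: "complex ^ 3"
    have "y i (c *s p) = c * y i p" for i by (simp add: y_def algebra_simps)
    moreover have "g (c *s p) = c *s g p" by (simp add: g_def vec_eq_iff algebra_simps)
    ultimately show "G (c *s p) = c ^ d * G p"
      using ops_homogeneous[OF hypfunD(1)[OF hyp], of c 0 d "\<lambda>i. y i p" u l "g p"]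
        homogfun_smult[OF hypfunD(2)[OF hyp]]
      by (simp add: G_def)
  next
    have "e1 $ 1 = 1" "e1 $ 2 = 0" "e1 $ 3 = 0" by (simp_all add: e1_def)
    then show "G (cvec e1) \<noteq> 0" using hypfunD(3)[OF hyp] by (simp add: G0)
  next
    fix p :: "real ^ 3" and t assume t: "Im t > 0"
    let ?c = "\<lambda>i. p $ 2 * y1 i + p $ 3 * y2 i"
    let ?X = "p $ 1 *\<^sub>R e + p $ 2 *\<^sub>R x1 + p $ 3 *\<^sub>R (x2 + w)"
    have "stable (rops ?c u l h)" by (intro stable_rops stable_h u)
    moreover have "cvec ?X + t *s cvec e = cvec (?X + Re t *\<^sub>R e) + \<i> *s cvec (Im t *\<^sub>R e)"
      by (simp add: vec_eq_iff complex_eq_iff)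
    moreover have "Im t *\<^sub>R e \<in> K" using t by (intro hcone_scaleR[OF hyp] hcone_self[OF hyp])
    ultimately show "G (cvec p + t *s cvec e1) \<noteq> 0" unfolding G by (simp add: stable_def)
  qed
  \<comment> \<open>The last two unit vectors correspond to \<open>(x1, y1)\<close> and
    \<open>(x2 + w, y2)\<close>; being above the zeros puts them into the cone of
    \<open>G\<close>.\<close>
  have cone: "v \<in> hcone G e1"
    if "v = vector [0, 1, 0] \<or> v = vector [0, 0, 1]" for v
    unfolding hcone_def
  proof (intro CollectI allI impI)
    fix s :: real assume s: "0 \<le> s"
    have "x1 + s *\<^sub>R e \<in> above (rops y1 u l h)" "x2 + w + s *\<^sub>R e \<in> above (rops y2 u l h)"
      by (intro above_add x1 x2w Kc_scaleR e_in_Kc s)+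
    from this[THEN above_pos] show "G (cvec (v + s *\<^sub>R e1)) \<noteq> 0"
      using that unfolding G0 by (auto simp: e1_def add_ac)
  qed
  have "vector [0, 1, 0] + vector [0, 0, 1] \<in> hcone G e1"
    by (intro hcone_add[OF hyp3] cone) auto
  moreover have "Re (G (cvec e1)) > 0"
  proof -
    have "e1 $ 1 = 1" "e1 $ 2 = 0" "e1 $ 3 = 0" by (simp_all add: e1_def)
    then show ?thesis using pos by (simp add: G0)
  qed
  ultimately have "Re (G (cvec (vector [0, 1, 0] + vector [0, 0, 1]))) > 0"
    using hcone_pos[OF hyp3] by blast
  then show "Re (rops (\<lambda>i. y1 i + y2 i) u l h (cvec (x1 + x2 + w))) > 0"
    by (simp add: G0 add.assoc)
qed

lemma above_rops_scaleR:
  assumes x: "x \<in> above (rops y u l h)" and c: "c > 0"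
  shows "c *\<^sub>R x \<in> above (rops (\<lambda>i. c * y i) u l h)"
  unfolding above_def
proof (intro CollectI ballI)
  fix w assume w: "w \<in> Kc"
  have "(1 / c) *\<^sub>R w \<in> Kc" using c w by (intro Kc_scaleR) auto
  from above_pos[OF above_add[OF x this]]
  have "Re (of_real (c ^ d) * rops y u l h (cvec (x + (1 / c) *\<^sub>R w))) > 0"
    using c by (simp del: of_real_power)
  moreover have "cvec (c *\<^sub>R x + w) = of_real c *s cvec (x + (1 / c) *\<^sub>R w)"
    using c by (simp add: vec_eq_iff algebra_simps)
  ultimately show "Re (rops (\<lambda>i. c * y i) u l h (cvec (c *\<^sub>R x + w))) > 0"
    using ops_homogeneous[OF hypfunD(1)[OF hyp], of "of_real c" 0 d "\<lambda>i. of_real (y i)" u l]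
      homogfun_smult[OF hypfunD(2)[OF hyp]]
    by simp
qed

lemma above_rops_sum:
  assumes u: "\<And>i. i \<in> set l \<Longrightarrow> u i \<in> Kc" and I: "finite I" "I \<noteq> {}"
    and x: "\<And>k. k \<in> I \<Longrightarrow> x k \<in> above (rops (y k) u l h)"
  shows "(\<Sum>k\<in>I. x k) \<in> above (rops (\<lambda>i. \<Sum>k\<in>I. y k i) u l h)"
  using I x
proof (induction I rule: finite_ne_induct)
  case (insert k I)
  have "x k + (\<Sum>k\<in>I. x k) \<in> above (rops (\<lambda>i. y k i + (\<Sum>k\<in>I. y k i)) u l h)"
    by (rule above_rops_add[OF u]) (use insert in auto)
  then show ?case using insert.hyps by simp
qed simp

text \<open>Since \<open>ldv\<close> is linear in the direction, \<open>ldv u F x\<close> is the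
  average of the values \<open>ldv v F x\<close>. It is below 1, so one of them is.\<close>

lemma above_select:
  assumes F: "stable F" and S: "finite S" "S \<subseteq> Kc" and p: "\<And>v. v \<in> S \<Longrightarrow> p v \<ge> 0" "(\<Sum>v\<in>S. p v) = 1"
    and u: "u = (\<Sum>v\<in>S. p v *\<^sub>R v)" and x: "x \<in> above (\<lambda>z. F z - D u F z)"
  shows "\<exists>v\<in>S. x \<in> above (\<lambda>z. F z - D v F z)"
proof (rule ccontr)
  note poly = stable_polyfun[OF F]
  have uK: "u \<in> Kc"
    unfolding u using S(1) S(2) p(1) by (induction S) (auto simp: Kc_0 intro!: Kc_add Kc_scaleR)
  have xF: "x \<in> above F" using x above_diff_D_subset[OF poly uK] by auto
  assume "\<not> ?thesis"
  then have ge: "ldv v F x \<ge> 1" if "v \<in> S" for v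
    using above_diff_D[OF F xF, of v] that S(2) by force
  have "1 = (\<Sum>v\<in>S. p v * 1)" by (simp add: p(2))
  also have "\<dots> \<le> (\<Sum>v\<in>S. p v * ldv v F x)" by (intro sum_mono mult_left_mono ge p)
  also have "\<dots> = ldv u F x"
    unfolding u ldv_def by (simp add: D_vec_sum[OF poly] sum_divide_distrib)
  also have "\<dots> < 1" by (rule above_diff_D_less[OF F uK x])
  finally show False by simp
qed

text \<open>The tail is replaced first. As the factors commute, the one for the head can then be
  applied last, to the stable function \<open>?H\<close>, and \<open>above_select\<close> replaces
  it.\<close>

lemma above_select_list:
  assumes S: "\<And>i. i \<in> J \<Longrightarrow> finite (S i)" "\<And>i. i \<in> J \<Longrightarrow> S i \<subseteq> Kc"
    and p: "\<And>i v. i \<in> J \<Longrightarrow> v \<in> S i \<Longrightarrow> p i v \<ge> 0" "\<And>i. i \<in> J \<Longrightarrow> (\<Sum>v\<in>S i. p i v) = 1"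
    and u: "\<And>i. i \<in> J \<Longrightarrow> u i = (\<Sum>v\<in>S i. p i v *\<^sub>R v)"
  shows "stable F \<Longrightarrow> distinct l \<Longrightarrow> set l \<subseteq> J \<Longrightarrow> x \<in> above (rops (\<lambda>_. 1) u l F) \<Longrightarrow>
    \<exists>V. (\<forall>i\<in>set l. V i \<in> S i) \<and> x \<in> above (rops (\<lambda>_. 1) V l F)"
proof (induction l arbitrary: F)
  case (Cons i l)
  note poly = stable_polyfun[OF Cons.prems(1)]
  let ?G = "\<lambda>z. F z - D (u i) F z"
  have i: "i \<in> J" and l: "set l \<subseteq> J" using Cons.prems(3) by auto
  have "(\<Sum>v\<in>B. p i v *\<^sub>R v) \<in> Kc" if "finite B" "B \<subseteq> S i" for B
    using that S(2)[OF i] p(1)[OF i]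
    by (induction B) (auto simp: Kc_0 intro!: Kc_add Kc_scaleR)
  then have uK: "u i \<in> Kc" using S(1)[OF i] u[OF i] by simp
  have "stable ?G" by (rule stable_diff_D'[OF Cons.prems(1) uK])
  moreover have "x \<in> above (rops (\<lambda>_. 1) u l ?G)"
    using Cons.prems(4) rops_Cons[OF poly, of "\<lambda>_. 1" u i l] by simp
  ultimately obtain V where V: "\<And>j. j \<in> set l \<Longrightarrow> V j \<in> S j" "x \<in> above (rops (\<lambda>_. 1) V l ?G)"
    using Cons.IH[of ?G] Cons.prems(2) l by auto
  let ?H = "rops (\<lambda>_. 1) V l F"
  have H: "stable ?H"
    using V(1) l S(2) by (intro stable_rops Cons.prems(1)) blast
  have "x \<in> above (\<lambda>z. ?H z - D (u i) ?H z)"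
    using V(2) ops_diff[OF poly polyfun_D[OF poly], of "\<lambda>_. 1" V l 1 "u i"]
    by (simp add: D_rops[OF poly, of _ "\<lambda>_. 1", simplified])
  from above_select[OF H S(1)[OF i] S(2)[OF i] p(1)[OF i] p(2)[OF i] u[OF i] this]
  obtain v where v: "v \<in> S i" "x \<in> above (\<lambda>z. ?H z - D v ?H z)" by blast
  have "rops (\<lambda>_. 1) (V(i := v)) l F = ?H"
    using Cons.prems(2) by (intro ops_cong) auto
  then have "rops (\<lambda>_. 1) (V(i := v)) (i # l) F = (\<lambda>z. ?H z - D v ?H z)"
    using rops_Cons'[OF poly, of "\<lambda>_. 1" "V(i := v)" i l] by simp
  then have "x \<in> above (rops (\<lambda>_. 1) (V(i := v)) (i # l) F)" using v(2) by metis
  moreover have "\<forall>j\<in>set (i # l). (V(i := v)) j \<in> S j" using V(1) v(1) by simp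
  ultimately show ?case by blast
qed simp

lemma above_minus_list:
  assumes "stable F" "\<And>i. i \<in> set l \<Longrightarrow> V i \<in> Kc" "x \<in> above (rops (\<lambda>_. 1) V l F)"
  shows "x - (\<Sum>i\<leftarrow>l. V i) \<in> above F"
  using assms
proof (induction l arbitrary: F)
  case (Cons i l)
  let ?G = "\<lambda>z. F z - D (V i) F z"
  have i: "V i \<in> Kc" and l: "\<And>j. j \<in> set l \<Longrightarrow> V j \<in> Kc"
    using Cons.prems(2) by auto
  have "rops (\<lambda>_. 1) V (i # l) F = rops (\<lambda>_. 1) V l ?G"
    using rops_Cons[OF stable_polyfun[OF Cons.prems(1)], of "\<lambda>_. 1" V i l] by simp
  then have "x \<in> above (rops (\<lambda>_. 1) V l ?G)" using Cons.prems(3) by metis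
  from above_diff_D_minus[OF Cons.prems(1) i Cons.IH[OF stable_diff_D'[OF Cons.prems(1) i] l this]]
  have "x - (\<Sum>i\<leftarrow>l. V i) - V i \<in> above F" by simp
  then show ?case by (simp add: diff_diff_eq add.commute)
qed simp

end

subsection \<open>The bound for the mixed polynomial\<close>

text \<open>With \<open>\<sigma> = 1 / \<mu>\<close> the last two claims are the hypotheses
  \<open>small\<close> and \<open>bound\<close> of \<open>barrier_step\<close>. The alternative in
  \<open>U\<close> gives \<open>\<mu> + \<delta> / r > 1\<close>, hence the first of them. The other
  follows from the main inequality of \<open>U\<close>, because Bernoulli's inequality bounds the
  quotient of power differences from below by
  \<open>1 / (1 + \<delta> / ((r - 1) * \<mu>))\<close>.\<close>

lemma U_bounds:
  assumes r: "r > 0" and U: "(\<delta>, \<mu>) \<in> U r"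
  shows "\<delta> \<ge> 1" "\<mu> > 0" "(1 / \<mu>) / (1 + \<delta> * (1 / \<mu>) / real r) < 1"
    "r \<le> 1 \<or> (1 / \<mu>) / (1 + \<delta> * (1 / \<mu>) / real (r - 1)) \<le> 1 - 1 / \<delta>"
proof -
  define x where "x = \<delta> / (real r * \<mu>)"
  define A where "A = (1 + x) ^ r - x ^ r"
  define B where "B = (1 + x) ^ (r - 1) - x ^ (r - 1)"
  have \<delta>0: "\<delta> > 0" and \<mu>: "\<mu> > 0" and main: "\<delta> - 1 \<ge> \<delta> / \<mu> * (B / A)"
    and alt: "\<mu> > 1 \<or> \<mu> > 1 - \<delta> / real r"
    using U by (auto simp: U_def A_def B_def x_def)
  show "\<mu> > 0" by (rule \<mu>)
  have x: "x > 0" using \<delta>0 \<mu> r by (simp add: x_def)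
  have A: "A > 0" using x r by (simp add: A_def power_strict_mono)
  have B: "B \<ge> 0" using x by (simp add: B_def power_mono)
  have "\<delta> / \<mu> * (B / A) \<ge> 0" using \<delta>0 \<mu> A B by simp
  then show "\<delta> \<ge> 1" using main by linarith
  have "\<mu> + \<delta> / real r > 1"
    using alt \<delta>0 r by (smt (verit) divide_nonneg_nonneg of_nat_0_le_iff)
  moreover have "(1 / \<mu>) / (1 + \<delta> * (1 / \<mu>) / real r) = 1 / (\<mu> + \<delta> / real r)"
    using \<mu> r by (simp add: field_simps)
  ultimately show "(1 / \<mu>) / (1 + \<delta> * (1 / \<mu>) / real r) < 1" by simp
  show "r \<le> 1 \<or> (1 / \<mu>) / (1 + \<delta> * (1 / \<mu>) / real (r - 1)) \<le> 1 - 1 / \<delta>"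
  proof (cases "r \<le> 1")
    case False
    define k where "k = r - 1"
    have k: "real k > 0" and rk: "r = Suc k" using False by (auto simp: k_def)
    define p where "p = (1 + x) ^ k"
    define q where "q = x ^ k"
    have pq: "A = (1 + x) * p - x * q" "B = p - q"
      by (simp_all add: A_def B_def p_def q_def rk)
    \<comment> \<open>Multiplied by \<open>q * x\<close> this becomes \<open>bern\<close>, which is
      \<open>A \<le> y * B\<close> up to the factor \<open>k\<close>.\<close>
    have "1 + real k * (1 / x) \<le> (1 + 1 / x) ^ k"
      using x by (intro Bernoulli_inequality) (simp add: order.trans[of _ 0])
    then have "q * (1 + real k * (1 / x)) \<le> q * (1 + 1 / x) ^ k"
      using x by (intro mult_left_mono) (auto simp: q_def)
    also have "q * (1 + 1 / x) ^ k = p"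
      using x by (simp add: p_def q_def field_simps flip: power_mult_distrib)
    finally have bern: "q * (x + real k) \<le> p * x" using x by (simp add: field_simps)
    define y where "y = 1 + real r * x / real k"
    have y: "y > 0" using x k by (simp add: y_def add_pos_nonneg)
    have "real k * (y * B - A) = p * x - q * (x + real k)"
      using k by (simp add: y_def pq rk field_simps)
    then have "y * B - A \<ge> 0" using bern k by (metis diff_ge_0_iff_ge mult_le_cancel_left_pos mult_zero_right)
    then have "1 / y \<le> B / A" using A y by (simp add: field_simps)
    then have "\<delta> / \<mu> * (1 / y) \<le> \<delta> / \<mu> * (B / A)" using \<delta>0 \<mu> by (intro mult_left_mono) auto
    then have "\<delta> / \<mu> * (1 / y) \<le> \<delta> - 1" using main by linarith
    then have "(1 / \<mu>) / y \<le> 1 - 1 / \<delta>" using \<delta>0 by (simp add: field_simps)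
    moreover have "y = 1 + \<delta> * (1 / \<mu>) / real (r - 1)"
      using r \<mu> by (simp add: y_def x_def k_def)
    ultimately show ?thesis by simp
  qed simp
qed

lemma U_nonempty:
  assumes "r > 0"
  shows "U r \<noteq> {}"
proof -
  \<comment> \<open>The value of \<open>\<delta> / (r * \<mu>)\<close> at the witness
    \<open>(2, 2)\<close>, left unreduced to match the definition of \<open>U\<close>. There the
    inequality says that the quotient of power differences is at most 1.\<close>
  define x where "x = 2 / (real r * 2)"
  obtain k where r: "r = Suc k" using assms by (cases r) auto
  have x: "x > 0" using assms by (simp add: x_def)
  have "x * x ^ k \<le> x * (1 + x) ^ k" using x by (intro mult_left_mono power_mono) auto
  then have "x * x ^ k \<le> x ^ k + x * (1 + x) ^ k" using x by (intro add_increasing) auto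
  then have "(1 + x) ^ k - x ^ k \<le> (1 + x) ^ r - x ^ r" by (simp add: r algebra_simps)
  moreover have "(1 + x) ^ r - x ^ r > 0" using x assms by (simp add: power_strict_mono)
  ultimately have "((1 + x) ^ k - x ^ k) / ((1 + x) ^ r - x ^ r) \<le> 1" by simp
  moreover have "r - 1 = k" by (simp add: r)
  ultimately have "(2, 2) \<in> U r"
    unfolding U_def mem_Collect_eq prod.case x_def[symmetric] by simp
  then show ?thesis by blast
qed

context hyperbolic_cone
begin

lemma above_mono:
  assumes F: "stable F" and x: "x \<in> above F" and v: "v \<in> Kc"
  shows "Re (F (cvec x)) \<le> Re (F (cvec (x + v)))"
proof -
  note poly = stable_polyfun[OF F]
  have "poly (line F x v) 0 \<le> poly (line F x v) 1"
  proof (rule DERIV_nonneg_imp_nondecreasing[of 0 1 "poly (line F x v)"])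
    fix s :: real assume s: "0 \<le> s" "s \<le> 1"
    have "ldv v F (x + s *\<^sub>R v) \<ge> 0" by (intro ldv_nonneg F above_add x Kc_scaleR v s)
    then have "poly (pderiv (line F x v)) s \<ge> 0"
      using above_line_pos[OF F x v s(1)] ldv_line[OF poly, of v x s v]
      by (simp add: line_D poly zero_le_divide_iff)
    then show "\<exists>y. (poly (line F x v) has_real_derivative y) (at s) \<and> 0 \<le> y"
      using poly_DERIV by blast
  qed simp
  then show ?thesis by (simp add: poly_line poly)
qed

text \<open>By \<open>absorb\<close> every real line in direction \<open>e\<close> ends in
  \<open>K\<close>, so \<open>G\<close> has infinitely many zeros on it. A complex point
  \<open>a + \<i> b\<close> lies on the complexification of the real line through \<open>a\<close>
  in direction \<open>b\<close>.\<close>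

lemma polyfun_zero_if_zero_on_K:
  assumes G: "polyfun G" and zero: "\<And>x. x \<in> K \<Longrightarrow> G (cvec x) = 0"
    and absorb: "\<And>x. \<exists>T>0. T *\<^sub>R e - x \<in> K"
  shows "G z = 0"
proof -
  have real: "G (cvec x) = 0" for x
  proof -
    obtain T where T: "T > 0" "T *\<^sub>R e - (- x) \<in> K" using absorb by blast
    have "poly (line G x e) s = 0" if "s > T" for s
    proof -
      have "x + s *\<^sub>R e = (T *\<^sub>R e - (- x)) + (s - T) *\<^sub>R e" by (simp add: algebra_simps)
      then have "x + s *\<^sub>R e \<in> K"
        using hcone_add_direction[OF hyp T(2), of "s - T"] that by (metis diff_ge_0_iff_ge less_imp_le)
      then show ?thesis using zero by (simp add: poly_line G)
    qed
    then have "{T<..} \<subseteq> {s. poly (line G x e) s = 0}" by auto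
    then have "line G x e = 0"
      using poly_roots_finite infinite_Ioi finite_subset by blast
    then show ?thesis using poly_line[OF G, of x e 0] polyfun_real[OF G, of x] by simp
  qed
  define a where "a = (\<chi> i. Re (z $ i))"
  define b where "b = (\<chi> i. Im (z $ i))"
  have z: "z = cvec a + \<i> *s cvec b" by (simp add: a_def b_def vec_eq_iff complex_eq_iff)
  have "line G a b = 0" by (rule line_eqI[OF G]) (simp add: real)
  then show ?thesis using poly_cpoly_line[OF G, of a b \<i>] by (simp add: z)
qed

text \<open>The eigenvalues control the degree only on lines through \<open>T e\<close>. For
  \<open>x\<close> in \<open>K\<close> with \<open>T e - x\<close> in \<open>K\<close>, monotonicity
  gives \<open>h (x + s u) \<le> h (T e + s u)\<close>, so the degree at \<open>x\<close> is no
  larger.\<close>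

lemma D_power_zero:
  assumes u: "u \<in> Kc" and absorb: "\<And>x. \<exists>T>0. T *\<^sub>R e - x \<in> K"
    and deg: "\<And>T. T > 0 \<Longrightarrow> degree (line h (T *\<^sub>R e) u) \<le> r"
  shows "(D u ^^ Suc r) h = (\<lambda>z. 0)"
proof
  note poly = hypfunD(1)[OF hyp]
  fix z
  show "(D u ^^ Suc r) h z = 0"
  proof (rule polyfun_zero_if_zero_on_K[OF polyfun_D_power[OF poly] _ absorb])
    fix x assume x: "x \<in> K"
    obtain T where T: "T > 0" "T *\<^sub>R e - x \<in> K" using absorb by blast
    have "degree (line h x u) \<le> degree (line h (T *\<^sub>R e) u)"
    proof (rule degree_le_if_poly_le)
      fix s :: real assume s: "s \<ge> 0"
      have xs: "x + s *\<^sub>R u \<in> above h" by (intro above_add K_above_h x Kc_scaleR u s)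
      show "poly (line h x u) s \<ge> 0" using above_pos[OF xs] by (simp add: poly_line poly)
      have "Re (h (cvec (x + s *\<^sub>R u))) \<le> Re (h (cvec (x + s *\<^sub>R u + (T *\<^sub>R e - x))))"
        using T(2) K_subset_Kc by (intro above_mono stable_h xs) auto
      then show "poly (line h x u) s \<le> poly (line h (T *\<^sub>R e) u) s"
        by (simp add: poly_line poly add.commute)
    qed
    then have "degree (line h x u) < Suc r" using deg[OF T(1)] by linarith
    then have "(pderiv ^^ Suc r) (line h x u) = 0"
      by (intro poly_eqI) (simp add: coeff_higher_pderiv coeff_eq_0 del: funpow.simps)
    then have "line ((D u ^^ Suc r) h) x u = 0"
      unfolding line_D_power[OF poly] .
    then have "poly (cpoly (line ((D u ^^ Suc r) h) x u)) 0 = 0" by (simp only: map_poly_0 poly_0)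
    then show "(D u ^^ Suc r) h (cvec x) = 0"
      unfolding poly_cpoly_line[OF polyfun_D_power[OF poly]] by (simp del: funpow.simps)
  qed
qed

text \<open>For each \<open>i\<close> the barrier steps for all indices except \<open>i\<close> lead
  from \<open>t e\<close> to \<open>x i\<close>. There the barrier along \<open>u i\<close> is at
  most \<open>\<sigma> < 1 / \<mu>\<close>, so the operator for \<open>u i\<close> with coefficient
  \<mu> can be applied without a further shift. Convexity in the point and the coefficients combines
  these \<open>m\<close> statements.\<close>

lemma mixed_bound:
  fixes u :: "nat \<Rightarrow> real ^ 'n"
  assumes m: "m > 0" and r: "r > 0" and U: "(\<delta>, \<mu>) \<in> U r"
    and u: "\<And>i. i \<in> {1..m} \<Longrightarrow> u i \<in> Kc" and sum: "(\<Sum>i=1..m. u i) = e"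
    and rank: "\<And>i. i \<in> {1..m} \<Longrightarrow> (D (u i) ^^ Suc r) h = (\<lambda>z. 0)"
    and t: "t > 0" "\<sigma> > 0" "\<sigma> < 1 / \<mu>" and \<sigma>: "\<And>i. i \<in> {1..m} \<Longrightarrow> ldv (u i) h (t *\<^sub>R e) \<le> \<sigma>"
  defines "T \<equiv> (t + (1 - 1 / real m) * \<delta>) / (1 - 1 / real m + \<mu> / real m)"
  shows "T *\<^sub>R e \<in> above (rops (\<lambda>_. 1) u [1..<Suc m] h)"
proof -
  note bounds = U_bounds[OF r U]
  note poly = hypfunD(1)[OF hyp]
  define l where "l = [1..<Suc m]"
  have l: "set l = {1..m}" "distinct l" by (auto simp: l_def)
  \<comment> \<open>\<open>U_bounds\<close> speaks about \<open>1 / \<mu>\<close>; both bounds carry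
    over to the smaller \<sigma> because the expression is increasing in it.\<close>
  have mono: "\<sigma> / (1 + \<delta> * \<sigma> / k) \<le> (1 / \<mu>) / (1 + \<delta> * (1 / \<mu>) / k)" if "k > 0" for k :: real
  proof -
    have eq: "\<sigma> / (1 + \<delta> * \<sigma> / k) = 1 / (1 / \<sigma> + \<delta> / k)" if "\<sigma> > 0" for \<sigma>
      using that \<open>k > 0\<close> bounds(1) by (simp add: field_simps)
    have "1 / (1 / \<sigma> + \<delta> / k) \<le> 1 / (\<mu> + \<delta> / k)"
    proof (rule divide_left_mono)
      show "\<mu> + \<delta> / k \<le> 1 / \<sigma> + \<delta> / k" using t(2,3) bounds(2) by (simp add: field_simps)
      have "\<mu> + \<delta> / k > 0" using bounds that by (simp add: add_pos_nonneg)
      moreover have "1 / \<sigma> + \<delta> / k > 0" using bounds that t by (simp add: add_pos_nonneg)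
      ultimately show "0 < (1 / \<sigma> + \<delta> / k) * (\<mu> + \<delta> / k)" by simp
    qed simp
    then show ?thesis
      unfolding eq[OF t(2)] eq[OF divide_pos_pos[OF zero_less_one bounds(2)]] by simp
  qed
  have te: "t *\<^sub>R e \<in> above h"
    by (intro K_above_h hcone_scaleR[OF hyp] hcone_self[OF hyp] t)
  define x where "x i = t *\<^sub>R e + \<delta> *\<^sub>R (e - u i)" for i
  \<comment> \<open>Coefficient \<mu> for the index left out, 1 for the others; summed over
    \<open>i\<close>, every index receives \<open>m - 1 + \<mu>\<close>.\<close>
  define y where "y i = (\<lambda>j. if j = i then \<mu> else 1)" for i :: nat
  have above: "x i \<in> above (rops (y i) u l h)" if i: "i \<in> {1..m}" for i
  proof -
    let ?l = "remove1 i l"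
    let ?F = "rops (\<lambda>_. 1) u ?l h"
    have set: "set ?l = {1..m} - {i}" using l by (simp add: set_remove1_eq)
    have "(\<Sum>j\<leftarrow>?l. u j) = (\<Sum>j\<in>{1..m} - {i}. u j)"
      using l by (simp add: sum_list_distinct_conv_sum_set distinct_remove1 set del: set_remove1_eq)
    also have "\<dots> = e - u i" using sum i by (simp add: sum_diff1)
    finally have lsum: "(\<Sum>j\<leftarrow>?l. u j) = e - u i" .
    have "t *\<^sub>R e + \<delta> *\<^sub>R (\<Sum>j\<leftarrow>?l. u j) \<in> above ?F \<and>
      (\<forall>j\<in>{1..m}. ldv (u j) ?F (t *\<^sub>R e + \<delta> *\<^sub>R (\<Sum>j\<leftarrow>?l. u j)) \<le> \<sigma>)"
    proof (rule barrier_list[OF stable_h te _ u rank \<sigma>])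
      show "set ?l \<subseteq> {1..m}" using set by auto
      show "1 \<le> r" using r by simp
      show "0 < \<sigma>" "1 \<le> \<delta>" by (fact t(2) bounds(1))+
      show "\<sigma> / (1 + \<delta> * \<sigma> / real r) < 1" using mono[of "real r"] r bounds(3) by simp
      show "r \<le> 1 \<or> \<sigma> / (1 + \<delta> * \<sigma> / real (r - 1)) \<le> 1 - 1 / \<delta>"
        using mono[of "real (r - 1)"] bounds(4) by (cases "r \<le> 1") auto
    qed
    then have xi: "x i \<in> above ?F" "ldv (u i) ?F (x i) \<le> \<sigma>"
      using i unfolding lsum x_def by auto
    have F: "stable ?F" using u set by (intro stable_rops stable_h) auto
    have eq: "D (\<mu> *\<^sub>R u i) ?F = (\<lambda>z. of_real \<mu> * D (u i) ?F z)"
      by (intro ext D_vec_scaleR polyfun_rops poly)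
    have "ldv (\<mu> *\<^sub>R u i) ?F (x i) = \<mu> * ldv (u i) ?F (x i)"
      unfolding ldv_def eq by simp
    also have "\<dots> \<le> \<mu> * \<sigma>" using xi(2) bounds(2) by simp
    also have "\<dots> < 1" using t(3) bounds(2) by (simp add: field_simps)
    finally have "x i \<in> above (\<lambda>z. ?F z - D (\<mu> *\<^sub>R u i) ?F z)"
      using bounds(2) by (intro above_diff_D[OF F xi(1)] Kc_scaleR u i) auto
    moreover have "rops (y i) u ?l h = ?F"
      using set by (intro ops_cong) (auto simp: y_def)
    then have "rops (y i) u l h = (\<lambda>z. ?F z - D (\<mu> *\<^sub>R u i) ?F z)"
      using rops_remove1[OF poly, of i l "y i" u] i l unfolding eq by (simp add: y_def)
    ultimately show ?thesis by simp
  qed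
  have "(\<Sum>i=1..m. x i) \<in> above (rops (\<lambda>j. \<Sum>i=1..m. y i j) u l h)"
    using m l u above by (intro above_rops_sum) auto
  moreover have "(\<Sum>i=1..m. x i) = (real m * t + (real m - 1) * \<delta>) *\<^sub>R e"
  proof -
    have "(\<Sum>i=1..m. e - u i) = real m *\<^sub>R e - e"
      unfolding sum_subtractf sum by (simp add: sum_constant_scaleR del: sum_constant)
    then have "(\<Sum>i=1..m. x i) = real m *\<^sub>R (t *\<^sub>R e) + \<delta> *\<^sub>R (real m *\<^sub>R e - e)"
      unfolding x_def sum.distrib scaleR_sum_right[symmetric]
      by (simp add: sum_constant_scaleR del: sum_constant)
    then show ?thesis by (simp add: algebra_simps)
  qed
  moreover have "rops (\<lambda>j. \<Sum>i=1..m. y i j) u l h = rops (\<lambda>j. real m - 1 + \<mu>) u l h"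
  proof (rule ops_cong)
    fix j assume j: "j \<in> set l"
    have "(\<Sum>i=1..m. y i j) = (\<Sum>i=1..m. 1 + (if i = j then \<mu> - 1 else 0))"
      by (rule sum.cong) (auto simp: y_def)
    then show "complex_of_real (\<Sum>i=1..m. y i j) = of_real (real m - 1 + \<mu>) \<and> u j = u j"
      using j l by (simp add: sum.distrib)
  qed
  ultimately have S: "(real m * t + (real m - 1) * \<delta>) *\<^sub>R e \<in> above (rops (\<lambda>j. real m - 1 + \<mu>) u l h)"
    by simp
  define c where "c = real m - 1 + \<mu>"
  have c: "c > 0" using m bounds(2) by (simp add: c_def add_nonneg_pos)
  have "(1 / c) *\<^sub>R (real m * t + (real m - 1) * \<delta>) *\<^sub>R e \<in> above (rops (\<lambda>j. 1 / c * c) u l h)"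
    using c by (intro above_rops_scaleR S[folded c_def]) simp
  moreover have "T = (1 / c) * (real m * t + (real m - 1) * \<delta>)"
  proof -
    have "1 - 1 / real m + \<mu> / real m = c / real m" "t + (1 - 1 / real m) * \<delta> = (real m * t + (real m - 1) * \<delta>) / real m"
      using m by (simp_all add: c_def field_simps)
    then show ?thesis using m by (simp add: T_def)
  qed
  ultimately show ?thesis using c by (simp add: l_def)
qed

end

subsection \<open>Eigenvalues\<close>

lemma homogeneous_evalp:
  assumes "homogeneous d g"
  shows "homogfun d (evalp g)"
  unfolding homogfun_def
proof (intro conjI allI polyfun_evalp)
  fix c and z :: "complex ^ 'a"
  have "(\<Prod>i\<in>UNIV. (c * z $ i) ^ Poly_Mapping.lookup k i) = c ^ d * (\<Prod>i\<in>UNIV. (z $ i) ^ Poly_Mapping.lookup k i)"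
    if "k \<in> Poly_Mapping.keys g" for k
    using assms that by (simp add: homogeneous_def power_mult_distrib prod.distrib flip: power_sum)
  then show "evalp g (c *s z) = c ^ d * evalp g z"
    unfolding evalp_def sum_distrib_left by (intro sum.cong) (simp_all add: mult_ac)
qed

lemma hypfun_evalp:
  assumes g: "hyperbolic d g e" and \<sigma>: "\<sigma> \<noteq> 0"
  shows "hypfun d (\<lambda>z. of_real \<sigma> * evalp g z) e"
  unfolding hypfun_def
proof (intro conjI allI impI)
  have hom: "homogfun d (evalp g :: complex ^ 'a \<Rightarrow> complex)"
    using g by (intro homogeneous_evalp) (simp add: hyperbolic_def)
  then show "homogfun d (\<lambda>z. of_real \<sigma> * evalp g z)"
    by (auto simp: homogfun_def intro: polyfun_cmult)
  show "of_real \<sigma> * evalp g (cvec e) \<noteq> (0 :: complex)"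
    using g \<sigma> by (simp add: evalp_cvec hyperbolic_def)
  fix x :: "real ^ 'a" and t :: complex assume t: "Im t > 0"
  have "cvec x + t *s cvec e = (\<chi> i. t * of_real (e $ i) - of_real ((- x) $ i))"
    by (simp add: vec_eq_iff)
  moreover have "t \<notin> \<real>" using t by (auto simp: complex_is_Real_iff)
  ultimately show "of_real \<sigma> * evalp g (cvec x + t *s cvec e) \<noteq> 0"
    using g \<sigma> by (simp add: hyperbolic_def del: vector_uminus_component) metis
qed

lemma evalp_scaleR:
  assumes "homogeneous d g"
  shows "evalp g (c *\<^sub>R (x :: real ^ 'n)) = c ^ d * evalp g x"
proof -
  have "complex_of_real (evalp g (c *\<^sub>R x)) = of_real (c ^ d * evalp g x)"
    using homogfun_smult[OF homogeneous_evalp[OF assms], of "of_real c" "cvec x"]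
    by (simp add: evalp_cvec flip: cvec_scaleR)
  then show ?thesis by (simp only: of_real_eq_iff)
qed

lemma prod_mset_cmult:
  "(\<Prod>l\<in>#L. c * f l) = c ^ size L * (\<Prod>l\<in>#L. f l :: 'a::comm_monoid_mult)"
  by (induction L) (simp_all add: ac_simps)

lemma evalp_eigenvalues:
  assumes g: "hyperbolic d g e"
  shows "evalp g (a *\<^sub>R e + b *\<^sub>R x) = evalp g e * (\<Prod>l\<in>#eigenvalues g e x. a + b * l)"
proof -
  have hom: "homogeneous d g" using g by (simp add: hyperbolic_def)
  note size = eigenvalues(2)[OF g, of x]
  show ?thesis
  proof (cases "b = 0")
    case True
    then show ?thesis using size by (simp add: evalp_scaleR[OF hom])
  next
    case False
    have "a *\<^sub>R e + b *\<^sub>R x = (- b) *\<^sub>R ((- a / b) *\<^sub>R e - x)"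
      using False by (simp add: algebra_simps)
    then have "evalp g (a *\<^sub>R e + b *\<^sub>R x) = (- b) ^ d * evalp g ((- a / b) *\<^sub>R e - x)"
      using evalp_scaleR[OF hom] by metis
    also have "\<dots> = evalp g e * (\<Prod>l\<in>#eigenvalues g e x. (- b) * (- a / b - l))"
      unfolding eigenvalues(1)[OF g] prod_mset_cmult size by simp
    also have "(\<Prod>l\<in>#eigenvalues g e x. (- b) * (- a / b - l)) = (\<Prod>l\<in>#eigenvalues g e x. a + b * l)"
      using False by (intro arg_cong[of _ _ prod_mset] image_mset_cong) (simp add: field_simps)
    finally show ?thesis .
  qed
qed

lemma poly_prod_mset_pCons:
  "poly (\<Prod>l\<in>#L. [:t, l:]) s = (\<Prod>l\<in>#L. t + s * l :: 'a::comm_ring_1)"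
  by (induction L) (simp_all add: algebra_simps)

lemma poly_pderiv_prod_mset_pCons_0:
  fixes t :: "'a::field"
  assumes "t \<noteq> 0"
  shows "poly (pderiv (\<Prod>l\<in>#L. [:t, l:])) 0 = poly (\<Prod>l\<in>#L. [:t, l:]) 0 * (sum_mset L / t)"
  using assms
  by (induction L) (simp_all add: pderiv_mult pderiv_pCons field_simps del: mult_pCons_left)

text \<open>Zero eigenvalues contribute constant factors, so only the nonzero ones raise the degree.
  This is how \<open>rk\<close> enters.\<close>

lemma degree_prod_mset_pCons_le:
  "degree (\<Prod>l\<in>#L. [:t, l:]) \<le> size {#l \<in># L. (l :: 'a::comm_ring_1) \<noteq> 0#}"
proof (induction L)
  case (add l L)
  have "degree ([:t, l:] * (\<Prod>l\<in>#L. [:t, l:])) \<le> degree [:t, l:] + degree (\<Prod>l\<in>#L. [:t, l:])"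
    by (rule degree_mult_le)
  then show ?case using add by (auto simp del: mult_pCons_left)
qed simp

subsection \<open>Random vectors\<close>

lemma evalp_eq_0_iff_eigenvalue:
  assumes g: "hyperbolic d g e"
  shows "evalp g (t *\<^sub>R e - x) = 0 \<longleftrightarrow> t \<in># eigenvalues g e x"
  using g by (auto simp: eigenvalues(1)[OF g] hyperbolic_def prod_mset_zero_iff)

lemma eigenvalues_nonempty:
  assumes "hyperbolic d g e" "d > 0"
  shows "set_mset (eigenvalues g e x) \<noteq> {}"
  using eigenvalues(2)[OF assms(1), of x] assms(2) by auto

lemma lambda_max_le_iff:
  assumes g: "hyperbolic d g e" "d > 0"
  shows "lambda_max g e x \<le> c \<longleftrightarrow> (\<forall>s>c. evalp g (s *\<^sub>R e - x) \<noteq> 0)"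
  unfolding lambda_max_def using eigenvalues_nonempty[OF g, of x]
  by (auto simp: evalp_eq_0_iff_eigenvalue[OF g(1)] not_less)

text \<open>The complement is the projection of the part \<open>s > c\<close> of a closed zero set.
  Covering the half-line by countably many compact intervals makes each projection closed.\<close>

lemma lambda_max_le_borel:
  assumes g: "hyperbolic d g e" "d > 0"
  shows "{x. lambda_max g e x \<le> c} \<in> sets borel"
proof -
  define Z where "Z = {(s, x :: real ^ 'a). evalp g (s *\<^sub>R e - x) = 0}"
  have "continuous_on UNIV (\<lambda>z. evalp g (fst z *\<^sub>R e - snd z))"
    unfolding evalp_def by (intro continuous_intros)
  then have "closed ((\<lambda>z. evalp g (fst z *\<^sub>R e - snd z)) -` {0})"
    by (intro closed_vimage) auto
  also have "(\<lambda>z. evalp g (fst z *\<^sub>R e - snd z)) -` {0} = Z" by (auto simp: Z_def)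
  finally have Z: "closed Z" .
  have bounds: "\<exists>n::nat. c + 1 / real (Suc n) \<le> s \<and> s \<le> c + real (Suc n)" if "s > c" for s
  proof -
    obtain n where n: "real n > max (1 / (s - c)) (s - c)" using reals_Archimedean2 by blast
    then have "1 / (s - c) \<le> real (Suc n)" "s - c \<le> real (Suc n)" by auto
    then have "c + 1 / real (Suc n) \<le> s" "s \<le> c + real (Suc n)"
      using that by (auto simp: field_simps)
    then show ?thesis by blast
  qed
  have "{x. \<not> lambda_max g e x \<le> c} =
      (\<Union>n. {x. \<exists>s. s \<in> {c + 1 / real (Suc n)..c + real (Suc n)} \<and> (s, x) \<in> Z})" (is "_ = ?R")
  proof (intro set_eqI iffI)
    fix x assume "x \<in> {x. \<not> lambda_max g e x \<le> c}"
    then obtain s where s: "s > c" "evalp g (s *\<^sub>R e - x) = 0"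
      by (auto simp: lambda_max_le_iff[OF g])
    then show "x \<in> ?R" using bounds[OF s(1)] by (auto simp: Z_def)
  next
    fix x assume "x \<in> ?R"
    then obtain n s where s: "c + 1 / real (Suc n) \<le> s" "evalp g (s *\<^sub>R e - x) = 0"
      by (auto simp: Z_def)
    moreover have "1 / real (Suc n) > 0" by simp
    ultimately have "s > c" by linarith
    then show "x \<in> {x. \<not> lambda_max g e x \<le> c}" using s(2) by (auto simp: lambda_max_le_iff[OF g])
  qed
  also have "\<dots> \<in> sets borel"
    by (intro sets.countable_UN image_subsetI borel_closed closed_compact_projection Z compact_Icc)
  finally have "UNIV - {x. \<not> lambda_max g e x \<le> c} \<in> sets borel"
    by (intro sets.Diff) auto
  moreover have "UNIV - {x. \<not> lambda_max g e x \<le> c} = {x. lambda_max g e x \<le> c}" by auto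
  ultimately show ?thesis by simp
qed

lemma (in prob_space) integral_finite_support:
  fixes X :: "'a \<Rightarrow> 'b::{second_countable_topology, t1_space}"
    and f :: "'b \<Rightarrow> 'c::{banach, second_countable_topology}"
  assumes X: "random_variable borel X" and S: "finite S" "AE \<omega> in M. X \<omega> \<in> S"
    and f: "f \<in> borel_measurable borel"
  shows "(\<integral>\<omega>. f (X \<omega>) \<partial>M) = (\<Sum>v\<in>S. prob (X -` {v} \<inter> space M) *\<^sub>R f v)"
proof -
  have meas: "X -` {v} \<inter> space M \<in> sets M" for v
    using X by (rule measurable_sets) simp
  have "(\<integral>\<omega>. f (X \<omega>) \<partial>M) = (\<integral>\<omega>. (\<Sum>v\<in>S. indicator (X -` {v} \<inter> space M) \<omega> *\<^sub>R f v) \<partial>M)"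
  proof (rule integral_cong_AE)
    show "AE \<omega> in M. f (X \<omega>) = (\<Sum>v\<in>S. indicator (X -` {v} \<inter> space M) \<omega> *\<^sub>R f v)"
      using S(2) AE_space
    proof eventually_elim
      case (elim \<omega>)
      have "(\<Sum>v\<in>S. indicator (X -` {v} \<inter> space M) \<omega> *\<^sub>R f v) = (\<Sum>v\<in>S. if v = X \<omega> then f v else 0)"
        using elim by (intro sum.cong) (auto simp: indicator_def)
      then show ?case using S(1) elim by simp
    qed
  qed (use X f meas in \<open>auto intro!: borel_measurable_sum borel_measurable_scaleR\<close>)
  also have "\<dots> = (\<Sum>v\<in>S. (\<integral>\<omega>. indicator (X -` {v} \<inter> space M) \<omega> *\<^sub>R f v \<partial>M))"
    using meas by (intro Bochner_Integration.integral_sum integrable_scaleR_left) (auto simp: emeasure_eq_measure)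
  also have "\<dots> = (\<Sum>v\<in>S. prob (X -` {v} \<inter> space M) *\<^sub>R f v)"
    using meas by (intro sum.cong refl) (simp add: emeasure_eq_measure)
  finally show ?thesis .
qed

theorem theorem6p1:
  fixes M :: "'a measure" and X :: "nat \<Rightarrow> 'a \<Rightarrow> real ^ 'n::finite"
    and h :: "'n rpoly" and e :: "real ^ 'n" and d m r :: nat and \<epsilon> :: real
  assumes "hyperbolic d h e" and "d > 0"
    and "r > 0" and "m > 0" and "\<epsilon> > 0"
    and "prob_space M"
    and "prob_space.indep_vars M (\<lambda>_. borel) X {1..m}"
    and "\<And>i. i \<in> {1..m} \<Longrightarrow> AE \<omega> in M. X i \<omega> \<in> Lambda_plus h e"
    and "\<And>i. i \<in> {1..m} \<Longrightarrow> \<exists>S. finite S \<and> (AE \<omega> in M. X i \<omega> \<in> S)"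
    and "(\<Sum>i=1..m. integral\<^sup>L M (X i)) = e"
    and "\<And>i. i \<in> {1..m} \<Longrightarrow> tr h e (integral\<^sup>L M (X i)) \<le> \<epsilon>"
    and "\<And>i. i \<in> {1..m} \<Longrightarrow> rk h e (integral\<^sup>L M (X i)) \<le> r"
  shows "measure M {\<omega> \<in> space M. lambda_max h e (\<Sum>i=1..m. X i \<omega>) \<le> delta \<epsilon> m r} > 0"
proof -
  note g = assms(1)
  interpret prob_space M by (rule assms(6))

  \<comment> \<open>Normalisation of the polynomial and its cone\<close>
  define \<sigma> where "\<sigma> = sgn (evalp h e)"
  define c where "c = \<sigma> * evalp h e"
  have \<sigma>: "\<sigma> \<noteq> 0" and c: "c > 0"
    using g by (auto simp: \<sigma>_def c_def hyperbolic_def sgn_if)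
  \<comment> \<open>\<open>evalp h e\<close> may be negative; the sign \<sigma> makes
    \<open>H\<close> positive at \<open>e\<close> and changes no zeros.\<close>
  define H :: "complex ^ 'n \<Rightarrow> complex" where "H z = of_real \<sigma> * evalp h z" for z
  have H_real: "Re (H (cvec x)) = \<sigma> * evalp h x" for x
    by (simp add: H_def evalp_cvec)
  interpret hyperbolic_cone H d e
  proof
    show "hypfun d H e" unfolding H_def by (rule hypfun_evalp[OF g \<sigma>])
    show "Re (H (cvec e)) > 0" using c by (simp add: H_real c_def)
  qed
  note polyH = hypfunD(1)[OF hyp]
  have H_eig: "Re (H (cvec (a *\<^sub>R e + b *\<^sub>R x))) = c * (\<Prod>l\<in>#eigenvalues h e x. a + b * l)" for a b x
    by (simp add: H_real evalp_eigenvalues[OF g] c_def)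
  have in_K: "a *\<^sub>R e + b *\<^sub>R x \<in> K"
    if "\<And>l. l \<in># eigenvalues h e x \<Longrightarrow> a + b * l > 0" for a b x
    unfolding hcone_def
  proof (intro CollectI allI impI)
    fix s :: real assume s: "0 \<le> s"
    have "a + s + b * l \<noteq> 0" if "l \<in># eigenvalues h e x" for l
      using \<open>\<And>l. l \<in># eigenvalues h e x \<Longrightarrow> a + b * l > 0\<close>[OF that] s by linarith
    then have "(\<Prod>l\<in>#eigenvalues h e x. a + s + b * l) \<noteq> 0" by (auto simp: prod_mset_zero_iff)
    then have "Re (H (cvec ((a + s) *\<^sub>R e + b *\<^sub>R x))) \<noteq> 0" unfolding H_eig using c by simp
    then show "H (cvec (a *\<^sub>R e + b *\<^sub>R x + s *\<^sub>R e)) \<noteq> 0" by (auto simp: algebra_simps)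
  qed
  have Lambda: "x \<in> Kc" if "x \<in> Lambda_plus h e" for x
  proof -
    have "l \<ge> 0" if "l \<in># eigenvalues h e x" for l
      using \<open>x \<in> Lambda_plus h e\<close> Min_le[OF finite_set_mset that]
      by (simp add: Lambda_plus_def lambda_min_def)
    then have "\<eta> *\<^sub>R e + 1 *\<^sub>R x \<in> K" if "\<eta> > 0" for \<eta>
      using that by (intro in_K) (simp add: add_pos_nonneg)
    then show ?thesis by (simp add: Kc_def add.commute)
  qed
  have absorb: "\<exists>T>0. T *\<^sub>R e - x \<in> K" for x
  proof -
    \<comment> \<open>Exceeds every eigenvalue of \<open>x\<close>; including 0 in the maximum also
      makes \<open>T\<close> positive.\<close>
    define T where "T = Max (insert 0 (set_mset (eigenvalues h e x))) + 1"
    have T: "l < T" if "l \<in> insert 0 (set_mset (eigenvalues h e x))" for l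
      using Max_ge[OF _ that] unfolding T_def by simp
    have "T *\<^sub>R e + (- 1) *\<^sub>R x \<in> K" using T by (intro in_K) auto
    then show ?thesis using T[of 0] by auto
  qed
  \<comment> \<open>On this line the degree is bounded by the number of nonzero eigenvalues, and for
    \<open>t > 0\<close> the logarithmic derivative at 0 is \<open>tr h e u / t\<close>. Rank and
    trace enter through these two facts.\<close>
  have lineH: "line H (t *\<^sub>R e) u = smult c (\<Prod>l\<in>#eigenvalues h e u. [:t, l:])" for t u
    by (rule line_eqI[OF polyH]) (simp add: H_eig poly_prod_mset_pCons)
  have ldvH: "ldv u H (t *\<^sub>R e) = tr h e u / t" if t: "t > 0" for t u
  proof -
    have "poly (\<Prod>l\<in>#eigenvalues h e u. [:t, l:]) 0 \<noteq> 0"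
      using t by (auto simp: poly_prod_mset_pCons prod_mset_zero_iff)
    then show ?thesis
      using ldv_line[OF polyH, of u "t *\<^sub>R e" 0 u] c t
      by (simp add: line_D[OF polyH] lineH pderiv_smult poly_pderiv_prod_mset_pCons_0 tr_def)
  qed

  \<comment> \<open>Distributions and expectations of the random vectors\<close>
  define u where "u i = integral\<^sup>L M (X i)" for i
  define p where "p i v = prob (X i -` {v} \<inter> space M)" for i v
  have X: "random_variable borel (X i)" if "i \<in> {1..m}" for i
    using assms(7) that by (auto simp: indep_vars_def)
  obtain S0 where S0: "\<And>i. i \<in> {1..m} \<Longrightarrow> finite (S0 i)"
    "\<And>i. i \<in> {1..m} \<Longrightarrow> AE \<omega> in M. X i \<omega> \<in> S0 i"
    using assms(9) by metis
  \<comment> \<open>Dropping the values of probability 0 leaves only points of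
    \<open>Lambda_plus\<close> and makes the product of probabilities at the end positive.\<close>
  define S where "S i = {v \<in> S0 i. p i v > 0}" for i
  have fin: "finite (S i)" if "i \<in> {1..m}" for i using S0(1)[OF that] by (simp add: S_def)
  have SK: "S i \<subseteq> Kc" if i: "i \<in> {1..m}" for i
  proof
    fix v assume v: "v \<in> S i"
    have "v \<in> Lambda_plus h e"
    proof (rule ccontr)
      assume "v \<notin> Lambda_plus h e"
      then have "\<omega> \<notin> X i -` {v} \<inter> space M" if "X i \<omega> \<in> Lambda_plus h e" for \<omega>
        using that by auto
      then have "AE \<omega> in M. \<omega> \<notin> X i -` {v} \<inter> space M"
        by (rule eventually_mono[OF assms(8)[OF i]])
      then have "p i v = 0"
        using measurable_sets[OF X[OF i], of "{v}"] by (simp add: p_def prob_eq_0)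
      then show False using v by (simp add: S_def)
    qed
    then show "v \<in> Kc" by (rule Lambda)
  qed
  have restrict: "(\<Sum>v\<in>S0 i. p i v *\<^sub>R f v) = (\<Sum>v\<in>S i. p i v *\<^sub>R f v)"
    if i: "i \<in> {1..m}" for i and f :: "real ^ 'n \<Rightarrow> 'b::real_vector"
  proof (rule sum.mono_neutral_right[OF S0(1)[OF i]])
    show "\<forall>v\<in>S0 i - S i. p i v *\<^sub>R f v = 0"
      using measure_nonneg[of M] by (auto simp: S_def p_def order_less_le)
  qed (auto simp: S_def)
  have u_sum: "u i = (\<Sum>v\<in>S i. p i v *\<^sub>R v)" if i: "i \<in> {1..m}" for i
    using integral_finite_support[OF X[OF i] S0(1)[OF i] S0(2)[OF i], of "\<lambda>v. v"] restrict[OF i, of "\<lambda>v. v"]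
    by (simp add: u_def p_def)
  have p_sum: "(\<Sum>v\<in>S i. p i v) = 1" if i: "i \<in> {1..m}" for i
    using integral_finite_support[OF X[OF i] S0(1)[OF i] S0(2)[OF i], of "\<lambda>v. 1 :: real"] restrict[OF i, of "\<lambda>v. 1 :: real"]
    by (simp add: p_def prob_space)
  have p_nonneg: "p i v \<ge> 0" for i v by (simp add: p_def)
  have uK: "u i \<in> Kc" if i: "i \<in> {1..m}" for i
  proof -
    have "(\<Sum>v\<in>B. p i v *\<^sub>R v) \<in> Kc" if "finite B" "B \<subseteq> S i" for B
      using that SK[OF i] p_nonneg
      by (induction B) (auto simp: Kc_0 intro!: Kc_add Kc_scaleR)
    then show ?thesis using fin[OF i] by (simp add: u_sum[OF i])
  qed
  have rank: "(D (u i) ^^ Suc r) H = (\<lambda>z. 0)" if i: "i \<in> {1..m}" for i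
  proof (rule D_power_zero[OF uK[OF i] absorb])
    fix T :: real assume "T > 0"
    have "degree (line H (T *\<^sub>R e) (u i)) \<le> rk h e (u i)"
      unfolding lineH rk_def by (rule order.trans[OF degree_smult_le degree_prod_mset_pCons_le])
    then show "degree (line H (T *\<^sub>R e) (u i)) \<le> r"
      using assms(12)[OF i] by (simp add: u_def)
  qed

  \<comment> \<open>The least \<open>lambda_max\<close> over all choices of values\<close>
  define L where "L = (\<lambda>V. lambda_max h e (\<Sum>i=1..m. V i)) ` Pi\<^sub>E {1..m} S"
  \<comment> \<open>\<open>t > \<epsilon> * \<mu>\<close> is strict so that the barrier bound
    \<open>\<epsilon> / t\<close> is below \<open>1 / \<mu>\<close>. The chosen values may vary with
    \<open>t\<close>, \<delta> and \<mu>, but \<open>Min L\<close> does not, which allows passing to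
    the limit in \<open>t\<close> and to the infimum.\<close>
  have bound: "Min L \<le> (t + (1 - 1 / real m) * \<delta>) / (1 - 1 / real m + \<mu> / real m)"
    and L: "finite L" "L \<noteq> {}"
    if U: "(\<delta>, \<mu>) \<in> U r" and t: "t > \<epsilon> * \<mu>" for t \<delta> \<mu>
  proof -
    let ?T = "(t + (1 - 1 / real m) * \<delta>) / (1 - 1 / real m + \<mu> / real m)"
    have \<mu>: "\<mu> > 0" by (rule U_bounds(2)[OF assms(3) U])
    have t0: "t > 0" using t assms(5) \<mu> by (meson less_trans mult_pos_pos)
    define l where "l = [1..<Suc m]"
    have l: "set l = {1..m}" "distinct l" by (auto simp: l_def)
    have "?T *\<^sub>R e \<in> above (rops (\<lambda>_. 1) u l H)"
      unfolding l_def
    proof (rule mixed_bound[OF assms(4,3) U uK _ rank t0])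
      show "(\<Sum>i=1..m. u i) = e" using assms(10) by (simp add: u_def)
      show "0 < \<epsilon> / t" "\<epsilon> / t < 1 / \<mu>" using assms(5) t0 \<mu> t by (simp_all add: field_simps)
      fix i assume i: "i \<in> {1..m}"
      show "ldv (u i) H (t *\<^sub>R e) \<le> \<epsilon> / t"
        unfolding ldvH[OF t0] using assms(11)[OF i] t0 by (simp add: u_def divide_right_mono)
    qed
    then have "\<exists>V. (\<forall>i\<in>set l. V i \<in> S i) \<and> ?T *\<^sub>R e \<in> above (rops (\<lambda>_. 1) V l H)"
      by (intro above_select_list[where J = "{1..m}" and p = p and u = u] fin SK p_nonneg p_sum u_sum
          stable_h l(2) equalityD1[OF l(1)])
    then obtain V where V: "\<And>i. i \<in> {1..m} \<Longrightarrow> V i \<in> S i"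
      "?T *\<^sub>R e \<in> above (rops (\<lambda>_. 1) V l H)"
      unfolding l(1) by blast
    have "?T *\<^sub>R e - (\<Sum>i\<leftarrow>l. V i) \<in> above H"
      using V(1) SK l(1) by (intro above_minus_list[OF stable_h _ V(2)]) auto
    moreover have "(\<Sum>i\<leftarrow>l. V i) = (\<Sum>i=1..m. V i)"
      using l by (simp add: sum_list_distinct_conv_sum_set)
    ultimately have above: "?T *\<^sub>R e - (\<Sum>i=1..m. V i) \<in> above H" by simp
    have "lambda_max h e (\<Sum>i=1..m. V i) \<le> ?T"
      unfolding lambda_max_le_iff[OF g assms(2)]
    proof (intro allI impI)
      fix s assume "s > ?T"
      then have "?T *\<^sub>R e - (\<Sum>i=1..m. V i) + (s - ?T) *\<^sub>R e \<in> above H"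
        by (intro above_add above Kc_scaleR e_in_Kc) simp
      moreover have "?T *\<^sub>R e - (\<Sum>i=1..m. V i) + (s - ?T) *\<^sub>R e = s *\<^sub>R e - (\<Sum>i=1..m. V i)"
        by (simp add: scaleR_diff_left)
      ultimately have "s *\<^sub>R e - (\<Sum>i=1..m. V i) \<in> above H" by metis
      from above_pos[OF this] show "evalp h (s *\<^sub>R e - (\<Sum>i=1..m. V i)) \<noteq> 0"
        by (auto simp: H_real)
    qed
    moreover have "restrict V {1..m} \<in> Pi\<^sub>E {1..m} S" using V(1) by auto
    then have "lambda_max h e (\<Sum>i=1..m. restrict V {1..m} i) \<in> L" unfolding L_def by (rule imageI)
    then have "lambda_max h e (\<Sum>i=1..m. V i) \<in> L" by simp
    moreover show "finite L" unfolding L_def by (intro finite_imageI finite_PiE fin) auto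
    ultimately show "L \<noteq> {}" "Min L \<le> ?T"
      using Min_le[of L "lambda_max h e (\<Sum>i=1..m. V i)"] by (blast, linarith)
  qed
  \<comment> \<open>\<open>L \<noteq> {}\<close> is a by-product of the bound, so it is read off at
    one member of \<open>U r\<close> and one admissible \<open>t\<close>.\<close>
  obtain \<delta>0 \<mu>0 where "(\<delta>0, \<mu>0) \<in> U r" using U_nonempty[OF assms(3)] by auto
  from L[OF this, of "\<epsilon> * \<mu>0 + 1"] have finL: "finite L" "L \<noteq> {}" by auto
  have le: "Min L \<le> delta \<epsilon> m r"
    unfolding delta_def
  proof (rule cINF_greatest[OF U_nonempty[OF assms(3)]], clarify)
    fix \<delta> \<mu> assume U: "(\<delta>, \<mu>) \<in> U r"
    define b where "b = 1 - 1 / real m + \<mu> / real m"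
    have "1 / real m \<le> 1" using assms(4) by simp
    moreover have "\<mu> / real m > 0" using U_bounds(2)[OF assms(3) U] assms(4) by simp
    ultimately have b: "b > 0" by (simp add: b_def)
    \<comment> \<open>The bound holds for every \<open>t > \<epsilon> * \<mu>\<close>, hence also at
      \<open>t = \<epsilon> * \<mu>\<close>.\<close>
    have "Min L * b - (1 - 1 / real m) * \<delta> \<le> \<epsilon> * \<mu>"
    proof (rule dense_ge)
      fix t assume "\<epsilon> * \<mu> < t"
      from bound[OF U this] show "Min L * b - (1 - 1 / real m) * \<delta> \<le> t"
        using b by (simp add: b_def[symmetric] pos_le_divide_eq)
    qed
    then show "Min L \<le> (\<epsilon> * \<mu> + (1 - 1 / real m) * \<delta>) / (1 - 1 / real m + \<mu> / real m)"
      using b by (simp add: b_def[symmetric] pos_le_divide_eq)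
  qed

  \<comment> \<open>Positive probability by independence\<close>
  obtain V where V: "V \<in> Pi\<^sub>E {1..m} S" "lambda_max h e (\<Sum>i=1..m. V i) = Min L"
    using Min_in[OF finL] unfolding L_def by auto
  have "0 < (\<Prod>i=1..m. p i (V i))"
    using V(1) by (intro prod_pos) (auto simp: S_def PiE_iff)
  also have "\<dots> = prob (\<Inter>i\<in>{1..m}. X i -` {V i} \<inter> space M)"
    unfolding p_def using assms(4) by (intro indep_varsD_finite[OF assms(7), symmetric]) auto
  also have "\<dots> \<le> prob {\<omega> \<in> space M. lambda_max h e (\<Sum>i=1..m. X i \<omega>) \<le> delta \<epsilon> m r}"
  proof (rule finite_measure_mono)
    show "(\<Inter>i\<in>{1..m}. X i -` {V i} \<inter> space M) \<subseteq>
        {\<omega> \<in> space M. lambda_max h e (\<Sum>i=1..m. X i \<omega>) \<le> delta \<epsilon> m r}"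
    proof
      fix \<omega> assume \<omega>: "\<omega> \<in> (\<Inter>i\<in>{1..m}. X i -` {V i} \<inter> space M)"
      then have "(\<Sum>i=1..m. X i \<omega>) = (\<Sum>i=1..m. V i)" by (intro sum.cong) auto
      moreover have "\<omega> \<in> space M" using \<omega> assms(4) by auto
      ultimately show "\<omega> \<in> {\<omega> \<in> space M. lambda_max h e (\<Sum>i=1..m. X i \<omega>) \<le> delta \<epsilon> m r}"
        using le V(2) by simp
    qed
    have "(\<lambda>\<omega>. \<Sum>i=1..m. X i \<omega>) \<in> borel_measurable M"
      using X by (intro borel_measurable_sum) auto
    from measurable_sets[OF this lambda_max_le_borel[OF g assms(2)]]
    show "{\<omega> \<in> space M. lambda_max h e (\<Sum>i=1..m. X i \<omega>) \<le> delta \<epsilon> m r} \<in> sets M"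
      by (simp add: vimage_def Int_def conj_commute)
  qed
  finally show ?thesis .
qed

end
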